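(* Let $(X,T)$ be a minimal topological dynamical system with maximal equicontinuous factor map $\pi_{eq}:X\to X_{eq}$. Then $\pi_{eq}$ is isomorphic and almost 1-1 if and only if $(X,T)$ is mean equicontinuous and frequently stable.
   Context: A topological dynamical system (t.d.s.) $(X,T)$ is a compact metric space $X$ (metric $d$) with a continuous map $T:X\to X$. It is minimal if every forward orbit is dense in $X$. It is equicontinuous if the family $\{T^n:n\in\mathbb{Z}_+\}$ is equicontinuous. A factor of $(X,T)$ is a t.d.s. $(X',T')$ with a continuous surjection $f:X\to X'$ (the factor map) satisfying $f\circ T=T'\circ f$. The maximal equicontinuous factor $(X_{eq},T_{eq})$, with factor map $\pi_{eq}$, is the (unique up to conjugacy) equicontinuous factor of $(X,T)$ such that every other equicontinuous factor of $(X,T)$ is a factor of it. If $(X,T)$ is minimal, $(X_{eq},T_{eq})$ is minimal and uniquely ergodic, with unique invariant Borel probability measure $\nu_{eq}$. $\pi_{eq}$ is isomorphic if $(X,T)$ has a unique invariant Borel probability measure $\mu$ and $\pi_{eq}$ is a measure-theoretic isomorphism between $(X,T,\mu)$ and $(X_{eq},T_{eq},\nu_{eq})$. $\pi_{eq}$ is almost 1-1 if $\{y\in X_{eq}:\#\pi_{eq}^{-1}(y)=1\}$ is residual in $X_{eq}$. $(X,T)$ is mean equicontinuous if for every $\varepsilon>0$ there is $\delta>0$ such that $d(x,y)\le\delta$ implies $\limsup_{n\to\infty}\frac1n\sum_{i=1}^n d(T^ix,T^iy)\le\varepsilon$. For $F\subset\mathbb{Z}_+$, $\overline{D}(F)=\limsup_{n\to\infty}\frac{\#(F\cap[0,n-1])}{n}$.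 $B_\delta(x)$ is the open ball of radius $\delta$ about $x$. A point $x\in X$ is frequently stable if for every $\varepsilon>0$ there is $\delta>0$ with $\overline{D}\{i\in\mathbb{Z}_+:\operatorname{diam}(T^iB_\delta(x))>\varepsilon\}<1$; $(X,T)$ is frequently stable if every $x\in X$ is frequently stable. *)

theory Defs
  imports "HOL-Probability.Probability"
begin

text \<open>
  Systems are carried by a subset of a metric space type; values of the map outside the carrier are
  irrelevant. The empty system is excluded.
\<close>

definition tds :: "'a::metric_space set \<Rightarrow> ('a \<Rightarrow> 'a) \<Rightarrow> bool" where
  "tds X T \<longleftrightarrow> X \<noteq> {} \<and> compact X \<and> continuous_on X T \<and> T ` X \<subseteq> X"

definition minimal_tds :: "'a::metric_space set \<Rightarrow> ('a \<Rightarrow> 'a) \<Rightarrow> bool" where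
  "minimal_tds X T \<longleftrightarrow> (\<forall>x\<in>X. X \<subseteq> closure (range (\<lambda>n. (T ^^ n) x)))"

definition equicontinuous_tds :: "'a::metric_space set \<Rightarrow> ('a \<Rightarrow> 'a) \<Rightarrow> bool" where
  "equicontinuous_tds X T \<longleftrightarrow>
     (\<forall>\<epsilon>>0. \<exists>\<delta>>0. \<forall>x\<in>X. \<forall>y\<in>X. dist x y < \<delta> \<longrightarrow>
        (\<forall>n. dist ((T ^^ n) x) ((T ^^ n) y) < \<epsilon>))"

definition factor_map ::
  "'a::metric_space set \<Rightarrow> ('a \<Rightarrow> 'a) \<Rightarrow> 'b::metric_space set \<Rightarrow> ('b \<Rightarrow> 'b) \<Rightarrow> ('a \<Rightarrow> 'b) \<Rightarrow> bool"
  where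
  "factor_map X T Y S f \<longleftrightarrow>
     continuous_on X f \<and> f ` X = Y \<and> (\<forall>x\<in>X. f (T x) = S (f x))"

text \<open>
  HOL cannot quantify over the type carrying the competing factor \<open>Z\<close>, so \<open>Z\<close> ranges over compact
  subsets of the metric space \<open>nat \<Rightarrow> real\<close> (with the product topology). Every compact metric space
  is homeomorphic to such a set, and equicontinuity of a compact system is a conjugacy invariant;
  the lemma \<open>maximal_equicontinuous_factorD\<close> below recovers maximality among the equicontinuous
  factors carried by an arbitrary metric space type.
\<close>

definition maximal_equicontinuous_factor ::
  "'a::metric_space set \<Rightarrow> ('a \<Rightarrow> 'a) \<Rightarrow> 'b::metric_space set \<Rightarrow> ('b \<Rightarrow> 'b) \<Rightarrow> ('a \<Rightarrow> 'b) \<Rightarrow> bool"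
  where
  "maximal_equicontinuous_factor X T Y S p \<longleftrightarrow>
     tds Y S \<and> equicontinuous_tds Y S \<and> factor_map X T Y S p \<and>
     (\<forall>(Z :: (nat \<Rightarrow> real) set) R g.
        tds Z R \<and> equicontinuous_tds Z R \<and> factor_map X T Z R g \<longrightarrow>
        (\<exists>h. factor_map Y S Z R h))"

lemma compact_embedding_nat_real:
  fixes Z :: "'c::metric_space set"
  assumes "compact Z"
  obtains e :: "'c \<Rightarrow> nat \<Rightarrow> real" and r where "homeomorphism Z (e ` Z) e r"
proof (cases "Z = {}")
  case True
  then show ?thesis
    using that[of undefined undefined] by (simp add: homeomorphism_def)
next
  case False
  obtain Q where Q: "countable Q" "Q \<subseteq> Z" "Z \<subseteq> closure Q"
  proof -
    have "\<forall>n::nat. \<exists>F. finite F \<and> F \<subseteq> Z \<and> Z \<subseteq> (\<Union>x\<in>F. ball x (1 / Suc n))"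
    proof
      fix n :: nat
      have "0 < 1 / real (Suc n)" by simp
      then show "\<exists>F. finite F \<and> F \<subseteq> Z \<and> Z \<subseteq> (\<Union>x\<in>F. ball x (1 / Suc n))"
        using compact_imp_seq_compact[OF assms] seq_compact_imp_totally_bounded by blast
    qed
    then obtain F where F: "\<And>n. finite (F n)" "\<And>n. F n \<subseteq> Z"
      "\<And>n::nat. Z \<subseteq> (\<Union>x\<in>F n. ball x (1 / Suc n))" by metis
    show ?thesis
    proof (rule that[of "\<Union>n. F n"])
      show "countable (\<Union>n. F n)" using F(1) by (simp add: countable_finite)
      show "(\<Union>n. F n) \<subseteq> Z" using F(2) by blast
      show "Z \<subseteq> closure (\<Union>n. F n)"
      proof
        fix z assume z: "z \<in> Z"
        show "z \<in> closure (\<Union>n. F n)"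
          unfolding closure_approachable
        proof (intro allI impI)
          fix \<epsilon> :: real assume "0 < \<epsilon>"
          then obtain n where n: "1 / real (Suc n) < \<epsilon>" using nat_approx_posE by blast
          from F(3)[of n] z obtain x where "x \<in> F n" "dist x z < 1 / Suc n" by auto
          then show "\<exists>y\<in>\<Union>n. F n. dist y z < \<epsilon>" using n by (meson UN_I UNIV_I less_trans)
        qed
      qed
    qed
  qed
  have "Q \<noteq> {}" using False Q(3) by auto
  define q where "q = from_nat_into Q"
  have rq: "range q = Q" unfolding q_def using Q(1) \<open>Q \<noteq> {}\<close> by (rule range_from_nat_into[rotated])
  define e where "e = (\<lambda>z n. dist z (q n))"
  have ce: "continuous_on Z e"
    unfolding e_def by (intro continuous_on_coordinatewise_then_product continuous_intros)
  have ie: "inj_on e Z"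
  proof (rule inj_onI)
    fix x y assume xy: "x \<in> Z" "y \<in> Z" "e x = e y"
    have "dist x y < \<epsilon>" if "\<epsilon> > 0" for \<epsilon>
    proof -
      have "0 < \<epsilon> / 2" "x \<in> closure Q" using that xy Q(3) by auto
      then obtain w where w: "w \<in> Q" "dist w x < \<epsilon> / 2" unfolding closure_approachable by blast
      then obtain n where "w = q n" using rq by blast
      then have "dist x w = dist y w" using xy(3) unfolding e_def by meson
      then show ?thesis using w dist_triangle3[of x y w]
        by (metis dist_commute dist_triangle_half_l)
    qed
    then show "x = y" by (metis dist_self less_irrefl zero_less_dist_iff)
  qed
  show ?thesis using homeomorphism_compact[OF assms ce refl ie] that by blast
qed

lemma maximal_equicontinuous_factorD:
  fixes Z :: "'c::metric_space set"
  assumes max: "maximal_equicontinuous_factor X T Y S p"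
    and Z: "tds Z R" "equicontinuous_tds Z R" "factor_map X T Z R g"
  shows "\<exists>h. factor_map Y S Z R h"
proof -
  from Z(1) have cZ: "compact Z" "Z \<noteq> {}" "continuous_on Z R" "R ` Z \<subseteq> Z" by (auto simp: tds_def)
  obtain e :: "'c \<Rightarrow> nat \<Rightarrow> real" and r where hom: "homeomorphism Z (e ` Z) e r"
    using compact_embedding_nat_real[OF cZ(1)] .
  have ce: "continuous_on Z e" and cr: "continuous_on (e ` Z) r"
    and re: "\<And>z. z \<in> Z \<Longrightarrow> r (e z) = z" using hom by (auto simp: homeomorphism_def)
  have cW: "compact (e ` Z)" using ce cZ(1) by (rule compact_continuous_image)
  define R' where "R' = e \<circ> R \<circ> r"
  have R'e: "R' (e z) = e (R z)" if "z \<in> Z" for z using that by (simp add: R'_def re)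
  have RZ: "(R ^^ n) z \<in> Z" if "z \<in> Z" for n z
    using that cZ(4) by (induction n) auto
  have R'n: "(R' ^^ n) (e z) = e ((R ^^ n) z)" if "z \<in> Z" for n z
    using that by (induction n) (auto simp: R'e RZ)
  have 1: "tds (e ` Z) R'"
    unfolding tds_def
  proof (intro conjI)
    have "r ` e ` Z = Z" by (force simp: re image_iff)
    then show "continuous_on (e ` Z) R'" unfolding R'_def
      using cr cZ ce by (metis continuous_on_compose continuous_on_subset comp_assoc image_comp)
    show "R' ` e ` Z \<subseteq> e ` Z" using cZ(4) by (auto simp: R'e)
  qed (use cW cZ in auto)
  have 2: "equicontinuous_tds (e ` Z) R'"
    unfolding equicontinuous_tds_def
  proof (intro allI impI)
    fix \<epsilon> :: real assume "\<epsilon> > 0"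
    from compact_uniformly_continuous[OF ce cZ(1)] this obtain a where a: "a > 0"
      "\<And>x y. x \<in> Z \<Longrightarrow> y \<in> Z \<Longrightarrow> dist x y < a \<Longrightarrow> dist (e x) (e y) < \<epsilon>"
      unfolding uniformly_continuous_on_def by metis
    from Z(2) a(1) obtain b where b: "b > 0"
      "\<And>x y n. x \<in> Z \<Longrightarrow> y \<in> Z \<Longrightarrow> dist x y < b \<Longrightarrow> dist ((R ^^ n) x) ((R ^^ n) y) < a"
      unfolding equicontinuous_tds_def by metis
    from compact_uniformly_continuous[OF cr cW] b(1) obtain c where c: "c > 0"
      "\<And>x y. x \<in> e ` Z \<Longrightarrow> y \<in> e ` Z \<Longrightarrow> dist x y < c \<Longrightarrow> dist (r x) (r y) < b"
      unfolding uniformly_continuous_on_def by metis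
    show "\<exists>\<delta>>0. \<forall>x\<in>e ` Z. \<forall>y\<in>e ` Z. dist x y < \<delta> \<longrightarrow> (\<forall>n. dist ((R' ^^ n) x) ((R' ^^ n) y) < \<epsilon>)"
    proof (intro exI[of _ c] conjI ballI impI allI)
      fix x y n assume "x \<in> e ` Z" "y \<in> e ` Z" and d: "dist x y < c"
      then obtain u v where uv: "u \<in> Z" "v \<in> Z" "x = e u" "y = e v" by blast
      then have "dist u v < b" using c(2)[of x y] d by (simp add: re)
      then show "dist ((R' ^^ n) x) ((R' ^^ n) y) < \<epsilon>"
        using uv a(2) b(2) by (simp add: R'n RZ)
    qed (use c in auto)
  qed
  have 3: "factor_map X T (e ` Z) R' (e \<circ> g)"
    unfolding factor_map_def
  proof (intro conjI ballI)
    show "continuous_on X (e \<circ> g)"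
      using Z(3) ce unfolding factor_map_def by (metis continuous_on_compose)
    show "(e \<circ> g) ` X = e ` Z"
      using Z(3) unfolding factor_map_def by (metis image_comp)
    show "(e \<circ> g) (T x) = R' ((e \<circ> g) x)" if "x \<in> X" for x
      using Z(3) that unfolding factor_map_def by (auto simp: R'e)
  qed
  obtain h where h: "factor_map Y S (e ` Z) R' h"
    using max 1 2 3 unfolding maximal_equicontinuous_factor_def by blast
  have "factor_map Y S Z R (r \<circ> h)"
    unfolding factor_map_def
  proof (intro conjI ballI)
    show "continuous_on Y (r \<circ> h)" using h cr unfolding factor_map_def
      by (metis continuous_on_compose)
    have "(r \<circ> h) ` Y = r ` e ` Z" using h unfolding factor_map_def by (metis image_comp)
    then show "(r \<circ> h) ` Y = Z" by (force simp: re image_iff)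
    fix y assume y: "y \<in> Y"
    then obtain z where z: "z \<in> Z" "h y = e z" using h unfolding factor_map_def by blast
    then show "(r \<circ> h) (S y) = R ((r \<circ> h) y)"
      using h y cZ(4) unfolding factor_map_def by (metis R'e comp_apply image_subset_iff re)
  qed
  then show ?thesis by blast
qed

definition invariant_prob :: "'a::metric_space set \<Rightarrow> ('a \<Rightarrow> 'a) \<Rightarrow> 'a measure \<Rightarrow> bool" where
  "invariant_prob X T \<mu> \<longleftrightarrow>
     prob_space \<mu> \<and> sets \<mu> = sets (restrict_space borel X) \<and> distr \<mu> \<mu> T = \<mu>"

definition measure_theoretic_isomorphism ::
  "'a measure \<Rightarrow> ('a \<Rightarrow> 'a) \<Rightarrow> 'b measure \<Rightarrow> ('b \<Rightarrow> 'b) \<Rightarrow> ('a \<Rightarrow> 'b) \<Rightarrow> bool" where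
  "measure_theoretic_isomorphism \<mu> T \<nu> S f \<longleftrightarrow>
     f \<in> measurable \<mu> \<nu> \<and> distr \<mu> \<nu> f = \<nu> \<and>
     (\<exists>A\<in>sets \<mu>. \<exists>B\<in>sets \<nu>.
        emeasure \<mu> (space \<mu> - A) = 0 \<and> emeasure \<nu> (space \<nu> - B) = 0 \<and>
        T ` A \<subseteq> A \<and> S ` B \<subseteq> B \<and> (\<forall>x\<in>A. f (T x) = S (f x)) \<and>
        bij_betw f A B \<and>
        inv_into A f \<in> measurable (restrict_space \<nu> B) (restrict_space \<mu> A))"

definition isomorphic_factor_map ::
  "'a::metric_space set \<Rightarrow> ('a \<Rightarrow> 'a) \<Rightarrow> 'b::metric_space set \<Rightarrow> ('b \<Rightarrow> 'b) \<Rightarrow> ('a \<Rightarrow> 'b) \<Rightarrow> bool"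
  where
  "isomorphic_factor_map X T Y S p \<longleftrightarrow>
     (\<exists>\<mu> \<nu>. {m. invariant_prob X T m} = {\<mu>} \<and> {m. invariant_prob Y S m} = {\<nu>} \<and>
        measure_theoretic_isomorphism \<mu> T \<nu> S p)"

definition residual_in :: "'a::topological_space set \<Rightarrow> 'a set \<Rightarrow> bool" where
  "residual_in Y A \<longleftrightarrow>
     A \<subseteq> Y \<and>
     (\<exists>U :: nat \<Rightarrow> 'a set.
        (\<forall>n. openin (top_of_set Y) (U n) \<and> Y \<subseteq> closure (U n)) \<and> (\<Inter>n. U n) \<subseteq> A)"

definition almost_one_to_one :: "'a set \<Rightarrow> 'b::metric_space set \<Rightarrow> ('a \<Rightarrow> 'b) \<Rightarrow> bool" where
  "almost_one_to_one X Y p \<longleftrightarrow> residual_in Y {y\<in>Y. card {x\<in>X. p x = y} = 1}"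

definition mean_equicontinuous :: "'a::metric_space set \<Rightarrow> ('a \<Rightarrow> 'a) \<Rightarrow> bool" where
  "mean_equicontinuous X T \<longleftrightarrow>
     (\<forall>\<epsilon>>0. \<exists>\<delta>>0. \<forall>x\<in>X. \<forall>y\<in>X. dist x y \<le> \<delta> \<longrightarrow>
        limsup (\<lambda>n. ereal ((\<Sum>i=1..n. dist ((T ^^ i) x) ((T ^^ i) y)) / real n)) \<le> ereal \<epsilon>)"

definition upper_density :: "nat set \<Rightarrow> ereal" where
  "upper_density F = limsup (\<lambda>n. ereal (real (card (F \<inter> {..<n})) / real n))"

definition frequently_stable_point :: "'a::metric_space set \<Rightarrow> ('a \<Rightarrow> 'a) \<Rightarrow> 'a \<Rightarrow> bool" where
  "frequently_stable_point X T x \<longleftrightarrow>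
     (\<forall>\<epsilon>>0. \<exists>\<delta>>0. upper_density {i. diameter ((T ^^ i) ` (X \<inter> ball x \<delta>)) > \<epsilon>} < 1)"

definition frequently_stable :: "'a::metric_space set \<Rightarrow> ('a \<Rightarrow> 'a) \<Rightarrow> bool" where
  "frequently_stable X T \<longleftrightarrow> (\<forall>x\<in>X. frequently_stable_point X T x)"

end

theory Submission
  imports Defs
begin

text \<open>
  For the mean equicontinuous direction, \<open>D(x,y) = limsup\<^sub>n 1/n \<Sum>\<^sub>i d(T\<^sup>i x, T\<^sup>i y)\<close> is a continuous
  \<open>T\<close>-invariant pseudometric, and the quotient by \<open>D\<close> is an equicontinuous factor, so \<open>D\<close> vanishes on
  the fibres of the maximal one. With the invariant measure \<open>\<mu>\<close>, the density \<open>max 0 (e - D(x,y))\<close> on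
  \<open>X \<times> X\<close> defines \<open>T \<times> T\<close>-invariant couplings concentrated near the fibres. Their integral of \<open>d\<close> equals
  that of its averages, hence is small. So \<open>d(\<cdot>,u)\<close> is an \<open>L\<^sup>1\<close>-limit of functions of \<open>\<pi>_eq\<close>, which
  gives a Borel inverse of \<open>\<pi>_eq\<close> almost everywhere. If moreover a ball \<open>B\<close> is frequently stable, points
  whose fibre meets \<open>B\<close> follow \<open>T\<^sup>i B\<close> on average, so along suitable \<open>i\<close> a \<open>D\<close>-ball of fixed radius is
  carried into a small set up to small measure; in the limit a whole \<open>D\<close>-ball has small diameter, and
  the fibres of small diameter are dense and open.

  Conversely, an isomorphic factor map forces every invariant coupling of \<open>\<mu>\<close> with itself over the
  factor to live on the diagonal, which gives mean equicontinuity; frequent stability holds because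
  every orbit in the factor returns syndetically to a neighbourhood of a point with singleton fibre.
\<close>

section \<open>Weak limits of empirical measures\<close>

text \<open>Disintegrating \<open>\<mu>\<close> over the factor is avoided. The cut-off
  \<open>max 0 (e - D)\<close> stands in for the conditional measures: it is continuous and
  invariant, so it can be integrated section by section without exceptional null sets, and
  minimality gives it the same mass at every point, so one constant normalises it. The obstacle is
  to pass from statements on average or almost everywhere to statements about every point. Two facts
  do this. An invariant measure of a minimal system charges every nonempty relatively open set, so a
  nonnegative continuous function with integral 0 vanishes identically. And \<open>T\<close> is a
  surjective isometry for \<open>D\<close>, so a \<open>D\<close>-ball keeps its radius when moved
  along an orbit; this is why the limit taken in the frequent stability argument still controls a
  ball and not only a fibre. Invariant measures and the joinings of the converse arise as limits of
  empirical measures, obtained by coding a compact metric space by a compact set of reals.\<close>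

text \<open>A whole binary sequence is stored in one real with base-6 digits 0 and 2, and
  \<open>cos (2 * pi * (6 ^ m * t))\<close> reads one digit. The gap between 1/2 and -1/2 makes the
  two tests closed and disjoint, at the price that some reals pass neither.\<close>

lemma separated_binary_digit_sets:
  obtains C :: "bool \<Rightarrow> nat \<Rightarrow> real set"
  where "\<And>b m. closed (C b m)" "\<And>m. C True m \<inter> C False m = {}"
    "\<And>s. \<exists>t\<in>{0..1}. \<forall>m. t \<in> C (s m) m"
proof
  define c where "c m t = cos (2 * pi * (6 ^ m * t))" for m and t :: real
  define C where "C b m = (if b then {t. c m t \<ge> 1 / 2} else {t. c m t \<le> - 1 / 2})" for b m
  have cont: "continuous_on UNIV (c m)" for m
    unfolding c_def by (intro continuous_intros)
  show "closed (C b m)" for b m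
    using cont[of m] by (auto simp: C_def intro!: closed_Collect_le continuous_intros)
  show "C True m \<inter> C False m = {}" for m
    by (auto simp: C_def)
  show "\<exists>t\<in>{0..1}. \<forall>m. t \<in> C (s m) m" for s
  proof -
    \<comment> \<open>Digit 0 puts the phase in [0, pi/3], digit 2 in [2 pi/3, pi]. The later digits
      add at most 2/5 of a unit of the current place, which does not leave these arcs.\<close>
    define d :: "nat \<Rightarrow> real" where "d m = (if s m then 0 else 2)" for m
    define u where "u m = d m * (1 / 6) ^ Suc m" for m
    have geo: "(\<lambda>j. 2 * (1 / 6) ^ Suc j :: real) sums (2 / 5)"
      using sums_mult[OF geometric_sums[of "1 / 6 :: real"], of "1 / 3"] by simp
    have tail: "summable (\<lambda>j. d (j + m) * (1 / 6) ^ Suc j)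
        \<and> (\<Sum>j. d (j + m) * (1 / 6) ^ Suc j) \<in> {0..2/5}" for m
    proof -
      have le: "norm (d (j + m) * (1 / 6) ^ Suc j) \<le> 2 * (1 / 6) ^ Suc j" for j
        by (auto simp: d_def)
      have s: "summable (\<lambda>j. d (j + m) * (1 / 6) ^ Suc j)"
        using le by (rule summable_comparison_test'[OF sums_summable[OF geo]])
      have "(\<Sum>j. d (j + m) * (1 / 6) ^ Suc j) \<le> (\<Sum>j. 2 * (1 / 6 :: real) ^ Suc j)"
        using le by (intro suminf_le s sums_summable[OF geo]) (auto simp: d_def)
      moreover have "0 \<le> (\<Sum>j. d (j + m) * (1 / 6) ^ Suc j)"
        by (intro suminf_nonneg s) (auto simp: d_def)
      ultimately show ?thesis using s sums_unique[OF geo] by simp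
    qed
    define t where "t = suminf u"
    have su: "summable u" using tail[of 0] unfolding u_def by simp
    have "t \<in> {0..1}" using tail[of 0] unfolding t_def u_def by auto
    moreover have "t \<in> C (s m) m" for m
    proof -
      define w where "w = (\<Sum>j. d (j + Suc m) * (1 / 6) ^ Suc j)"
      have w: "w \<in> {0..2/5}" "summable (\<lambda>j. d (j + Suc m) * (1 / 6) ^ Suc j)"
        using tail[of "Suc m"] by (auto simp: w_def)
      have e: "6 ^ m * u (j + Suc m) = 1 / 6 * (d (j + Suc m) * (1 / 6) ^ Suc j)" for j
        by (simp add: u_def power_add field_simps)
      have "6 ^ m * (\<Sum>j. u (j + Suc m)) = (\<Sum>j. 6 ^ m * u (j + Suc m))"
        using su summable_ignore_initial_segment by (intro suminf_mult[symmetric]) blast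
      also have "\<dots> = w / 6"
        unfolding e w_def using w(2) by (subst suminf_mult) auto
      finally have tl: "6 ^ m * (\<Sum>j. u (j + Suc m)) = w / 6" .
      have "\<exists>k::int. 6 ^ m * u i = of_int k" if "i < m" for i
      proof -
        have "(6::real) ^ m = 6 ^ Suc i * 6 ^ (m - Suc i)"
          using that by (metis Suc_leI le_add_diff_inverse power_add)
        then have "6 ^ m * u i = d i * 6 ^ (m - Suc i)"
          by (simp add: u_def power_divide)
        then show ?thesis
          by (intro exI[of _ "(if s i then 0 else 2) * 6 ^ (m - Suc i)"]) (simp add: d_def)
      qed
      then obtain k :: "nat \<Rightarrow> int" where k: "\<And>i. i < m \<Longrightarrow> 6 ^ m * u i = of_int (k i)" by metis
      have "t = (\<Sum>i<m. u i) + u m + (\<Sum>j. u (j + Suc m))"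
        unfolding t_def using suminf_split_initial_segment[OF su, of "Suc m"] by simp
      then have "6 ^ m * t = (\<Sum>i<m. 6 ^ m * u i) + 6 ^ m * u m + 6 ^ m * (\<Sum>j. u (j + Suc m))"
        by (simp add: distrib_left sum_distrib_left)
      also have "\<dots> = of_int (\<Sum>i<m. k i) + d m / 6 + w / 6"
        unfolding tl using k by (simp add: u_def power_divide)
      finally have "2 * pi * (6 ^ m * t) = 2 * pi * (d m / 6 + w / 6) + 2 * pi * of_int (\<Sum>i<m. k i)"
        by (simp add: algebra_simps)
      then have c: "c m t = cos (2 * pi * (d m / 6 + w / 6))"
        using cos.plus_of_int[of "2 * pi * (d m / 6 + w / 6)" "\<Sum>i<m. k i"]
        by (simp only: c_def mult.commute[of "of_int _"] of_real_eq_id id_apply)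
      show ?thesis
      proof (cases "s m")
        case True
        have "2 * pi * (w / 6) \<le> pi / 3" using w(1) by (simp add: field_simps)
        then have "cos (2 * pi * (w / 6)) \<ge> cos (pi / 3)"
          using w(1) by (intro cos_monotone_0_pi_le) auto
        then show ?thesis using True by (simp add: C_def c d_def cos_60)
      next
        case False
        have "2 * pi * (1 / 3 + w / 6) \<ge> 2 * pi / 3" "2 * pi * (1 / 3 + w / 6) \<le> pi" 
          using w(1) by (auto simp: field_simps)
        then have "cos (2 * pi * (1 / 3 + w / 6)) \<le> cos (2 * pi / 3)"
          by (intro cos_monotone_0_pi_le) auto
        then show ?thesis using False by (simp add: C_def c d_def cos_120)
      qed
    qed
    ultimately show ?thesis by blast
  qed
qed

text \<open>A point is coded by comparing each coordinate \<open>e x n\<close> with each rational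
  \<open>q\<close>. In case of equality both answers are allowed, so the relation \<open>G\<close>
  between codes and points is closed, hence compact. A code determines all coordinates, so
  \<open>fst\<close> embeds \<open>G\<close> in the line, and \<open>\<phi>\<close> is the second
  projection read through this embedding.\<close>

lemma compact_metric_image_of_compact_real:
  fixes X :: "'a::metric_space set"
  assumes "compact X"
  obtains K :: "real set" and \<phi> where "compact K" "continuous_on K \<phi>" "\<phi> ` K = X"
proof -
  obtain e :: "'a \<Rightarrow> nat \<Rightarrow> real" and r where hom: "homeomorphism X (e ` X) e r"
    using compact_embedding_nat_real[OF assms] .
  then have ce: "continuous_on X e" and inj: "inj_on e X"
    by (auto simp: homeomorphism_def intro: inj_on_inverseI)
  have cn: "continuous_on X (\<lambda>x. e x n)" for n
    using ce by (rule continuous_on_product_then_coordinatewise)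
  obtain C :: "bool \<Rightarrow> nat \<Rightarrow> real set" where C: "\<And>b m. closed (C b m)"
      "\<And>m. C True m \<inter> C False m = {}" "\<And>s. \<exists>t\<in>{0..1}. \<forall>m. t \<in> C (s m) m"
    using separated_binary_digit_sets by blast
  define A where "A b m = (let (n, q) = from_nat m :: nat \<times> rat in
      {x \<in> X. if b then of_rat q \<le> e x n else e x n \<le> of_rat q})" for b m
  have cA: "closed (A b m)" for b m
  proof -
    obtain n q where m: "from_nat m = (n :: nat, q :: rat)" by fastforce
    have "closed {x \<in> X. of_rat q \<le> e x n}" "closed {x \<in> X. e x n \<le> of_rat q}"
      using cn[of n] compact_imp_closed[OF assms]
      by (auto intro!: continuous_closed_preimage continuous_on_closed_Collect_le continuous_intros)
    then show ?thesis by (cases b) (simp_all add: A_def m)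
  qed
  define G where "G = ({0..1} \<times> X) \<inter> (\<Inter>m. C True m \<times> A True m \<union> C False m \<times> A False m)"
  have cG: "compact G"
    unfolding G_def using assms C(1) cA
    by (intro compact_Int_closed compact_Times closed_INT ballI closed_Un closed_Times) auto
  have "inj_on fst G"
  proof (rule inj_onI)
    fix v w assume v: "v \<in> G" and w: "w \<in> G" and eq: "fst v = fst w"
    obtain t x y where vw: "v = (t, x)" "w = (t, y)" using eq by (metis prod.collapse)
    have False if lt: "e x n < e y n" and xy: "(t, x) \<in> G" "(t, y) \<in> G" for x y n
    proof -
      obtain q where q: "e x n < of_rat q" "of_rat q < e y n" using of_rat_dense[OF lt] by blast
      obtain m where m: "from_nat m = (n, q)" using from_nat_to_nat by blast
      have "(t, x) \<in> C True m \<times> A True m \<union> C False m \<times> A False m"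
        "(t, y) \<in> C True m \<times> A True m \<union> C False m \<times> A False m"
        using xy by (auto simp: G_def)
      then show False using q C(2)[of m] by (auto simp: A_def m)
    qed
    then have "e x n = e y n" for n using v w vw by (metis linorder_neqE_linordered_idom)
    then have "e x = e y" by blast
    then have "x = y" using inj v w vw by (auto simp: G_def inj_on_def)
    then show "v = w" using vw by simp
  qed
  then obtain g where g: "homeomorphism G (fst ` G) fst g"
    using homeomorphism_compact[OF cG continuous_on_fst[OF continuous_on_id] refl] by auto
  have "snd ` G = X"
  proof
    show "X \<subseteq> snd ` G"
    proof
      fix x assume x: "x \<in> X"
      have "\<exists>b. x \<in> A b m" for m
      proof -
        obtain n q where m: "from_nat m = (n :: nat, q :: rat)" by fastforce
        show ?thesis by (rule exI[of _ "of_rat q \<le> e x n"]) (use x m in \<open>auto simp: A_def\<close>)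
      qed
      then obtain s where s: "\<And>m. x \<in> A (s m) m" by metis
      then obtain t where t: "t \<in> {0..1}" "\<forall>m. t \<in> C (s m) m" using C(3) by blast
      have "(t, x) \<in> C True m \<times> A True m \<union> C False m \<times> A False m" for m
        using s[of m] t(2)[rule_format, of m] by (cases "s m") auto
      then have "(t, x) \<in> G" using t x by (auto simp: G_def)
      then show "x \<in> snd ` G" by force
    qed
  qed (auto simp: G_def)
  moreover have "snd ` G = (snd \<circ> g) ` fst ` G"
    using g unfolding homeomorphism_def by (metis image_comp)
  moreover have "continuous_on (fst ` G) (snd \<circ> g)"
    using g by (intro continuous_on_compose continuous_on_snd) (auto simp: homeomorphism_def)
  moreover have "compact (fst ` G)"
    using cG by (intro compact_continuous_image continuous_on_fst continuous_on_id)
  ultimately show ?thesis using that by metis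
qed

section \<open>Borel measures on a compact carrier\<close>

lemma space_restrict_borel_eq:
  "sets M = sets (restrict_space borel X) \<Longrightarrow> space M = X"
  using sets_eq_imp_space_eq[of M "restrict_space borel X"] by (simp add: space_restrict_space)

lemma continuous_on_borel_measurable_restrict:
  assumes "sets M = sets (restrict_space borel X)" "continuous_on X f"
  shows "f \<in> borel_measurable M"
  using borel_measurable_continuous_on_restrict[OF assms(2)] measurable_cong_sets[OF assms(1) refl]
  by blast

lemma continuous_on_measurable_restrict:
  assumes "sets M = sets (restrict_space borel X)" "sets N = sets (restrict_space borel Y)"
    "continuous_on X f" "f ` X \<subseteq> Y"
  shows "f \<in> measurable M N"
proof -
  have "f \<in> measurable M (restrict_space borel Y)"
    using assms space_restrict_borel_eq[OF assms(1)]
    by (intro measurable_restrict_space2 continuous_on_borel_measurable_restrict) auto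
  then show ?thesis using measurable_cong_sets[OF refl assms(2)] by blast
qed

lemma continuous_on_compact_bounded_real:
  fixes f :: "'a::topological_space \<Rightarrow> real"
  assumes "compact X" "continuous_on X f"
  obtains B where "B \<ge> 0" "\<And>x. x \<in> X \<Longrightarrow> \<bar>f x\<bar> \<le> B"
proof -
  obtain B where "\<forall>y\<in>f ` X. \<bar>y\<bar> \<le> B"
    using compact_imp_bounded[OF compact_continuous_image[OF assms(2,1)]]
    by (auto simp: bounded_iff)
  then show ?thesis by (intro that[of "max 0 B"]) (auto simp: le_max_iff_disj)
qed

lemma integrable_continuous_on_compact:
  fixes f :: "'a::metric_space \<Rightarrow> real"
  assumes "finite_measure M" "sets M = sets (restrict_space borel X)" "compact X" "continuous_on X f"
  shows "integrable M f"
proof -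
  interpret finite_measure M by fact
  obtain B where "B \<ge> 0" "\<And>x. x \<in> X \<Longrightarrow> \<bar>f x\<bar> \<le> B"
    by (rule continuous_on_compact_bounded_real[OF assms(3,4)]) blast
  then show ?thesis
    using continuous_on_borel_measurable_restrict[OF assms(2,4)] space_restrict_borel_eq[OF assms(2)]
    by (intro integrable_const_bound[where B=B]) auto
qed

text \<open>Closed subsets of \<open>X\<close> form an intersection-stable generator, and the
  indicator of a nonempty closed \<open>C\<close> is the limit of the continuous functions
  \<open>max 0 (1 - real k * infdist x C)\<close>.\<close>

lemma measure_eqI_continuous_integrals:
  fixes M N :: "'a::metric_space measure"
  assumes "prob_space M" "prob_space N" "compact X"
    and sM: "sets M = sets (restrict_space borel X)" and sN: "sets N = sets (restrict_space borel X)"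
    and eq: "\<And>f :: 'a \<Rightarrow> real. continuous_on X f \<Longrightarrow> integral\<^sup>L M f = integral\<^sup>L N f"
  shows "M = N"
proof -
  interpret M: prob_space M by fact
  interpret N: prob_space N by fact
  note sp = space_restrict_borel_eq[OF sM] space_restrict_borel_eq[OF sN]
  define E where "E = {C. C \<subseteq> X \<and> closed C}"
  have gen: "sets (restrict_space borel X) = sigma_sets X E"
  proof -
    have "closed X" using assms(3) by (rule compact_imp_closed)
    then have "X \<in> sigma_sets UNIV (Collect closed)" by auto
    then have "(\<inter>) X ` sigma_sets UNIV (Collect closed) = sigma_sets X ((\<inter>) X ` Collect closed)"
      by (rule sigma_sets_Int) auto
    moreover have "(\<inter>) X ` Collect closed = E"
      using \<open>closed X\<close> by (auto simp: E_def image_iff)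
    moreover have "sets (borel :: 'a measure) = sigma_sets UNIV (Collect closed)"
      unfolding borel_eq_closed by simp
    ultimately show ?thesis by (simp add: sets_restrict_space)
  qed
  have lim: "(\<lambda>k. LINT x|M. max 0 (1 - real k * infdist x C)) \<longlonglongrightarrow> measure M C"
    if C: "C \<in> E" "C \<noteq> {}" and M: "prob_space M" "sets M = sets (restrict_space borel X)" for C M
  proof -
    interpret P: prob_space M by fact
    have CM: "C \<in> sets M" using C gen M(2) by (simp add: sigma_sets.Basic)
    have "(\<lambda>k. LINT x|M. max 0 (1 - real k * infdist x C)) \<longlonglongrightarrow> (LINT x|M. indicator C x)"
    proof (rule integral_dominated_convergence[where w="\<lambda>_. 1"])
      show "(\<lambda>x. max 0 (1 - real k * infdist x C)) \<in> borel_measurable M" for k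
        by (intro continuous_on_borel_measurable_restrict[OF M(2)] continuous_intros)
      show "AE x in M. (\<lambda>k. max 0 (1 - real k * infdist x C)) \<longlonglongrightarrow> indicat_real C x"
      proof (intro AE_I2)
        fix x
        show "(\<lambda>k. max 0 (1 - real k * infdist x C)) \<longlonglongrightarrow> indicat_real C x"
        proof (cases "x \<in> C")
          case False
          then have pos: "infdist x C > 0"
            using C in_closed_iff_infdist_zero[of C x] infdist_nonneg[of x C] by (auto simp: E_def less_le)
          obtain K :: nat where K: "1 / infdist x C < real K" using reals_Archimedean2 by blast
          have "max 0 (1 - real k * infdist x C) = 0" if "k \<ge> K" for k
          proof -
            have "1 / infdist x C < real k" using K that by linarith
            then show ?thesis using pos by (simp add: field_simps)
          qed
          then have "\<forall>\<^sub>F k in sequentially. max 0 (1 - real k * infdist x C) = indicat_real C x"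
            using False by (auto simp: eventually_sequentially)
          then show ?thesis by (rule tendsto_eventually)
        qed simp
      qed
    qed (use CM in \<open>auto intro!: AE_I2 mult_nonneg_nonneg simp: infdist_nonneg\<close>)
    then show ?thesis using CM by simp
  qed
  show ?thesis
  proof (rule measure_eqI_generator_eq[where E=E and \<Omega>=X and A="\<lambda>_. X"])
    show "Int_stable E" by (auto simp: Int_stable_def E_def)
    \<comment> \<open>The empty set is separate: \<open>infdist x {}\<close> is 0, so the
      approximating functions would be constantly 1.\<close>
    show "emeasure M C = emeasure N C" if "C \<in> E" for C
    proof (cases "C = {}")
      case False
      have "(LINT x|M. max 0 (1 - real k * infdist x C)) = (LINT x|N. max 0 (1 - real k * infdist x C))" for k
        by (intro eq continuous_intros)
      then have "measure M C = measure N C"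
        using lim[OF that False assms(1) sM] lim[OF that False assms(2) sN] LIMSEQ_unique by simp
      then show ?thesis by (simp add: M.emeasure_eq_measure N.emeasure_eq_measure)
    qed simp
  qed (use gen sM sN sp assms(3) in \<open>auto simp: E_def compact_imp_closed\<close>)
qed

text \<open>Lift the points to a compact subset of the real line, where Helly's selection theorem applies,
  and push the limit measure forward.\<close>

theorem empirical_measures_subsequence:
  fixes X :: "'a::metric_space set" and x :: "nat \<Rightarrow> nat \<Rightarrow> 'a" and N :: "nat \<Rightarrow> nat"
  assumes X: "compact X" and N: "\<And>k. N k > 0" and x: "\<And>k i. x k i \<in> X"
  obtains r M where "strict_mono r" "prob_space M" "sets M = sets (restrict_space borel X)"
    "\<And>f :: 'a \<Rightarrow> real. continuous_on X f \<Longrightarrow>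
      (\<lambda>k. (\<Sum>i=1..N (r k). f (x (r k) i)) / real (N (r k))) \<longlonglongrightarrow> integral\<^sup>L M f"
proof -
  obtain K :: "real set" and \<phi> where K: "compact K" "continuous_on K \<phi>" "\<phi> ` K = X"
    using compact_metric_image_of_compact_real[OF X] .
  obtain t where t: "\<And>k i. t k i \<in> K" "\<And>k i. \<phi> (t k i) = x k i"
  proof -
    have "\<forall>k i. \<exists>s. s \<in> K \<and> \<phi> s = x k i" using x K(3) by (metis imageE)
    then show ?thesis using that by metis
  qed
  have "K \<noteq> {}" using t(1) by auto
  have clK: "closed K" using K(1) by (rule compact_imp_closed)
  \<comment> \<open>The uniform distribution on the lifted points, counted with multiplicity, as a
    measure on the whole line.\<close>
  define m where "m k = distr (uniform_count_measure {1..N k}) borel (t k)" for k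
  have meas: "t k \<in> measurable (uniform_count_measure {1..N k}) borel" for k
    by (simp add: measurable_def sets_uniform_count_measure space_uniform_count_measure)
  have rd: "real_distribution (m k)" for k
    unfolding m_def real_distribution_def real_distribution_axioms_def using N[of k]
    by (auto intro!: prob_space.prob_space_distr meas prob_space_uniform_count_measure)
  have int: "integral\<^sup>L (m k) f = (\<Sum>i=1..N k. f (t k i)) / real (N k)"
    if "f \<in> borel_measurable borel" for k and f :: "real \<Rightarrow> real"
    unfolding m_def using that
    by (subst integral_distr[OF meas]) (simp_all add: integral_uniform_count_measure)
  have "tight m"
    unfolding tight_def
  proof (intro conjI allI impI rd)
    fix \<epsilon> :: real assume "\<epsilon> > 0"
    obtain B where B: "\<And>s. s \<in> K \<Longrightarrow> \<bar>s\<bar> \<le> B" using compact_imp_bounded[OF K(1)] by (auto simp: bounded_iff)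
    \<comment> \<open>The interval is open on the left, so it starts at \<open>- B - 1\<close> to
      contain all of \<open>K\<close>.\<close>
    have "measure (m k) {- B - 1<..B} = 1" for k
    proof -
      interpret real_distribution "m k" by (rule rd)
      have "measure (m k) {- B - 1<..B} = (LINT s|m k. indicator {- B - 1<..B} s)" by simp
      also have "\<dots> = (\<Sum>i=1..N k. 1) / real (N k)"
      proof (subst int)
        have "indicat_real {- B - 1<..B} (t k i) = 1" for i using B[OF t(1)[of k i]] by (auto simp: indicator_def)
        then show "(\<Sum>i=1..N k. indicat_real {- B - 1<..B} (t k i)) / real (N k) = (\<Sum>i=1..N k. 1) / real (N k)"
          by simp
      qed simp
      finally show ?thesis using N[of k] by simp
    qed
    moreover obtain s where "s \<in> K" using \<open>K \<noteq> {}\<close> by blast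
    then have "- B - 1 < B" using B[of s] by linarith
    ultimately show "\<exists>a b. a < b \<and> (\<forall>k. 1 - \<epsilon> < measure (m k) {a<..b})"
      using \<open>\<epsilon> > 0\<close> by (intro exI[of _ "- B - 1"] exI[of _ B]) simp
  qed
  then obtain r L where r: "strict_mono r" and L: "real_distribution L" and wc: "weak_conv_m (m \<circ> id \<circ> r) L"
    using tight_imp_convergent_subsubsequence[of m id] strict_mono_id by blast
  interpret L: real_distribution L by (rule L)
  have conv: "(\<lambda>k. (\<Sum>i=1..N (r k). f (t (r k) i)) / real (N (r k))) \<longlonglongrightarrow> integral\<^sup>L L f"
    if f: "continuous_on UNIV f" "\<And>s. \<bar>f s\<bar> \<le> B" for f B
  proof -
    have "(\<lambda>k. integral\<^sup>L ((m \<circ> id \<circ> r) k) f) \<longlonglongrightarrow> integral\<^sup>L L f"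
      using f rd
      by (intro weak_conv_imp_integral_bdd_continuous_conv[OF _ L wc, where B=B])
        (auto simp: continuous_on_eq_continuous_at)
    then show ?thesis
      using f(1) by (simp add: int borel_measurable_continuous_onI)
  qed
  \<comment> \<open>The test function \<open>min 1 (infdist s K)\<close> vanishes at every lifted
    point, so its limit integral is 0.\<close>
  have "AE s in L. s \<in> K"
  proof -
    define h where "h s = min 1 (infdist s K)" for s
    have hc: "continuous_on UNIV h" unfolding h_def by (intro continuous_intros)
    have hb: "\<bar>h s\<bar> \<le> 1" "0 \<le> h s" for s using infdist_nonneg[of s K] by (auto simp: h_def)
    have "h (t k i) = 0" for k i using t(1) by (simp add: h_def)
    then have "integral\<^sup>L L h = 0"
      using conv[OF hc hb(1)] by (simp add: LIMSEQ_const_iff)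
    moreover have "integrable L h"
      using hb(1) hc by (intro L.integrable_const_bound[where B=1]) (auto simp: borel_measurable_continuous_onI)
    ultimately have "AE s in L. h s = 0" using hb(2) by (subst (asm) integral_nonneg_eq_0_iff_AE) auto
    then show ?thesis
    proof eventually_elim
      case (elim s)
      then show ?case using in_closed_iff_infdist_zero[OF clK \<open>K \<noteq> {}\<close>] by (simp add: h_def min_def split: if_splits)
    qed
  qed
  moreover have KL: "K \<in> sets L" using clK by simp
  ultimately have K1: "emeasure L K = 1" using L.emeasure_eq_1_AE by blast
  \<comment> \<open>Off \<open>K\<close>, a null set of \<open>L\<close>, any value in
    \<open>X\<close> will do.\<close>
  define \<psi> where "\<psi> s = (if s \<in> K then \<phi> s else \<phi> (SOME s. s \<in> K))" for s
  define R where "R = restrict_space borel X"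
  have \<psi>X: "\<psi> s \<in> X" for s using K(3) some_in_eq[of K] \<open>K \<noteq> {}\<close> by (auto simp: \<psi>_def)
  have "\<psi> \<in> borel_measurable borel"
    unfolding \<psi>_def using clK borel_measurable_continuous_on_restrict[OF K(2)]
    by (intro measurable_If_restrict_space_iff[THEN iffD2]) auto
  then have \<psi>m: "\<psi> \<in> measurable L R"
    unfolding R_def using \<psi>X by (intro measurable_restrict_space2) auto
  show thesis
  proof (rule that[OF r])
    show "prob_space (distr L R \<psi>)" using \<psi>m by (rule L.prob_space_distr)
    show "sets (distr L R \<psi>) = sets (restrict_space borel X)" by (simp add: R_def)
    fix f :: "'a \<Rightarrow> real" assume f: "continuous_on X f"
    obtain B where B: "B \<ge> 0" "\<And>y. y \<in> X \<Longrightarrow> \<bar>f y\<bar> \<le> B"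
      by (rule continuous_on_compact_bounded_real[OF X f]) blast
    \<comment> \<open>Weak convergence tests functions on the whole line, hence the Tietze extension
      with the same bound.\<close>
    have "continuous_on K (f \<circ> \<phi>)" using K f by (intro continuous_on_compose) auto
    then obtain g where g: "continuous_on UNIV g" "\<And>s. s \<in> K \<Longrightarrow> g s = f (\<phi> s)" "\<And>s. \<bar>g s\<bar> \<le> B"
      proof (rule Tietze[of K "f \<circ> \<phi>" UNIV B])
      show "norm ((f \<circ> \<phi>) s) \<le> B" if "s \<in> K" for s using that B(2) K(3) by auto
    qed (use clK B in \<open>auto\<close>)
    have "integral\<^sup>L (distr L R \<psi>) f = (LINT s|L. f (\<psi> s))"
      using f \<psi>m by (intro integral_distr) (auto simp: R_def borel_measurable_continuous_on_restrict)
    also have "\<dots> = integral\<^sup>L L g"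
    proof (rule integral_cong_AE)
      show "AE s in L. f (\<psi> s) = g s" using \<open>AE s in L. s \<in> K\<close>
        by eventually_elim (simp add: \<psi>_def g)
      show "(\<lambda>s. f (\<psi> s)) \<in> borel_measurable L"
        using measurable_compose[OF \<psi>m] borel_measurable_continuous_on_restrict[OF f] by (simp add: R_def)
      show "g \<in> borel_measurable L" using g(1) by (simp add: borel_measurable_continuous_onI)
    qed
    finally show "(\<lambda>k. (\<Sum>i=1..N (r k). f (x (r k) i)) / real (N (r k))) \<longlonglongrightarrow> integral\<^sup>L (distr L R \<psi>) f"
      using conv[OF g(1) g(3)] by (simp add: g(2) t)
  qed
qed

section \<open>Minimal systems and invariant measures\<close>

locale topological_system =
  fixes X :: "'a::metric_space set" and T :: "'a \<Rightarrow> 'a"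
  assumes tds: "tds X T"
begin

lemma X_nonempty: "X \<noteq> {}" and compact_X: "compact X" and continuous_T: "continuous_on X T"
  and T_in: "x \<in> X \<Longrightarrow> T x \<in> X"
  using tds by (auto simp: tds_def)

lemma iter_in: "x \<in> X \<Longrightarrow> (T ^^ n) x \<in> X"
  by (induction n) (auto simp: T_in)

lemma continuous_iter: "continuous_on X (T ^^ n)"
proof (induction n)
  case (Suc n)
  then have "continuous_on X (T \<circ> T ^^ n)"
    using iter_in by (intro continuous_on_compose continuous_on_subset[OF continuous_T]) auto
  then show ?case by simp
qed (simp add: continuous_on_id')

lemma continuous_on_comp_iter:
  "continuous_on X f \<Longrightarrow> continuous_on X (\<lambda>x. f ((T ^^ n) x))"
  using iter_in by (intro continuous_on_compose2[OF _ continuous_iter]) auto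

lemma invariant_prob_integral_iter:
  fixes f :: "'a \<Rightarrow> real"
  assumes M: "invariant_prob X T M" and f: "continuous_on X f"
  shows "(LINT x|M. f ((T ^^ n) x)) = integral\<^sup>L M f"
proof (induction n)
  case (Suc n)
  have sM: "sets M = sets (restrict_space borel X)" and d: "distr M M T = M"
    using M by (auto simp: invariant_prob_def)
  have "T \<in> measurable M M"
    using continuous_T T_in by (intro continuous_on_measurable_restrict[OF sM sM]) auto
  moreover have "(\<lambda>x. f ((T ^^ n) x)) \<in> borel_measurable M"
    by (rule continuous_on_borel_measurable_restrict[OF sM continuous_on_comp_iter[OF f]])
  ultimately have "(LINT x|M. f ((T ^^ n) (T x))) = (LINT x|distr M M T. f ((T ^^ n) x))"
    by (rule integral_distr[symmetric])
  then show ?case using Suc d by (simp add: funpow_swap1)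
qed simp

text \<open>The sums of \<open>f \<circ> T\<close> and of \<open>f\<close> along an orbit segment
  differ by two boundary terms, so the averages differ by at most \<open>2 * B / N k\<close>. The
  starting point may change with \<open>k\<close>, as it does for the marginals of a limit of pairs
  of orbits.\<close>

lemma empirical_limit_invariant:
  assumes M: "prob_space M" and sM: "sets M = sets (restrict_space borel X)"
    and N: "filterlim N at_top sequentially" and x: "\<And>k. x k \<in> X"
    and lim: "\<And>f :: 'a \<Rightarrow> real. continuous_on X f \<Longrightarrow>
      (\<lambda>k. (\<Sum>i=1..N k. f ((T ^^ i) (x k))) / real (N k)) \<longlonglongrightarrow> integral\<^sup>L M f"
  shows "invariant_prob X T M"
proof -
  interpret prob_space M by fact
  have Tm: "T \<in> measurable M M"
    using continuous_T T_in by (intro continuous_on_measurable_restrict[OF sM sM]) auto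
  have "distr M M T = M"
  proof (rule measure_eqI_continuous_integrals[OF prob_space_distr[OF Tm] M compact_X])
    fix f :: "'a \<Rightarrow> real" assume f: "continuous_on X f"
    obtain B where B: "B \<ge> 0" "\<And>x. x \<in> X \<Longrightarrow> \<bar>f x\<bar> \<le> B"
      by (rule continuous_on_compact_bounded_real[OF compact_X f]) blast
    have tel: "(\<Sum>i=1..n. g (Suc i)) - (\<Sum>i=1..n. g i) = g (Suc n) - g 1" for g :: "nat \<Rightarrow> real" and n
      by (induction n) auto
    have "(\<lambda>k. (\<Sum>i=1..N k. f (T ((T ^^ i) (x k)))) / real (N k)
        - (\<Sum>i=1..N k. f ((T ^^ i) (x k))) / real (N k)) \<longlonglongrightarrow> 0"
    proof (rule Lim_null_comparison)
      show "(\<lambda>k. 2 * B / real (N k)) \<longlonglongrightarrow> 0"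
        using N by (intro tendsto_divide_0[OF tendsto_const]
            filterlim_compose[OF filterlim_real_sequentially, THEN filterlim_at_top_imp_at_infinity])
      show "\<forall>\<^sub>F k in sequentially. norm ((\<Sum>i=1..N k. f (T ((T ^^ i) (x k)))) / real (N k)
        - (\<Sum>i=1..N k. f ((T ^^ i) (x k))) / real (N k)) \<le> 2 * B / real (N k)"
      proof (intro always_eventually allI)
        fix k
        have "(\<Sum>i=1..N k. f (T ((T ^^ i) (x k)))) - (\<Sum>i=1..N k. f ((T ^^ i) (x k)))
            = f ((T ^^ Suc (N k)) (x k)) - f ((T ^^ 1) (x k))"
          using tel[of "\<lambda>i. f ((T ^^ i) (x k))" "N k"] by simp
        moreover have "\<bar>f ((T ^^ Suc (N k)) (x k)) - f ((T ^^ 1) (x k))\<bar> \<le> 2 * B"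
          using B(2)[OF iter_in[OF x], of "Suc (N k)" k] B(2)[OF iter_in[OF x], of 1 k] by linarith
        ultimately show "norm ((\<Sum>i=1..N k. f (T ((T ^^ i) (x k)))) / real (N k)
          - (\<Sum>i=1..N k. f ((T ^^ i) (x k))) / real (N k)) \<le> 2 * B / real (N k)"
          by (simp add: diff_divide_distrib[symmetric] divide_right_mono)
      qed
    qed
    moreover have "continuous_on X (\<lambda>x. f (T x))" using continuous_on_comp_iter[OF f, of 1] by simp
    ultimately have "(LINT x|M. f (T x)) - integral\<^sup>L M f = 0"
      using LIMSEQ_unique[OF tendsto_diff[OF lim lim[OF f]]] by blast
    moreover have "integral\<^sup>L (distr M M T) f = (LINT x|M. f (T x))"
      using Tm by (rule integral_distr) (rule continuous_on_borel_measurable_restrict[OF sM f])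
    ultimately show "integral\<^sup>L (distr M M T) f = integral\<^sup>L M f" by simp
  qed (simp_all add: sM)
  then show ?thesis using M sM by (simp add: invariant_prob_def)
qed

theorem invariant_prob_exists: "\<exists>M. invariant_prob X T M"
proof -
  obtain x0 where x0: "x0 \<in> X" using X_nonempty by blast
  obtain r M where r: "strict_mono r" and M: "prob_space M" "sets M = sets (restrict_space borel X)"
    and lim: "\<And>f :: 'a \<Rightarrow> real. continuous_on X f \<Longrightarrow>
      (\<lambda>k. (\<Sum>i=1..Suc (r k). f ((T ^^ i) x0)) / real (Suc (r k))) \<longlonglongrightarrow> integral\<^sup>L M f"
    by (rule empirical_measures_subsequence[OF compact_X, of Suc "\<lambda>k i. (T ^^ i) x0"])
      (use iter_in[OF x0] in auto)
  have "filterlim (\<lambda>k. Suc (r k)) at_top sequentially"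
    using filterlim_subseq[OF r] by (rule filterlim_compose[OF filterlim_Suc])
  from empirical_limit_invariant[OF M this x0 lim] show ?thesis by blast
qed

end

locale minimal_system = topological_system +
  assumes minimal: "minimal_tds X T"
begin

lemma orbit_approaches:
  assumes "x \<in> X" "y \<in> X" "e > 0"
  obtains n where "dist ((T ^^ n) x) y < e"
proof -
  have "y \<in> closure (range (\<lambda>n. (T ^^ n) x))"
    using minimal assms(1,2) by (auto simp: minimal_tds_def)
  then show ?thesis using that assms(3) unfolding closure_approachable by blast
qed

text \<open>The image of \<open>X\<close> is closed and contains the forward orbit of
  \<open>T x\<close>, which is dense.\<close>

lemma T_surj: "T ` X = X"
proof
  show "T ` X \<subseteq> X" using T_in by blast
  show "X \<subseteq> T ` X"
  proof
    fix y assume y: "y \<in> X"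
    obtain x where x: "x \<in> X" using X_nonempty by blast
    have "range (\<lambda>n. (T ^^ n) (T x)) \<subseteq> T ` X"
      using iter_in[OF x] by (auto simp: funpow_swap1[symmetric])
    then have "closure (range (\<lambda>n. (T ^^ n) (T x))) \<subseteq> T ` X"
      using compact_imp_closed[OF compact_continuous_image[OF continuous_T compact_X]]
      by (rule closure_minimal)
    then show "y \<in> T ` X" using minimal T_in[OF x] y by (auto simp: minimal_tds_def)
  qed
qed

lemma iter_surj: "(T ^^ n) ` X = X"
proof (induction n)
  case (Suc n)
  have "(T ^^ Suc n) ` X = T ` (T ^^ n) ` X" by (simp add: image_comp)
  then show ?case using Suc T_surj by simp
qed simp

text \<open>Points avoiding \<open>U\<close> for ever longer times would accumulate at a point whose
  whole orbit avoids \<open>U\<close>. The uniform bound is what makes visits syndetic and what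
  yields finite covers by preimages.\<close>

lemma uniformly_visits_open:
  assumes "open U" "U \<inter> X \<noteq> {}"
  obtains N where "\<And>x. x \<in> X \<Longrightarrow> \<exists>j\<le>N. (T ^^ j) x \<in> U"
proof (rule ccontr)
  assume "\<not> thesis"
  then have "\<forall>N. \<exists>x. x \<in> X \<and> (\<forall>j\<le>N. (T ^^ j) x \<notin> U)" using that by blast
  then obtain s where s: "\<And>N. s N \<in> X" "\<And>N j. j \<le> N \<Longrightarrow> (T ^^ j) (s N) \<notin> U" by metis
  obtain l r where l: "l \<in> X" "strict_mono (r :: nat \<Rightarrow> nat)" "(s \<circ> r) \<longlonglongrightarrow> l"
    using compact_X s(1) unfolding compact_def by metis
  have "(T ^^ j) l \<in> - U" for j
  proof (rule Lim_in_closed_set[OF closed_Compl[OF assms(1)]])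
    show "(\<lambda>k. (T ^^ j) ((s \<circ> r) k)) \<longlonglongrightarrow> (T ^^ j) l"
      using s(1) by (intro continuous_on_tendsto_compose[OF continuous_iter l(3,1)]) simp
    show "\<forall>\<^sub>F k in sequentially. (T ^^ j) ((s \<circ> r) k) \<in> - U"
      unfolding eventually_sequentially
    proof (intro exI[of _ j] allI impI)
      fix k assume "j \<le> k"
      then have "j \<le> r k" using seq_suble[OF l(2), of k] by linarith
      then show "(T ^^ j) ((s \<circ> r) k) \<in> - U" using s(2) by simp
    qed
  qed simp
  moreover obtain u e where "u \<in> X" "e > 0" "ball u e \<subseteq> U"
    using assms open_contains_ball by (metis Int_iff ex_in_conv)
  moreover obtain n where "dist ((T ^^ n) l) u < e"
    using orbit_approaches[OF l(1)] calculation by metis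
  ultimately show False by (metis ComplD dist_commute mem_ball subsetD)
qed

lemma invariant_continuous_constant:
  fixes f :: "'a \<Rightarrow> 'c::t2_space"
  assumes f: "continuous_on X f" and inv: "\<And>x. x \<in> X \<Longrightarrow> f (T x) = f x"
    and "x \<in> X" "y \<in> X"
  shows "f x = f y"
proof -
  have it: "f ((T ^^ n) x) = f x" for n
    by (induction n) (use inv iter_in \<open>x \<in> X\<close> in auto)
  have "\<forall>k. \<exists>n. dist ((T ^^ n) x) y < inverse (real (Suc k))"
    using orbit_approaches[OF assms(3,4)] by (metis inverse_positive_iff_positive of_nat_0_less_iff zero_less_Suc)
  then obtain n where n: "\<And>k. dist ((T ^^ n k) x) y < inverse (real (Suc k))" by metis
  have "(\<lambda>k. (T ^^ n k) x) \<longlonglongrightarrow> y"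
    by (rule metric_tendsto_imp_tendsto[OF LIMSEQ_inverse_real_of_nat])
      (use n in \<open>auto intro!: always_eventually simp: less_imp_le\<close>)
  then have "(\<lambda>k. f ((T ^^ n k) x)) \<longlonglongrightarrow> f y"
    using assms(3,4) iter_in by (intro continuous_on_tendsto_compose[OF f]) auto
  then show ?thesis unfolding it by (simp add: LIMSEQ_const_iff)
qed

text \<open>By uniform visits the sum of \<open>f\<close> over the first \<open>N + 1\<close>
  iterates is at least \<open>f z / 2\<close> everywhere, while its integral is \<open>N + 1\<close>
  times that of \<open>f\<close>.\<close>

lemma invariant_prob_full_support:
  fixes f :: "'a \<Rightarrow> real"
  assumes M: "invariant_prob X T M" and f: "continuous_on X f" "\<And>x. x \<in> X \<Longrightarrow> 0 \<le> f x"
    and z: "z \<in> X" "f z > 0"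
  shows "integral\<^sup>L M f > 0"
proof -
  interpret prob_space M using M by (simp add: invariant_prob_def)
  have sM: "sets M = sets (restrict_space borel X)" using M by (simp add: invariant_prob_def)
  note sp = space_restrict_borel_eq[OF sM]
  have int: "integrable M g" if "continuous_on X g" for g :: "'a \<Rightarrow> real"
    using that by (intro integrable_continuous_on_compact[OF _ sM compact_X]) unfold_locales
  obtain U where U: "open U" "U \<inter> X = {x \<in> X. f z / 2 < f x}"
  proof -
    have "openin (top_of_set X) {x \<in> X. f z / 2 < f x}"
      using continuous_openin_preimage_gen[OF f(1) open_greaterThan[of "f z / 2"]]
      by (simp add: vimage_def Int_def)
    then show ?thesis using that unfolding openin_open by (metis Int_commute)
  qed
  have "U \<inter> X \<noteq> {}" using U z by auto
  then obtain N where N: "\<And>x. x \<in> X \<Longrightarrow> \<exists>j\<le>N. (T ^^ j) x \<in> U"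
    using uniformly_visits_open[OF U(1)] by metis
  have "f z / 2 \<le> (\<Sum>j\<le>N. f ((T ^^ j) x))" if x: "x \<in> X" for x
  proof -
    obtain j where "j \<le> N" "(T ^^ j) x \<in> U" using N[OF x] by blast
    then have "(T ^^ j) x \<in> U \<inter> X" using iter_in[OF x] by blast
    then have "f z / 2 \<le> f ((T ^^ j) x)" unfolding U(2) by simp
    also have "\<dots> \<le> (\<Sum>j\<le>N. f ((T ^^ j) x))"
      using \<open>j \<le> N\<close> f(2) iter_in[OF x] by (intro member_le_sum) auto
    finally show ?thesis .
  qed
  then have "(LINT x|M. f z / 2) \<le> (LINT x|M. (\<Sum>j\<le>N. f ((T ^^ j) x)))"
    using sp f(1) by (intro integral_mono int continuous_intros continuous_on_comp_iter) auto
  also have "\<dots> = (\<Sum>j\<le>N. LINT x|M. f ((T ^^ j) x))"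
    using f(1) by (intro Bochner_Integration.integral_sum int continuous_on_comp_iter)
  also have "\<dots> = real (Suc N) * integral\<^sup>L M f"
    using invariant_prob_integral_iter[OF M f(1)] by simp
  finally have "0 < real (Suc N) * integral\<^sup>L M f" using z(2) by (simp add: prob_space)
  then show ?thesis by (simp add: zero_less_mult_iff)
qed

end

section \<open>The mean orbit distance\<close>

text \<open>Uniform continuity in a form that survives averaging: summed along two orbits, it bounds
  the difference of Birkhoff averages by \<open>avg_dist\<close>.\<close>

lemma uniformly_continuous_linear_bound:
  fixes f :: "'a::metric_space \<Rightarrow> real"
  assumes X: "compact X" and f: "continuous_on X f" and \<eta>: "\<eta> > 0"
  obtains C where "C > 0" "\<And>x y. x \<in> X \<Longrightarrow> y \<in> X \<Longrightarrow> \<bar>f x - f y\<bar> \<le> \<eta> + C * dist x y"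
proof -
  obtain B where B: "B \<ge> 0" "\<And>x. x \<in> X \<Longrightarrow> \<bar>f x\<bar> \<le> B"
    by (rule continuous_on_compact_bounded_real[OF X f]) blast
  obtain \<delta> where \<delta>: "\<delta> > 0" "\<And>x y. x \<in> X \<Longrightarrow> y \<in> X \<Longrightarrow> dist x y < \<delta> \<Longrightarrow> dist (f x) (f y) < \<eta>"
    using compact_uniformly_continuous[OF f X] \<eta> unfolding uniformly_continuous_on_def by metis
  show thesis
  \<comment> \<open>Pairs at distance at least \<open>\<delta>\<close> are covered by the linear
    term alone; the \<open>+ 1\<close> keeps the constant positive when
    \<open>B = 0\<close>.\<close>
  proof (rule that[of "2 * (B + 1) / \<delta>"])
    show "0 < 2 * (B + 1) / \<delta>" using B(1) \<delta>(1) by simp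
    fix x y assume xy: "x \<in> X" "y \<in> X"
    show "\<bar>f x - f y\<bar> \<le> \<eta> + 2 * (B + 1) / \<delta> * dist x y"
    proof (cases "dist x y < \<delta>")
      case True
      then have "\<bar>f x - f y\<bar> \<le> \<eta>" using \<delta>(2)[OF xy] by (simp add: dist_real_def)
      moreover have "0 \<le> 2 * (B + 1) / \<delta> * dist x y" using B(1) \<delta>(1) by simp
      ultimately show ?thesis by linarith
    next
      case False
      then have "2 * (B + 1) / \<delta> * \<delta> \<le> 2 * (B + 1) / \<delta> * dist x y"
        using B(1) \<delta>(1) by (intro mult_left_mono) auto
      then have "2 * (B + 1) \<le> 2 * (B + 1) / \<delta> * dist x y" using \<delta>(1) by simp
      moreover have "\<bar>f x - f y\<bar> \<le> 2 * (B + 1)" using B(2)[OF xy(1)] B(2)[OF xy(2)] by simp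
      ultimately show ?thesis using \<eta> by (intro add_increasing) auto
    qed
  qed
qed

lemma continuous_on_integral_kernel:
  fixes H :: "'a::metric_space \<Rightarrow> 'a \<Rightarrow> real"
  assumes M: "prob_space M" "sets M = sets (restrict_space borel X)" and X: "compact X"
    and H: "continuous_on (X \<times> X) (\<lambda>(x, y). H x y)"
  shows "continuous_on X (\<lambda>x. LINT y|M. H x y)"
proof -
  interpret prob_space M by fact
  have Hx: "continuous_on X (H x)" if "x \<in> X" for x
    using that continuous_on_compose2[OF H continuous_on_Pair[OF continuous_on_const continuous_on_id]]
    by auto
  have int: "integrable M (H x)" if "x \<in> X" for x
    using Hx[OF that] by (intro integrable_continuous_on_compact[OF _ M(2) X]) unfold_locales
  show ?thesis
    unfolding continuous_on_iff
  proof (intro ballI allI impI)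
    fix x and e :: real assume x: "x \<in> X" and e: "e > 0"
    obtain d where d: "d > 0" "\<And>p q. p \<in> X \<times> X \<Longrightarrow> q \<in> X \<times> X \<Longrightarrow> dist q p < d \<Longrightarrow>
        dist (case q of (x, y) \<Rightarrow> H x y) (case p of (x, y) \<Rightarrow> H x y) < e / 2"
      using compact_uniformly_continuous[OF H compact_Times[OF X X]] e half_gt_zero[OF e]
      unfolding uniformly_continuous_on_def by metis
    show "\<exists>d>0. \<forall>x'\<in>X. dist x' x < d \<longrightarrow> dist (LINT y|M. H x' y) (LINT y|M. H x y) < e"
    proof (intro exI[of _ d] conjI ballI impI d)
      fix x' assume x': "x' \<in> X" "dist x' x < d"
      have "\<bar>H x' y - H x y\<bar> \<le> e / 2" if "y \<in> X" for y
        using d(2)[of "(x, y)" "(x', y)"] x x' that by (simp add: dist_Pair_Pair dist_real_def)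
      then have "\<bar>LINT y|M. H x' y - H x y\<bar> \<le> (LINT y|M. e / 2)"
        using x x' space_restrict_borel_eq[OF M(2)]
        by (intro order_trans[OF integral_abs_bound] integral_mono integrable_abs Bochner_Integration.integrable_diff int) auto
      then show "dist (LINT y|M. H x' y) (LINT y|M. H x y) < e"
        using int x x' e by (simp add: dist_real_def prob_space)
    qed
  qed
qed

definition avg_dist :: "('a::metric_space \<Rightarrow> 'a) \<Rightarrow> nat \<Rightarrow> 'a \<Rightarrow> 'a \<Rightarrow> real" where
  "avg_dist T n x y = (\<Sum>i=1..n. dist ((T ^^ i) x) ((T ^^ i) y)) / real n"

text \<open>The Besicovitch pseudometric of orbits. Averages of pairs from \<open>X\<close> are
  bounded, so \<open>real_of_ereal\<close> loses nothing there.\<close>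

definition mean_dist :: "('a::metric_space \<Rightarrow> 'a) \<Rightarrow> 'a \<Rightarrow> 'a \<Rightarrow> real" where
  "mean_dist T x y = real_of_ereal (limsup (\<lambda>n. ereal (avg_dist T n x y)))"

lemma avg_dist_nonneg: "0 \<le> avg_dist T n x y"
  by (simp add: avg_dist_def sum_nonneg)

lemma avg_dist_commute: "avg_dist T n x y = avg_dist T n y x"
  by (simp add: avg_dist_def dist_commute)

lemma avg_dist_triangle: "avg_dist T n x z \<le> avg_dist T n x y + avg_dist T n y z"
  unfolding avg_dist_def add_divide_distrib[symmetric] sum.distrib[symmetric]
  by (intro divide_right_mono sum_mono dist_triangle) simp

lemma mean_dist_commute: "mean_dist T x y = mean_dist T y x"
  by (simp add: mean_dist_def avg_dist_commute[of T _ x])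

lemma mean_dist_self [simp]: "mean_dist T x x = 0"
  by (simp add: mean_dist_def avg_dist_def Limsup_const zero_ereal_def[symmetric])

context topological_system
begin

lemma diameter_bound:
  obtains B where "B > 0" "\<And>x y. x \<in> X \<Longrightarrow> y \<in> X \<Longrightarrow> dist x y \<le> B"
proof -
  have "dist x y \<le> diameter X + 1" if "x \<in> X" "y \<in> X" for x y
    using diameter_bounded_bound[OF compact_imp_bounded[OF compact_X] that] by linarith
  moreover have "diameter X + 1 > 0"
    using diameter_ge_0[OF compact_imp_bounded[OF compact_X]] by linarith
  ultimately show ?thesis using that by blast
qed

lemma avg_dist_le:
  assumes "\<And>x y. x \<in> X \<Longrightarrow> y \<in> X \<Longrightarrow> dist x y \<le> B" "B \<ge> 0" "x \<in> X" "y \<in> X"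
  shows "avg_dist T n x y \<le> B"
proof -
  have "(\<Sum>i=1..n. dist ((T ^^ i) x) ((T ^^ i) y)) \<le> real (card {1..n}) * B"
    using assms iter_in by (intro sum_bounded_above) auto
  then show ?thesis using assms(2) by (cases "n = 0") (simp_all add: avg_dist_def field_simps)
qed

lemma ereal_mean_dist:
  assumes "x \<in> X" "y \<in> X"
  shows "ereal (mean_dist T x y) = limsup (\<lambda>n. ereal (avg_dist T n x y))"
proof -
  obtain B where B: "B > 0" "\<And>x y. x \<in> X \<Longrightarrow> y \<in> X \<Longrightarrow> dist x y \<le> B"
    by (rule diameter_bound) blast
  have "limsup (\<lambda>n. ereal (avg_dist T n x y)) \<le> ereal B"
    using avg_dist_le[OF B(2)] B(1) assms by (intro Limsup_bounded always_eventually) (auto simp: less_imp_le)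
  moreover have "0 \<le> limsup (\<lambda>n. ereal (avg_dist T n x y))"
    by (intro le_Limsup always_eventually) (auto simp: avg_dist_nonneg)
  ultimately show ?thesis unfolding mean_dist_def by (subst ereal_real) auto
qed

lemma mean_dist_leI:
  assumes "x \<in> X" "y \<in> X" "\<forall>\<^sub>F n in sequentially. avg_dist T n x y \<le> c"
  shows "mean_dist T x y \<le> c"
proof -
  have "ereal (mean_dist T x y) \<le> ereal c"
    unfolding ereal_mean_dist[OF assms(1,2)] using assms(3) by (intro Limsup_bounded) simp
  then show ?thesis by simp
qed

lemma mean_dist_lessD:
  assumes "x \<in> X" "y \<in> X" "mean_dist T x y < c"
  shows "\<forall>\<^sub>F n in sequentially. avg_dist T n x y < c"
proof -
  have "limsup (\<lambda>n. ereal (avg_dist T n x y)) < ereal c"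
    using assms(3) unfolding ereal_mean_dist[OF assms(1,2), symmetric] by simp
  then have "\<forall>\<^sub>F n in sequentially. ereal (avg_dist T n x y) < ereal c" by (rule Limsup_lessD)
  then show ?thesis by simp
qed

lemma mean_dist_nonneg:
  assumes "x \<in> X" "y \<in> X" shows "0 \<le> mean_dist T x y"
proof (rule ccontr)
  assume "\<not> ?thesis"
  then have "\<forall>\<^sub>F n in sequentially. avg_dist T n x y < 0" using mean_dist_lessD[OF assms, of 0] by simp
  then have "\<forall>\<^sub>F n :: nat in sequentially. False"
    by eventually_elim (use avg_dist_nonneg[of T] in \<open>simp add: not_less[symmetric]\<close>)
  then show False by simp
qed

lemma mean_dist_triangle:
  assumes "x \<in> X" "y \<in> X" "z \<in> X"
  shows "mean_dist T x z \<le> mean_dist T x y + mean_dist T y z"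
proof (rule field_le_epsilon)
  fix e :: real assume e: "e > 0"
  have "\<forall>\<^sub>F n in sequentially. avg_dist T n x y < mean_dist T x y + e / 2"
    "\<forall>\<^sub>F n in sequentially. avg_dist T n y z < mean_dist T y z + e / 2"
    using e by (auto intro!: mean_dist_lessD assms)
  then have "\<forall>\<^sub>F n in sequentially. avg_dist T n x z \<le> mean_dist T x y + mean_dist T y z + e"
  proof eventually_elim
    case (elim n)
    then show ?case using avg_dist_triangle[of T n x z y] by linarith
  qed
  then show "mean_dist T x z \<le> mean_dist T x y + mean_dist T y z + e"
    by (rule mean_dist_leI[OF assms(1,3)])
qed

lemma birkhoff_average_shift:
  fixes f :: "'a \<Rightarrow> real"
  assumes f: "continuous_on X f" and x: "x \<in> X"
  shows "(\<lambda>n. (\<Sum>i=1..n. f ((T ^^ i) ((T ^^ m) x))) / real n - (\<Sum>i=1..n. f ((T ^^ i) x)) / real n)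
    \<longlonglongrightarrow> 0"
proof (induction m)
  case (Suc m)
  obtain B where B: "B \<ge> 0" "\<And>x. x \<in> X \<Longrightarrow> \<bar>f x\<bar> \<le> B"
    by (rule continuous_on_compact_bounded_real[OF compact_X f]) blast
  define y where "y = (T ^^ m) x"
  have y: "y \<in> X" unfolding y_def by (rule iter_in[OF x])
  have "(\<lambda>n. (\<Sum>i=1..n. f ((T ^^ i) (T y))) / real n - (\<Sum>i=1..n. f ((T ^^ i) y)) / real n) \<longlonglongrightarrow> 0"
  proof (rule Lim_null_comparison)
    show "(\<lambda>n. 2 * B / real n) \<longlonglongrightarrow> 0"
      by (intro tendsto_divide_0[OF tendsto_const] filterlim_real_sequentially[THEN filterlim_at_top_imp_at_infinity])
    have "norm ((\<Sum>i=1..n. f ((T ^^ i) (T y))) / real n - (\<Sum>i=1..n. f ((T ^^ i) y)) / real n) \<le> 2 * B / real n" for n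
    proof -
      have "(\<Sum>i=1..n. f ((T ^^ i) (T y))) - (\<Sum>i=1..n. f ((T ^^ i) y)) = f ((T ^^ Suc n) y) - f ((T ^^ 1) y)"
        by (induction n) (auto simp: funpow_swap1[symmetric])
      moreover have "\<bar>f ((T ^^ Suc n) y) - f ((T ^^ 1) y)\<bar> \<le> 2 * B"
        using B(2)[OF iter_in[OF y], of "Suc n"] B(2)[OF iter_in[OF y], of 1] by linarith
      ultimately show ?thesis by (simp add: diff_divide_distrib[symmetric] divide_right_mono)
    qed
    then show "\<forall>\<^sub>F n in sequentially. norm ((\<Sum>i=1..n. f ((T ^^ i) (T y))) / real n
        - (\<Sum>i=1..n. f ((T ^^ i) y)) / real n) \<le> 2 * B / real n"
      by (intro always_eventually allI)
  qed
  from tendsto_add[OF this Suc] show ?case by (simp add: y_def)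
qed simp

end

text \<open>Applying \<open>T\<close> to both points shifts the window of summation by one step,
  which changes an average by at most \<open>2 * B / n\<close>.\<close>

lemma (in topological_system) mean_dist_T:
  assumes "x \<in> X" "y \<in> X"
  shows "mean_dist T (T x) (T y) = mean_dist T x y"
proof -
  obtain B where B: "B > 0" "\<And>x y. x \<in> X \<Longrightarrow> y \<in> X \<Longrightarrow> dist x y \<le> B"
    by (rule diameter_bound) blast
  have le: "\<bar>avg_dist T n (T x) (T y) - avg_dist T n x y\<bar> \<le> 2 * B / real n" for n
  proof -
    define g where "g i = dist ((T ^^ i) x) ((T ^^ i) y)" for i
    have "(\<Sum>i=1..n. g (Suc i)) - (\<Sum>i=1..n. g i) = g (Suc n) - g 1" by (induction n) auto
    moreover have "\<bar>g (Suc n) - g 1\<bar> \<le> 2 * B"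
      using B(2)[OF iter_in[OF assms(1)] iter_in[OF assms(2)], of "Suc n" "Suc n"]
        B(2)[OF iter_in[OF assms(1)] iter_in[OF assms(2)], of 1 1] zero_le_dist
      unfolding g_def by (smt (verit) zero_le_dist)
    ultimately show ?thesis
      by (simp add: avg_dist_def g_def funpow_swap1[symmetric] diff_divide_distrib[symmetric] divide_right_mono)
  qed
  have lim: "(\<lambda>n. 2 * B / real n) \<longlonglongrightarrow> 0"
    by (intro tendsto_divide_0[OF tendsto_const] filterlim_real_sequentially[THEN filterlim_at_top_imp_at_infinity])
  have small: "\<forall>\<^sub>F n in sequentially. 2 * B / real n < e" if "e > 0" for e
    using order_tendstoD(2)[OF lim that] .
  have 1: "mean_dist T (T x) (T y) \<le> mean_dist T x y"
  proof (rule field_le_epsilon)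
    fix e :: real assume e: "e > 0"
    have "\<forall>\<^sub>F n in sequentially. avg_dist T n x y < mean_dist T x y + e / 2"
      using e by (intro mean_dist_lessD assms) auto
    then have "\<forall>\<^sub>F n in sequentially. avg_dist T n (T x) (T y) \<le> mean_dist T x y + e"
      using small[OF half_gt_zero[OF e]]
    proof eventually_elim
      case (elim n)
      then show ?case using le[of n] by linarith
    qed
    then show "mean_dist T (T x) (T y) \<le> mean_dist T x y + e"
      by (intro mean_dist_leI T_in assms)
  qed
  have 2: "mean_dist T x y \<le> mean_dist T (T x) (T y)"
  proof (rule field_le_epsilon)
    fix e :: real assume e: "e > 0"
    have "\<forall>\<^sub>F n in sequentially. avg_dist T n (T x) (T y) < mean_dist T (T x) (T y) + e / 2"
      using e by (intro mean_dist_lessD T_in assms) auto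
    then have "\<forall>\<^sub>F n in sequentially. avg_dist T n x y \<le> mean_dist T (T x) (T y) + e"
      using small[OF half_gt_zero[OF e]]
    proof eventually_elim
      case (elim n)
      then show ?case using le[of n] by linarith
    qed
    then show "mean_dist T x y \<le> mean_dist T (T x) (T y) + e"
      by (intro mean_dist_leI assms)
  qed
  show ?thesis using 1 2 by simp
qed

lemma (in topological_system) mean_dist_iter:
  assumes "x \<in> X" "y \<in> X"
  shows "mean_dist T ((T ^^ n) x) ((T ^^ n) y) = mean_dist T x y"
  by (induction n) (use assms in \<open>auto simp: mean_dist_T iter_in\<close>)

locale mean_equicontinuous_system = minimal_system +
  assumes mean_equicontinuous: "mean_equicontinuous X T"
begin

lemma mean_dist_small:
  assumes "e > 0"
  obtains d where "d > 0" "\<And>x y. x \<in> X \<Longrightarrow> y \<in> X \<Longrightarrow> dist x y \<le> d \<Longrightarrow> mean_dist T x y \<le> e"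
proof -
  have "\<exists>d>0. \<forall>x\<in>X. \<forall>y\<in>X. dist x y \<le> d \<longrightarrow>
      limsup (\<lambda>n. ereal (avg_dist T n x y)) \<le> ereal e"
    using mean_equicontinuous assms unfolding mean_equicontinuous_def avg_dist_def by simp
  then show ?thesis using that by (auto simp: ereal_mean_dist[symmetric])
qed

text \<open>Mean equicontinuity is smallness near the diagonal; the triangle inequality in each
  variable carries it to all pairs.\<close>

lemma continuous_mean_dist: "continuous_on (X \<times> X) (\<lambda>(x, y). mean_dist T x y)"
  unfolding continuous_on_iff
proof (intro ballI allI impI)
  fix p and e :: real assume p: "p \<in> X \<times> X" and e: "e > 0"
  obtain d where d: "d > 0" "\<And>x y. x \<in> X \<Longrightarrow> y \<in> X \<Longrightarrow> dist x y \<le> d \<Longrightarrow> mean_dist T x y \<le> e / 3"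
    using mean_dist_small[of "e / 3"] e by auto
  show "\<exists>d>0. \<forall>q\<in>X \<times> X. dist q p < d \<longrightarrow>
      dist (case q of (x, y) \<Rightarrow> mean_dist T x y) (case p of (x, y) \<Rightarrow> mean_dist T x y) < e"
  proof (intro exI[of _ d] conjI ballI impI d(1))
    fix q assume q: "q \<in> X \<times> X" "dist q p < d"
    obtain x y x' y' where pq: "p = (x, y)" "q = (x', y')" by (metis surj_pair)
    then have in_X: "x \<in> X" "y \<in> X" "x' \<in> X" "y' \<in> X" using p q by auto
    have "dist x' x \<le> d" "dist y' y \<le> d"
      using q(2) dist_fst_le[of q p] dist_snd_le[of q p] pq by auto
    then have "mean_dist T x' x \<le> e / 3" "mean_dist T y' y \<le> e / 3" using d(2) in_X by auto
    then have "\<bar>mean_dist T x' y' - mean_dist T x y\<bar> \<le> 2 * e / 3"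
      using mean_dist_triangle[of x' x y'] mean_dist_triangle[of x y y']
        mean_dist_triangle[of x x' y] mean_dist_triangle[of x' y' y] in_X
        mean_dist_commute[of T x x'] mean_dist_commute[of T y y'] by linarith
    then show "dist (case q of (x, y) \<Rightarrow> mean_dist T x y) (case p of (x, y) \<Rightarrow> mean_dist T x y) < e"
      using e pq by (simp add: dist_real_def)
  qed
qed

lemma continuous_on_mean_dist [continuous_intros]:
  assumes "continuous_on A f" "continuous_on A g" "f ` A \<subseteq> X" "g ` A \<subseteq> X"
  shows "continuous_on A (\<lambda>a. mean_dist T (f a) (g a))"
  using continuous_on_compose2[OF continuous_mean_dist continuous_on_Pair[OF assms(1,2)]] assms(3,4)
  by auto

text \<open>Some iterate of \<open>x\<close> comes so close to \<open>y\<close> that their averaged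
  distance is small, and replacing \<open>x\<close> by an iterate does not affect its averages in
  the limit.\<close>

lemma birkhoff_average_difference:
  fixes f :: "'a \<Rightarrow> real"
  assumes f: "continuous_on X f" and xy: "x \<in> X" "y \<in> X"
  shows "(\<lambda>n. (\<Sum>i=1..n. f ((T ^^ i) x)) / real n - (\<Sum>i=1..n. f ((T ^^ i) y)) / real n) \<longlonglongrightarrow> 0"
  unfolding tendsto_iff
proof (intro allI impI)
  fix e :: real assume e: "e > 0"
  define a where "a x n = (\<Sum>i=1..n. f ((T ^^ i) x)) / real n" for x n
  obtain C where C: "C > 0" "\<And>x y. x \<in> X \<Longrightarrow> y \<in> X \<Longrightarrow> \<bar>f x - f y\<bar> \<le> e / 4 + C * dist x y"
    by (rule uniformly_continuous_linear_bound[OF compact_X f, of "e / 4"]) (use e in auto)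
  \<comment> \<open>This makes three errors of \<open>e / 4\<close>: the constant of the linear
    bound, \<open>C * c\<close>, and the shift from \<open>x\<close> to \<open>z\<close>.\<close>
  define c where "c = e / (4 * C)"
  have c: "c > 0" "C * c = e / 4" using C e by (auto simp: c_def)
  obtain d where d: "d > 0" "\<And>x y. x \<in> X \<Longrightarrow> y \<in> X \<Longrightarrow> dist x y \<le> d \<Longrightarrow> mean_dist T x y \<le> c / 2"
    using mean_dist_small[of "c / 2"] c by auto
  obtain m where m: "dist ((T ^^ m) x) y < d" using orbit_approaches[OF xy d(1)] .
  define z where "z = (T ^^ m) x"
  have z: "z \<in> X" unfolding z_def by (rule iter_in[OF xy(1)])
  have "mean_dist T z y < c" using d(2)[OF z xy(2)] m c(1) by (auto simp: z_def)
  then have "\<forall>\<^sub>F n in sequentially. avg_dist T n z y < c" by (rule mean_dist_lessD[OF z xy(2)])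
  moreover have "\<forall>\<^sub>F n in sequentially. dist (a z n - a x n) 0 < e / 4"
    unfolding a_def z_def by (rule tendstoD[OF birkhoff_average_shift[OF f xy(1)]]) (use e in simp)
  ultimately show "\<forall>\<^sub>F n in sequentially. dist (a x n - a y n) 0 < e" 
    using eventually_gt_at_top[of 0]
  proof eventually_elim
    case (elim n)
    have "\<bar>(\<Sum>i=1..n. f ((T ^^ i) z)) - (\<Sum>i=1..n. f ((T ^^ i) y))\<bar>
        \<le> (\<Sum>i=1..n. \<bar>f ((T ^^ i) z) - f ((T ^^ i) y)\<bar>)"
      unfolding sum_subtractf[symmetric] by (rule sum_abs)
    also have "\<dots> \<le> (\<Sum>i=1..n. e / 4 + C * dist ((T ^^ i) z) ((T ^^ i) y))"
      using z xy iter_in by (intro sum_mono C(2)) auto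
    also have "\<dots> = real n * (e / 4) + C * (\<Sum>i=1..n. dist ((T ^^ i) z) ((T ^^ i) y))"
      by (simp add: sum.distrib sum_distrib_left)
    finally have "\<bar>a z n - a y n\<bar> \<le> (real n * (e / 4) + C * (\<Sum>i=1..n. dist ((T ^^ i) z) ((T ^^ i) y))) / real n"
      unfolding a_def diff_divide_distrib[symmetric] by (simp add: divide_right_mono)
    also have "\<dots> = e / 4 + C * avg_dist T n z y"
      using elim(3) by (simp add: avg_dist_def add_divide_distrib)
    also have "\<dots> \<le> e / 4 + C * c" using elim(1) C(1) by simp
    finally have "\<bar>a z n - a y n\<bar> \<le> e / 2" using c(2) by simp
    moreover have "\<bar>a z n - a x n\<bar> < e / 4" using elim(2) by (simp add: dist_real_def)
    ultimately have "\<bar>a x n - a y n\<bar> < e" using e by linarith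
    then show ?case by (simp add: dist_real_def)
  qed
qed

text \<open>The averages at \<open>x\<close> and \<open>y\<close> differ by a null sequence.
  Integrating over \<open>x\<close> turns the average at \<open>x\<close> into the integral of
  \<open>f\<close>, exactly for each \<open>n > 0\<close> by invariance. The averages at
  \<open>y\<close> do not mention \<open>M\<close>, which yields unique ergodicity.\<close>

lemma birkhoff_average_tendsto:
  fixes f :: "'a \<Rightarrow> real"
  assumes M: "invariant_prob X T M" and f: "continuous_on X f" and y: "y \<in> X"
  shows "(\<lambda>n. (\<Sum>i=1..n. f ((T ^^ i) y)) / real n) \<longlonglongrightarrow> integral\<^sup>L M f"
proof -
  interpret prob_space M using M by (simp add: invariant_prob_def)
  have sM: "sets M = sets (restrict_space borel X)" using M by (simp add: invariant_prob_def)
  note sp = space_restrict_borel_eq[OF sM]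
  have fin: "finite_measure M" by unfold_locales
  define a where "a x n = (\<Sum>i=1..n. f ((T ^^ i) x)) / real n" for x n
  have ac: "continuous_on X (\<lambda>x. a x n)" for n
    unfolding a_def divide_inverse
    by (intro continuous_on_mult continuous_on_sum continuous_on_const continuous_on_comp_iter[OF f])
  obtain B where B: "B \<ge> 0" "\<And>x. x \<in> X \<Longrightarrow> \<bar>f x\<bar> \<le> B"
    by (rule continuous_on_compact_bounded_real[OF compact_X f]) blast
  have aB: "\<bar>a x n\<bar> \<le> B" if "x \<in> X" for x n
  proof -
    have "\<bar>\<Sum>i=1..n. f ((T ^^ i) x)\<bar> \<le> (\<Sum>i=1..n. \<bar>f ((T ^^ i) x)\<bar>)" by (rule sum_abs)
    also have "\<dots> \<le> real (card {1..n}) * B"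
      using B(2) iter_in[OF that] by (intro sum_bounded_above) auto
    finally show ?thesis using B(1) by (cases "n = 0") (simp_all add: a_def abs_divide field_simps)
  qed
  have "(\<lambda>n. LINT x|M. a x n - a y n) \<longlonglongrightarrow> (LINT x|M. 0)"
  proof (rule integral_dominated_convergence[where w="\<lambda>_. 2 * B"])
    show "(\<lambda>x. a x n - a y n) \<in> borel_measurable M" for n
      by (intro continuous_on_borel_measurable_restrict[OF sM] continuous_intros ac)
    show "AE x in M. (\<lambda>n. a x n - a y n) \<longlonglongrightarrow> 0"
      using birkhoff_average_difference[OF f _ y] sp by (intro AE_I2) (simp add: a_def)
    show "AE x in M. norm (a x n - a y n) \<le> 2 * B" for n
    proof (intro AE_I2)
      fix x assume "x \<in> space M"
      then show "norm (a x n - a y n) \<le> 2 * B" using aB[of x n] aB[OF y, of n] sp by simp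
    qed
  qed auto
  moreover have "(LINT x|M. a x n - a y n) = integral\<^sup>L M f - a y n" if "n > 0" for n
  proof -
    have "(LINT x|M. a x n) = (\<Sum>i=1..n. LINT x|M. f ((T ^^ i) x)) / real n"
      unfolding a_def integral_divide_zero using integrable_continuous_on_compact[OF fin sM compact_X continuous_on_comp_iter[OF f]]
      by (subst Bochner_Integration.integral_sum) auto
    also have "\<dots> = integral\<^sup>L M f" using invariant_prob_integral_iter[OF M f] that by simp
    finally show ?thesis using integrable_continuous_on_compact[OF fin sM compact_X ac[of n]]
      by (simp add: prob_space)
  qed
  then have "\<forall>\<^sub>F n in sequentially. (LINT x|M. a x n - a y n) = integral\<^sup>L M f - a y n"
    by (rule eventually_mono[OF eventually_gt_at_top[of 0]])
  ultimately have "(\<lambda>n. integral\<^sup>L M f - a y n) \<longlonglongrightarrow> 0"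
    by (simp add: tendsto_cong)
  from tendsto_diff[OF tendsto_const[of "integral\<^sup>L M f"] this] show ?thesis by (simp add: a_def)
qed

theorem invariant_prob_unique:
  assumes "invariant_prob X T M" "invariant_prob X T N"
  shows "M = N"
proof (rule measure_eqI_continuous_integrals[OF _ _ compact_X])
  fix f :: "'a \<Rightarrow> real" assume f: "continuous_on X f"
  obtain y where y: "y \<in> X" using X_nonempty by blast
  show "integral\<^sup>L M f = integral\<^sup>L N f"
    using birkhoff_average_tendsto[OF assms(1) f y] birkhoff_average_tendsto[OF assms(2) f y]
    by (rule LIMSEQ_unique)
qed (use assms in \<open>auto simp: invariant_prob_def\<close>)

end

section \<open>The quotient by the mean orbit distance\<close>

text \<open>A continuous map from a compact space onto a Hausdorff one is a quotient map: preimages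
  of closed sets under \<open>f\<close> are images of compact sets under \<open>g\<close>.\<close>

lemma continuous_on_image_factor:
  fixes g :: "'a::topological_space \<Rightarrow> 'b::t2_space" and f :: "'b \<Rightarrow> 'c::topological_space"
  assumes "compact X" "continuous_on X g" "continuous_on X (\<lambda>x. f (g x))"
  shows "continuous_on (g ` X) f"
proof -
  have "closed (g ` X)" using assms by (intro compact_imp_closed compact_continuous_image)
  moreover have "closed (f -` C \<inter> g ` X)" if C: "closed C" for C
  proof -
    obtain D where D: "closed D" "D \<inter> X = (\<lambda>x. f (g x)) -` C \<inter> X"
      using assms(3) C unfolding continuous_on_closed_invariant by blast
    have "f -` C \<inter> g ` X = g ` (X \<inter> D)" using D(2) by auto
    moreover have "compact (g ` (X \<inter> D))"
      using assms(1) D(1) by (intro compact_continuous_image continuous_on_subset[OF assms(2)] compact_Int_closed) auto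
    ultimately show ?thesis using compact_imp_closed by simp
  qed
  ultimately show ?thesis by (simp add: continuous_on_closed_vimage)
qed

text \<open>On the compact set where \<open>h\<close> is at least \<open>e\<close>, \<open>f\<close>
  attains a positive minimum. This compares pseudometrics vanishing on the same pairs, and detects
  closeness to a singleton fibre.\<close>

lemma compact_zero_set_control:
  fixes f h :: "'a::topological_space \<Rightarrow> real"
  assumes K: "compact K" and f: "continuous_on K f" and h: "continuous_on K h"
    and zero: "\<And>z. z \<in> K \<Longrightarrow> f z \<le> 0 \<Longrightarrow> h z \<le> 0" and e: "e > 0"
  obtains d where "d > 0" "\<And>z. z \<in> K \<Longrightarrow> f z < d \<Longrightarrow> h z < e"
proof (cases "\<exists>z\<in>K. e \<le> h z")
  case True
  obtain D where D: "closed D" "D \<inter> K = h -` {e..} \<inter> K"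
    using h closed_atLeast[of e] unfolding continuous_on_closed_invariant by blast
  have "compact (K \<inter> D)" using K D(1) by (rule compact_Int_closed)
  moreover have "K \<inter> D \<noteq> {}" using True D(2) by auto
  ultimately obtain z where z: "z \<in> K \<inter> D" "\<forall>w\<in>K \<inter> D. f z \<le> f w"
    using continuous_attains_inf continuous_on_subset[OF f] by (metis inf_le1)
  have "z \<in> K" "h z \<ge> e" using z(1) D(2) by auto
  then have "f z > 0" using zero[of z] e by linarith
  then show ?thesis
  proof (rule that)
    fix w assume w: "w \<in> K" "f w < f z"
    then have "w \<notin> D" using z(2) by force
    then show "h w < e" using D(2) w(1) by auto
  qed
next
  case False
  then show ?thesis using that[of 1] by force
qed

lemma (in topological_system) factor_map_iter:
  assumes "factor_map X T Y S f" "x \<in> X"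
  shows "f ((T ^^ n) x) = (S ^^ n) (f x)"
  by (induction n) (use assms iter_in in \<open>auto simp: factor_map_def\<close>)

context mean_equicontinuous_system
begin

lemma mean_dist_eq_of_zero:
  assumes "x \<in> X" "x' \<in> X" "y \<in> X" "mean_dist T x x' = 0"
  shows "mean_dist T x y = mean_dist T x' y"
  using mean_dist_triangle[of x x' y] mean_dist_triangle[of x' x y] assms mean_dist_commute[of T x x']
  by simp

lemma mean_dist_small_near:
  assumes "e > 0" "y \<in> X" "x \<in> X"
  obtains n where "mean_dist T ((T ^^ n) x) y < e"
proof -
  obtain d where d: "d > 0" "\<And>x y. x \<in> X \<Longrightarrow> y \<in> X \<Longrightarrow> dist x y \<le> d \<Longrightarrow> mean_dist T x y \<le> e / 2"
    using mean_dist_small[of "e / 2"] assms(1) by auto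
  obtain n where "dist ((T ^^ n) x) y < d" using orbit_approaches[OF assms(3,2) d(1)] .
  then have "mean_dist T ((T ^^ n) x) y \<le> e / 2" using d(2) iter_in[OF assms(3)] assms(2) by simp
  then show ?thesis using assms(1) by (intro that[of n]) simp
qed

text \<open>The quotient of the system by the pseudometric \<open>mean_dist T\<close>, realised in sequence space by
  the distances to a dense orbit.\<close>

definition orbit_dist_map :: "'a \<Rightarrow> 'a \<Rightarrow> nat \<Rightarrow> real" where
  "orbit_dist_map x0 x n = mean_dist T x ((T ^^ n) x0)"

lemma continuous_orbit_dist_map:
  assumes "x0 \<in> X" shows "continuous_on X (orbit_dist_map x0)"
  unfolding orbit_dist_map_def using iter_in[OF assms]
  by (intro continuous_on_coordinatewise_then_product continuous_on_mean_dist continuous_on_id continuous_on_const) auto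

lemma orbit_dist_map_eq_iff:
  assumes x0: "x0 \<in> X" and xy: "x \<in> X" "y \<in> X"
  shows "orbit_dist_map x0 x = orbit_dist_map x0 y \<longleftrightarrow> mean_dist T x y = 0"
proof
  assume "mean_dist T x y = 0"
  then show "orbit_dist_map x0 x = orbit_dist_map x0 y"
    unfolding orbit_dist_map_def using mean_dist_eq_of_zero[OF xy iter_in[OF x0]] by blast
next
  assume eq: "orbit_dist_map x0 x = orbit_dist_map x0 y"
  have "mean_dist T x y \<le> 0"
  proof (rule field_le_epsilon)
    fix e :: real assume e: "e > 0"
    obtain n where n: "mean_dist T ((T ^^ n) x0) y < e / 2"
      using mean_dist_small_near[of "e / 2" y x0] e xy x0 by auto
    have "mean_dist T x ((T ^^ n) x0) = mean_dist T y ((T ^^ n) x0)"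
      using fun_cong[OF eq, of n] by (simp add: orbit_dist_map_def)
    then show "mean_dist T x y \<le> 0 + e"
      using mean_dist_triangle[OF xy(1) iter_in[OF x0] xy(2), of n] n
        mean_dist_commute[of T y "(T ^^ n) x0"] by linarith
  qed
  then show "mean_dist T x y = 0" using mean_dist_nonneg[OF xy] by simp
qed

text \<open>\<open>T\<close> is an isometry for \<open>mean_dist T\<close>, but sequence space
  carries another metric. Compactness makes the two uniformly equivalent on the quotient;
  equicontinuity follows by passing to \<open>mean_dist T\<close>, iterating, and passing
  back.\<close>

lemma equicontinuous_quotient:
  assumes x0: "x0 \<in> X"
  obtains R where "tds (orbit_dist_map x0 ` X) R" "equicontinuous_tds (orbit_dist_map x0 ` X) R"
    "factor_map X T (orbit_dist_map x0 ` X) R (orbit_dist_map x0)"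
proof -
  define g where "g = orbit_dist_map x0"
  have gc: "continuous_on X g" unfolding g_def by (rule continuous_orbit_dist_map[OF x0])
  have giff: "g x = g y \<longleftrightarrow> mean_dist T x y = 0" if "x \<in> X" "y \<in> X" for x y
    unfolding g_def by (rule orbit_dist_map_eq_iff[OF x0 that])
  \<comment> \<open>The choice of preimage is harmless: points with the same image have mean
    distance 0, and so have their images under \<open>T\<close>.\<close>
  define R where "R z = g (T (inv_into X g z))" for z
  have Rg: "R (g x) = g (T x)" if x: "x \<in> X" for x
  proof -
    define w where "w = inv_into X g (g x)"
    have w: "w \<in> X" "g w = g x" using x by (auto simp: w_def inv_into_into f_inv_into_f)
    then have "mean_dist T (T w) (T x) = 0" using giff x by (simp add: mean_dist_T)
    then show ?thesis using giff T_in w(1) x by (simp add: R_def w_def[symmetric])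
  qed
  have Rn: "(R ^^ n) (g x) = g ((T ^^ n) x)" if "x \<in> X" for x n
    using that by (induction n) (auto simp: Rg iter_in)
  have gTc: "continuous_on X (\<lambda>x. g (T x))"
    using T_in by (intro continuous_on_compose2[OF gc continuous_T]) auto
  have Rc: "continuous_on X (\<lambda>x. R (g x))"
    using gTc by (subst continuous_on_cong[OF refl Rg]) auto
  have cXX: "compact (X \<times> X)" using compact_X by (intro compact_Times)
  have dg: "continuous_on (X \<times> X) (\<lambda>p. dist (g (fst p)) (g (snd p)))"
    by (intro continuous_on_dist continuous_on_compose2[OF gc] continuous_intros) auto
  have dm: "continuous_on (X \<times> X) (\<lambda>p. mean_dist T (fst p) (snd p))"
    using continuous_mean_dist by (simp add: case_prod_unfold)
  have "tds (g ` X) R"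
    using compact_X X_nonempty gc Rc T_in
    by (auto simp: tds_def Rg intro!: compact_continuous_image continuous_on_image_factor)
  moreover have "equicontinuous_tds (g ` X) R"
    unfolding equicontinuous_tds_def
  proof (intro allI impI)
    fix e :: real assume e: "e > 0"
    obtain a where a: "a > 0"
      "\<And>p. p \<in> X \<times> X \<Longrightarrow> mean_dist T (fst p) (snd p) < a \<Longrightarrow> dist (g (fst p)) (g (snd p)) < e"
    proof (rule compact_zero_set_control[OF cXX dm dg _ e])
      fix p assume "p \<in> X \<times> X" "mean_dist T (fst p) (snd p) \<le> 0"
      then show "dist (g (fst p)) (g (snd p)) \<le> 0"
        using giff[of "fst p" "snd p"] mean_dist_nonneg[of "fst p" "snd p"] by auto
    qed blast
    obtain d where d: "d > 0"
      "\<And>p. p \<in> X \<times> X \<Longrightarrow> dist (g (fst p)) (g (snd p)) < d \<Longrightarrow> mean_dist T (fst p) (snd p) < a"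
    proof (rule compact_zero_set_control[OF cXX dg dm _ a(1)])
      fix p assume "p \<in> X \<times> X" "dist (g (fst p)) (g (snd p)) \<le> 0"
      then show "mean_dist T (fst p) (snd p) \<le> 0" using giff by auto
    qed blast
    show "\<exists>d>0. \<forall>x\<in>g ` X. \<forall>y\<in>g ` X. dist x y < d \<longrightarrow> (\<forall>n. dist ((R ^^ n) x) ((R ^^ n) y) < e)"
    proof (intro exI[of _ d] conjI d(1) ballI impI allI)
      fix u v n assume "u \<in> g ` X" "v \<in> g ` X" and uv: "dist u v < d"
      then obtain x y where xy: "x \<in> X" "y \<in> X" "u = g x" "v = g y" by blast
      then have "mean_dist T ((T ^^ n) x) ((T ^^ n) y) < a" using d(2)[of "(x, y)"] uv by (simp add: mean_dist_iter)
      then show "dist ((R ^^ n) u) ((R ^^ n) v) < e"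
        using a(2)[of "((T ^^ n) x, (T ^^ n) y)"] xy iter_in by (simp add: Rn)
    qed
  qed
  moreover have "factor_map X T (g ` X) R g" using gc Rg by (simp add: factor_map_def)
  ultimately show ?thesis using that unfolding g_def by blast
qed

text \<open>The factor map onto the quotient given by maximality need not be compatible with \<open>p\<close>; the
  recurrence times \<open>n\<close> of \<open>p x\<close> are nevertheless also those of a point of the quotient, and
  \<open>mean_dist T (T\<^sup>n u) u\<close> does not depend on \<open>u\<close>.\<close>

lemma mean_dist_zero_on_fibres:
  assumes max: "maximal_equicontinuous_factor X T Y S p"
    and x: "x \<in> X" "x' \<in> X" and eq: "p x = p x'"
  shows "mean_dist T x x' = 0"
proof -
  define g where "g = orbit_dist_map x"
  obtain R where R: "tds (g ` X) R" "equicontinuous_tds (g ` X) R" "factor_map X T (g ` X) R g"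
    using equicontinuous_quotient[OF x(1)] unfolding g_def .
  obtain h where h: "factor_map Y S (g ` X) R h"
    using maximal_equicontinuous_factorD[OF max R] by blast
  have p: "factor_map X T Y S p" and Y: "tds Y S" using max by (auto simp: maximal_equicontinuous_factor_def)
  interpret Y: topological_system Y S using Y by unfold_locales
  have px: "p x \<in> Y" using p x(1) by (auto simp: factor_map_def)
  have hc: "continuous_on Y h" using h by (simp add: factor_map_def)
  have pc: "continuous_on X p" using p by (simp add: factor_map_def)
  have gc: "continuous_on X g" unfolding g_def by (rule continuous_orbit_dist_map[OF x(1)])
  \<comment> \<open>\<open>w\<close> need not be \<open>x\<close>, since \<open>h \<circ> p\<close>
    may differ from \<open>g\<close>.\<close>
  obtain w where w: "w \<in> X" "h (p x) = g w" using h px by (auto simp: factor_map_def)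
  have "mean_dist T x x' \<le> 0"
  proof (rule field_le_epsilon)
    fix e :: real assume e: "e > 0"
    have e2: "e / 2 > 0" using e by simp
    obtain d1 where d1: "d1 > 0" "\<And>q. q \<in> X \<times> X \<Longrightarrow> dist (g (fst q)) (g (snd q)) < d1 \<Longrightarrow>
        mean_dist T (fst q) (snd q) < e / 2"
    proof (rule compact_zero_set_control[of "X \<times> X" "\<lambda>q. dist (g (fst q)) (g (snd q))"
          "\<lambda>q. mean_dist T (fst q) (snd q)", OF _ _ _ _ e2])
      show "compact (X \<times> X)" using compact_X by (intro compact_Times)
      show "continuous_on (X \<times> X) (\<lambda>q. dist (g (fst q)) (g (snd q)))"
        by (intro continuous_on_dist continuous_on_compose2[OF gc] continuous_intros) auto
      show "continuous_on (X \<times> X) (\<lambda>q. mean_dist T (fst q) (snd q))"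
        using continuous_mean_dist by (simp add: case_prod_unfold)
      show "mean_dist T (fst q) (snd q) \<le> 0" if "q \<in> X \<times> X" "dist (g (fst q)) (g (snd q)) \<le> 0" for q
        using that orbit_dist_map_eq_iff[OF x(1)] by (auto simp: g_def)
    qed blast
    obtain d2 where d2: "d2 > 0" "\<And>y. y \<in> Y \<Longrightarrow> dist y (p x) < d2 \<Longrightarrow> dist (h y) (h (p x)) < d1"
      using hc px d1(1) unfolding continuous_on_iff by metis
    obtain d3 where d3: "d3 > 0" "\<And>u. u \<in> X \<Longrightarrow> dist u x' < d3 \<Longrightarrow> dist (p u) (p x') < d2"
      using pc x(2) d2(1) unfolding continuous_on_iff by metis
    obtain d4 where d4: "d4 > 0" "\<And>x y. x \<in> X \<Longrightarrow> y \<in> X \<Longrightarrow> dist x y \<le> d4 \<Longrightarrow> mean_dist T x y \<le> e / 2"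
      using mean_dist_small[OF e2] by blast
    \<comment> \<open>An iterate of \<open>x\<close> near \<open>x'\<close> has its image near
      \<open>p x' = p x\<close>, so \<open>n\<close> is an approximate return time of
      \<open>p x\<close>, and through \<open>h\<close> also of \<open>g w\<close>.\<close>
    obtain n where n: "dist ((T ^^ n) x) x' < min d3 d4"
      using orbit_approaches[OF x, of "min d3 d4"] d3(1) d4(1) by auto
    have "dist ((S ^^ n) (p x)) (p x) < d2"
      using d3(2)[OF iter_in[OF x(1), of n]] n eq factor_map_iter[OF p x(1), of n] by simp
    then have "dist (h ((S ^^ n) (p x))) (h (p x)) < d1" using d2(2) Y.iter_in[OF px] by blast
    moreover have "h ((S ^^ n) (p x)) = g ((T ^^ n) w)"
      using Y.factor_map_iter[OF h px, of n] factor_map_iter[OF R(3) w(1), of n] w(2) by simp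
    ultimately have "mean_dist T ((T ^^ n) w) w < e / 2"
      using d1(2)[of "((T ^^ n) w, w)"] w iter_in[OF w(1)] by simp
    moreover have "mean_dist T ((T ^^ n) w) w = mean_dist T ((T ^^ n) x) x"
    proof (rule invariant_continuous_constant[OF _ _ w(1) x(1)])
      show "continuous_on X (\<lambda>u. mean_dist T ((T ^^ n) u) u)"
        using iter_in by (intro continuous_on_mean_dist continuous_iter continuous_on_id) auto
      show "mean_dist T ((T ^^ n) (T u)) (T u) = mean_dist T ((T ^^ n) u) u" if "u \<in> X" for u
        using mean_dist_T[OF iter_in[OF that] that, of n] by (simp add: funpow_swap1)
    qed
    moreover have "mean_dist T ((T ^^ n) x) x' \<le> e / 2" using d4(2)[OF iter_in[OF x(1)] x(2)] n by simp
    ultimately show "mean_dist T x x' \<le> 0 + e"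
      using mean_dist_triangle[OF x(1) iter_in[OF x(1)] x(2), of n] mean_dist_commute[of T x "(T ^^ n) x"]
      by linarith
  qed
  then show ?thesis using mean_dist_nonneg[OF x] by simp
qed

end

section \<open>The factor map is an isomorphism\<close>

context mean_equicontinuous_system
begin

text \<open>A continuous substitute for the indicator of a neighbourhood of the diagonal in
  \<open>mean_dist T\<close>; it vanishes once the mean distance reaches \<open>e\<close>.\<close>

definition kernel :: "real \<Rightarrow> 'a \<Rightarrow> 'a \<Rightarrow> real" where
  "kernel e x y = max 0 (e - mean_dist T x y)"

lemma kernel_nonneg: "0 \<le> kernel e x y"
  by (simp add: kernel_def)

lemma kernel_le: "x \<in> X \<Longrightarrow> y \<in> X \<Longrightarrow> e > 0 \<Longrightarrow> kernel e x y \<le> e"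
  by (simp add: kernel_def mean_dist_nonneg)

lemma kernel_iter: "x \<in> X \<Longrightarrow> y \<in> X \<Longrightarrow> kernel e ((T ^^ n) x) ((T ^^ n) y) = kernel e x y"
  by (simp add: kernel_def mean_dist_iter)

lemma continuous_on_kernel:
  assumes "continuous_on A f" "continuous_on A g" "f ` A \<subseteq> X" "g ` A \<subseteq> X"
  shows "continuous_on A (\<lambda>a. kernel e (f a) (g a))"
  unfolding kernel_def
  by (intro continuous_on_max continuous_on_const continuous_on_diff continuous_on_mean_dist assms)

end

locale mean_equicontinuous_prob = mean_equicontinuous_system +
  fixes \<mu> :: "'a measure"
  assumes invariant: "invariant_prob X T \<mu>"
begin

sublocale prob_space \<mu>
  using invariant by (simp add: invariant_prob_def)

lemma sets_\<mu>: "sets \<mu> = sets (restrict_space borel X)"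
  using invariant by (simp add: invariant_prob_def)

lemma space_\<mu>: "space \<mu> = X"
  by (rule space_restrict_borel_eq[OF sets_\<mu>])

lemma integrable_continuous: "continuous_on X f \<Longrightarrow> integrable \<mu> f" for f :: "'a \<Rightarrow> real"
  by (intro integrable_continuous_on_compact[OF _ sets_\<mu> compact_X]) unfold_locales

lemma continuous_on_section:
  assumes "continuous_on (X \<times> X) (\<lambda>(x, y). H x y)" "x \<in> X"
  shows "continuous_on X (H x)"
  using continuous_on_compose2[OF assms(1) continuous_on_Pair[OF continuous_on_const continuous_on_id]] assms(2)
  by auto

lemma iterated_integral_iter:
  fixes H :: "'a \<Rightarrow> 'a \<Rightarrow> real"
  assumes H: "continuous_on (X \<times> X) (\<lambda>(x, y). H x y)"
  shows "(LINT x|\<mu>. LINT y|\<mu>. H ((T ^^ n) x) ((T ^^ n) y)) = (LINT x|\<mu>. LINT y|\<mu>. H x y)"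
proof -
  have "(LINT x|\<mu>. LINT y|\<mu>. H ((T ^^ n) x) ((T ^^ n) y)) = (LINT x|\<mu>. LINT y|\<mu>. H ((T ^^ n) x) y)"
    using continuous_on_section[OF H] iter_in space_\<mu>
    by (intro Bochner_Integration.integral_cong refl invariant_prob_integral_iter[OF invariant]) auto
  also have "\<dots> = (LINT x|\<mu>. LINT y|\<mu>. H x y)"
    by (intro invariant_prob_integral_iter[OF invariant] continuous_on_integral_kernel[OF _ sets_\<mu> compact_X H])
      unfold_locales
  finally show ?thesis .
qed

text \<open>The mass is a continuous invariant function of \<open>x\<close>. Its constancy gives the
  normalised joining the marginal \<open>\<mu>\<close> on either side.\<close>

lemma kernel_mass_constant:
  assumes "x \<in> X" "x' \<in> X"
  shows "(LINT y|\<mu>. kernel e x y) = (LINT y|\<mu>. kernel e x' y)"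
proof (rule invariant_continuous_constant[OF _ _ assms])
  have k: "continuous_on (X \<times> X) (\<lambda>(x, y). kernel e x y)"
    using continuous_on_kernel[OF continuous_on_fst[OF continuous_on_id] continuous_on_snd[OF continuous_on_id], of "X \<times> X"]
    by (auto simp: case_prod_unfold)
  then show "continuous_on X (\<lambda>x. LINT y|\<mu>. kernel e x y)"
    by (intro continuous_on_integral_kernel[OF _ sets_\<mu> compact_X]) unfold_locales
  fix x assume x: "x \<in> X"
  have "(LINT y|\<mu>. kernel e (T x) y) = (LINT y|\<mu>. kernel e (T x) (T y))"
    using invariant_prob_integral_iter[OF invariant continuous_on_section[OF k T_in[OF x]], of 1] by simp
  also have "\<dots> = (LINT y|\<mu>. kernel e x y)"
    using kernel_iter[OF x, of _ e 1] space_\<mu> by (intro Bochner_Integration.integral_cong) auto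
  finally show "(LINT y|\<mu>. kernel e (T x) y) = (LINT y|\<mu>. kernel e x y)" .
qed

lemma kernel_mass_pos:
  assumes "x \<in> X" "e > 0" shows "(LINT y|\<mu>. kernel e x y) > 0"
  by (rule invariant_prob_full_support[OF invariant _ _ assms(1)])
    (use assms in \<open>auto simp: kernel_def intro!: continuous_on_max continuous_on_diff continuous_on_mean_dist continuous_on_const continuous_on_id\<close>)

text \<open>The joining with density \<open>kernel e\<close> is invariant under \<open>T \<times> T\<close>, so the integral of the
  distance equals that of its averages, which are eventually below \<open>e\<close> on the support.\<close>

lemma kernel_dist_integral_le:
  assumes e: "e > 0"
  shows "(LINT x|\<mu>. LINT y|\<mu>. dist x y * kernel e x y) \<le> e * (LINT x|\<mu>. LINT y|\<mu>. kernel e x y)"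
proof -
  define H where "H i x y = dist ((T ^^ i) x) ((T ^^ i) y) * kernel e x y" for i x y
  have cf: "continuous_on (X \<times> X) (\<lambda>p. (T ^^ i) (fst p))" "continuous_on (X \<times> X) (\<lambda>p. (T ^^ i) (snd p))" for i
    by (auto intro!: continuous_on_compose2[OF continuous_iter] continuous_intros)
  have ck: "continuous_on (X \<times> X) (\<lambda>p. kernel e (fst p) (snd p))"
    by (intro continuous_on_kernel continuous_intros) auto
  have cK: "continuous_on (X \<times> X) (\<lambda>(x, y). kernel e x y)" using ck by (simp add: case_prod_unfold)
  have cH: "continuous_on (X \<times> X) (\<lambda>(x, y). H i x y)" for i
    unfolding H_def case_prod_unfold by (intro continuous_on_mult continuous_on_dist cf ck)
  define A where "A n x y = avg_dist T n x y" for n x y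
  have cA': "continuous_on (X \<times> X) (\<lambda>p. A n (fst p) (snd p))" for n
    unfolding A_def avg_dist_def divide_inverse
    by (intro continuous_on_mult continuous_on_sum continuous_on_const continuous_on_dist cf)
  \<comment> \<open>The excess of the \<open>n\<close>-step averages over \<open>e\<close>, weighted
    by the kernel. It tends to 0 pointwise: where the kernel is positive, the averages are
    eventually below \<open>e\<close>.\<close>
  define P where "P n x y = max 0 (A n x y - e) * kernel e x y" for n x y
  have cP: "continuous_on (X \<times> X) (\<lambda>(x, y). P n x y)" for n
    unfolding P_def case_prod_unfold
    by (intro continuous_on_mult continuous_on_max continuous_on_diff continuous_on_const cA' ck)
  have cAk: "continuous_on (X \<times> X) (\<lambda>(x, y). A n x y * kernel e x y)" for n
    unfolding case_prod_unfold by (intro continuous_on_mult cA' ck)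
  have cE: "continuous_on (X \<times> X) (\<lambda>(x, y). e * kernel e x y)"
    unfolding case_prod_unfold by (intro continuous_on_mult continuous_on_const ck)
  have inner: "continuous_on X (\<lambda>x. LINT y|\<mu>. G x y)" if "continuous_on (X \<times> X) (\<lambda>(x, y). G x y)" for G :: "'a \<Rightarrow> 'a \<Rightarrow> real"
    using that by (intro continuous_on_integral_kernel[OF _ sets_\<mu> compact_X]) unfold_locales
  note int_in = integrable_continuous[OF continuous_on_section] and int_out = integrable_continuous[OF inner]
  define J where "J = (LINT x|\<mu>. LINT y|\<mu>. dist x y * kernel e x y)"
  define c where "c = (LINT x|\<mu>. LINT y|\<mu>. kernel e x y)"
  obtain B where B: "B > 0" "\<And>x y. x \<in> X \<Longrightarrow> y \<in> X \<Longrightarrow> dist x y \<le> B"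
    by (rule diameter_bound) blast
  have JH: "(LINT x|\<mu>. LINT y|\<mu>. H i x y) = J" for i
  proof -
    have "(LINT x|\<mu>. LINT y|\<mu>. H i x y) = (LINT x|\<mu>. LINT y|\<mu>. H 0 ((T ^^ i) x) ((T ^^ i) y))"
      by (intro Bochner_Integration.integral_cong refl) (simp add: H_def kernel_iter space_\<mu>)
    also have "\<dots> = (LINT x|\<mu>. LINT y|\<mu>. H 0 x y)" by (rule iterated_integral_iter[OF cH])
    finally show ?thesis by (simp add: H_def J_def)
  qed
  have JA: "J = (LINT x|\<mu>. LINT y|\<mu>. A n x y * kernel e x y)" if n: "n > 0" for n
  proof -
    have "(LINT x|\<mu>. LINT y|\<mu>. A n x y * kernel e x y) = (LINT x|\<mu>. LINT y|\<mu>. (\<Sum>i=1..n. H i x y) / real n)"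
      by (simp add: A_def avg_dist_def H_def sum_distrib_right)
    also have "\<dots> = (LINT x|\<mu>. (\<Sum>i=1..n. LINT y|\<mu>. H i x y) / real n)"
      using int_in[OF cH] space_\<mu> by (intro Bochner_Integration.integral_cong refl) simp
    also have "\<dots> = (\<Sum>i=1..n. LINT x|\<mu>. LINT y|\<mu>. H i x y) / real n"
      using int_out[OF cH] by simp
    also have "\<dots> = J" using JH n by simp
    finally show ?thesis ..
  qed
  have step: "J \<le> e * c + (LINT x|\<mu>. LINT y|\<mu>. P n x y)" if n: "n > 0" for n
  proof -
    have "J \<le> (LINT x|\<mu>. (LINT y|\<mu>. e * kernel e x y) + (LINT y|\<mu>. P n x y))"
      unfolding JA[OF n]
    proof (rule integral_mono)
      fix x assume "x \<in> space \<mu>"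
      then have x: "x \<in> X" using space_\<mu> by simp
      have "(LINT y|\<mu>. A n x y * kernel e x y) \<le> (LINT y|\<mu>. e * kernel e x y + P n x y)"
      proof (rule integral_mono)
        fix y
        show "A n x y * kernel e x y \<le> e * kernel e x y + P n x y"
          unfolding P_def distrib_right[symmetric] using kernel_nonneg[of e x y]
          by (intro mult_right_mono) auto
      qed (use int_in[OF cAk x] int_in[OF cE x] int_in[OF cP x] in auto)
      then show "(LINT y|\<mu>. A n x y * kernel e x y) \<le> (LINT y|\<mu>. e * kernel e x y) + (LINT y|\<mu>. P n x y)"
        using int_in[OF cE x] int_in[OF cP x] by simp
    qed (use int_out[OF cAk] int_out[OF cE] int_out[OF cP] in auto)
    also have "\<dots> = (LINT x|\<mu>. LINT y|\<mu>. e * kernel e x y) + (LINT x|\<mu>. LINT y|\<mu>. P n x y)"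
      using int_out[OF cE] int_out[OF cP] by simp
    also have "(LINT x|\<mu>. LINT y|\<mu>. e * kernel e x y) = e * c" by (simp add: c_def)
    finally show ?thesis by simp
  qed
  have Pb: "\<bar>P n x y\<bar> \<le> B * e" if xy: "x \<in> X" "y \<in> X" for n x y
  proof -
    have "A n x y \<le> B" unfolding A_def using B xy by (intro avg_dist_le) auto
    then have "max 0 (A n x y - e) \<le> B" using B(1) e by simp
    then have "max 0 (A n x y - e) * kernel e x y \<le> B * e"
      using kernel_le[OF xy e] kernel_nonneg B(1) by (intro mult_mono) auto
    then show ?thesis using kernel_nonneg[of e x y] by (simp add: P_def abs_mult)
  qed
  have P0: "(\<lambda>n. P n x y) \<longlonglongrightarrow> 0" if xy: "x \<in> X" "y \<in> X" for x y
  proof (cases "mean_dist T x y < e")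
    case True
    have "\<forall>\<^sub>F n in sequentially. P n x y = 0"
      using mean_dist_lessD[OF xy True] by eventually_elim (simp add: P_def A_def)
    then show ?thesis by (rule tendsto_eventually)
  next
    case False
    then show ?thesis by (simp add: P_def kernel_def)
  qed
  have "(\<lambda>n. LINT x|\<mu>. LINT y|\<mu>. P n x y) \<longlonglongrightarrow> (LINT x|\<mu>. 0)"
  proof (rule integral_dominated_convergence[where w="\<lambda>_. B * e"])
    show "AE x in \<mu>. (\<lambda>n. LINT y|\<mu>. P n x y) \<longlonglongrightarrow> 0"
    proof (intro AE_I2)
      fix x assume "x \<in> space \<mu>"
      then have x: "x \<in> X" using space_\<mu> by simp
      have "(\<lambda>n. LINT y|\<mu>. P n x y) \<longlonglongrightarrow> (LINT y|\<mu>. 0)"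
        using P0[OF x] Pb[OF x] space_\<mu> borel_measurable_integrable[OF int_in[OF cP x]]
        by (intro integral_dominated_convergence[where w="\<lambda>_. B * e"]) auto
      then show "(\<lambda>n. LINT y|\<mu>. P n x y) \<longlonglongrightarrow> 0" by simp
    qed
    show "AE x in \<mu>. norm (LINT y|\<mu>. P n x y) \<le> B * e" for n
    proof (intro AE_I2)
      fix x assume "x \<in> space \<mu>"
      then have x: "x \<in> X" using space_\<mu> by simp
      have "\<bar>LINT y|\<mu>. P n x y\<bar> \<le> (LINT y|\<mu>. B * e)"
        using Pb[OF x] int_in[OF cP x] space_\<mu>
        by (intro order_trans[OF integral_abs_bound] integral_mono) auto
      then show "norm (LINT y|\<mu>. P n x y) \<le> B * e" by (simp add: prob_space)
    qed
  qed (use borel_measurable_integrable[OF int_out[OF cP]] in auto)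
  then have "(\<lambda>n. e * c + (LINT x|\<mu>. LINT y|\<mu>. P n x y)) \<longlonglongrightarrow> e * c + 0"
    by (intro tendsto_add tendsto_const) simp
  moreover have "\<forall>\<^sub>F n in sequentially. J \<le> e * c + (LINT x|\<mu>. LINT y|\<mu>. P n x y)"
    using step by (rule eventually_mono[OF eventually_gt_at_top[of 0]])
  ultimately show ?thesis unfolding J_def[symmetric] c_def[symmetric]
    by (intro tendsto_lowerbound[of _ "e * c" sequentially J]) auto
qed

text \<open>\<open>F x\<close>, the kernel-weighted mean of \<open>dist y u\<close> over
  \<open>y\<close>, is an approximate conditional expectation. It sees \<open>x\<close> only through
  mean distances, hence only through \<open>p x\<close>, and its L1 error is at most the
  kernel-weighted mean of \<open>dist x y\<close>.\<close>

lemma dist_approximated_by_factor: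
  fixes p :: "'a \<Rightarrow> 'b::metric_space"
  assumes p: "continuous_on X p" "\<And>x x'. x \<in> X \<Longrightarrow> x' \<in> X \<Longrightarrow> p x = p x' \<Longrightarrow> mean_dist T x x' = 0"
    and u: "u \<in> X" and e: "e > 0"
  shows "\<exists>G. continuous_on (p ` X) G \<and> (LINT x|\<mu>. \<bar>dist x u - G (p x)\<bar>) \<le> e"
proof -
  define c where "c = (LINT y|\<mu>. kernel e u y)"
  have c: "c > 0" unfolding c_def using kernel_mass_pos[OF u e] .
  have ceq: "(LINT y|\<mu>. kernel e x y) = c" if "x \<in> X" for x
    unfolding c_def by (rule kernel_mass_constant[OF that u])
  define F where "F x = (LINT y|\<mu>. dist y u * kernel e x y) / c" for x
  have ck: "continuous_on (X \<times> X) (\<lambda>p. kernel e (fst p) (snd p))"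
    by (intro continuous_on_kernel continuous_intros) auto
  have cK: "continuous_on (X \<times> X) (\<lambda>(x, y). kernel e x y)" using ck by (simp add: case_prod_unfold)
  have c1: "continuous_on (X \<times> X) (\<lambda>(x, y). dist y u * kernel e x y)"
    unfolding case_prod_unfold by (intro continuous_on_mult ck continuous_intros)
  have c2: "continuous_on (X \<times> X) (\<lambda>(x, y). dist x y * kernel e x y)"
    unfolding case_prod_unfold by (intro continuous_on_mult ck continuous_intros)
  have inner: "continuous_on X (\<lambda>x. LINT y|\<mu>. G x y)" if "continuous_on (X \<times> X) (\<lambda>(x, y). G x y)" for G :: "'a \<Rightarrow> 'a \<Rightarrow> real"
    using that by (intro continuous_on_integral_kernel[OF _ sets_\<mu> compact_X]) unfold_locales
  have Fc: "continuous_on X F"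
    unfolding F_def using c by (intro continuous_on_divide inner[OF c1] continuous_on_const) auto
  have Feq: "F x = F x'" if xx': "x \<in> X" "x' \<in> X" "p x = p x'" for x x'
    unfolding F_def kernel_def
    using mean_dist_eq_of_zero[OF xx'(1,2) _ p(2)[OF xx']] space_\<mu>
    by (intro arg_cong2[of _ _ _ _ "(/)"] Bochner_Integration.integral_cong refl) simp
  define G where "G z = F (inv_into X p z)" for z
  have Gp: "G (p x) = F x" if "x \<in> X" for x
    unfolding G_def using that by (intro Feq) (auto simp: inv_into_into f_inv_into_f)
  have "continuous_on (p ` X) G"
    using Fc by (intro continuous_on_image_factor[OF compact_X p(1)]) (simp cong: continuous_on_cong add: Gp)
  moreover have "(LINT x|\<mu>. \<bar>dist x u - G (p x)\<bar>) \<le> e"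
  proof -
    have le: "\<bar>dist x u - F x\<bar> \<le> (LINT y|\<mu>. dist x y * kernel e x y) / c" if x: "x \<in> X" for x
    proof -
      have i1: "integrable \<mu> (\<lambda>y. dist y u * kernel e x y)"
        by (rule integrable_continuous[OF continuous_on_section[OF c1 x]])
      have i2: "integrable \<mu> (\<lambda>y. dist x y * kernel e x y)"
        by (rule integrable_continuous[OF continuous_on_section[OF c2 x]])
      have i3: "integrable \<mu> (\<lambda>y. kernel e x y)"
        using integrable_continuous[OF continuous_on_section[OF cK x]] .
      have "c * dist x u = (LINT y|\<mu>. dist x u * kernel e x y)" using ceq[OF x] by (simp add: mult.commute)
      then have "c * (dist x u - F x) = (LINT y|\<mu>. dist x u * kernel e x y - dist y u * kernel e x y)"
        using c i1 i3 by (simp add: F_def right_diff_distrib)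
      also have "\<bar>\<dots>\<bar> \<le> (LINT y|\<mu>. dist x y * kernel e x y)"
      proof (intro order_trans[OF integral_abs_bound] integral_mono i2)
        show "integrable \<mu> (\<lambda>y. \<bar>dist x u * kernel e x y - dist y u * kernel e x y\<bar>)"
          using i1 i3 by (intro integrable_abs Bochner_Integration.integrable_diff) auto
        fix y
        have "\<bar>dist x u - dist y u\<bar> \<le> dist x y"
          using dist_triangle[of x u y] dist_triangle[of y u x] dist_commute[of x y] by linarith
        then show "\<bar>dist x u * kernel e x y - dist y u * kernel e x y\<bar> \<le> dist x y * kernel e x y"
          using kernel_nonneg[of e x y] by (simp add: left_diff_distrib[symmetric] abs_mult mult_right_mono)
      qed
      finally show ?thesis using c by (simp add: abs_mult pos_le_divide_eq mult.commute)
    qed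
    have "(LINT x|\<mu>. \<bar>dist x u - G (p x)\<bar>) = (LINT x|\<mu>. \<bar>dist x u - F x\<bar>)"
      using space_\<mu> by (intro Bochner_Integration.integral_cong) (auto simp: Gp)
    also have "\<dots> \<le> (LINT x|\<mu>. (LINT y|\<mu>. dist x y * kernel e x y) / c)"
    proof (rule integral_mono)
      show "integrable \<mu> (\<lambda>x. \<bar>dist x u - F x\<bar>)"
        by (intro integrable_abs integrable_continuous continuous_on_diff Fc continuous_on_dist continuous_on_id continuous_on_const)
      show "integrable \<mu> (\<lambda>x. (LINT y|\<mu>. dist x y * kernel e x y) / c)"
        using integrable_continuous[OF inner[OF c2]] by simp
    qed (use le space_\<mu> in auto)
    also have "\<dots> = (LINT x|\<mu>. LINT y|\<mu>. dist x y * kernel e x y) / c" by simp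
    also have "\<dots> \<le> e * (LINT x|\<mu>. LINT y|\<mu>. kernel e x y) / c"
      using kernel_dist_integral_le[OF e] c by (intro divide_right_mono) auto
    also have "(LINT x|\<mu>. LINT y|\<mu>. kernel e x y) = (LINT x|\<mu>. c)"
      using space_\<mu> by (intro Bochner_Integration.integral_cong) (auto simp: ceq)
    also have "e * (LINT x|\<mu>. c) / c = e" using c by (simp add: prob_space)
    finally show ?thesis .
  qed
  ultimately show ?thesis by blast
qed

text \<open>A subsequence of the L1 approximations converges almost everywhere. Where it diverges
  \<open>lim\<close> is unspecified, but the function it defines on the factor is still
  Borel.\<close>

lemma dist_AE_eq_factor_function:
  fixes p :: "'a \<Rightarrow> 'b::metric_space"
  assumes p: "continuous_on X p" "\<And>x x'. x \<in> X \<Longrightarrow> x' \<in> X \<Longrightarrow> p x = p x' \<Longrightarrow> mean_dist T x x' = 0"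
    and u: "u \<in> X"
  shows "\<exists>G. G \<in> borel_measurable (restrict_space borel (p ` X)) \<and> (AE x in \<mu>. dist x u = G (p x))"
proof -
  have "\<forall>k. \<exists>G. continuous_on (p ` X) G \<and> (LINT x|\<mu>. \<bar>dist x u - G (p x)\<bar>) \<le> inverse (real (Suc k))"
    by (intro allI dist_approximated_by_factor[OF p u]) simp_all
  then obtain G where G: "\<And>k. continuous_on (p ` X) (G k)"
    "\<And>k. (LINT x|\<mu>. \<bar>dist x u - G k (p x)\<bar>) \<le> inverse (real (Suc k))" by metis
  have "\<exists>r::nat\<Rightarrow>nat. strict_mono r \<and> (AE x in \<mu>. (\<lambda>n. dist x u - G (r n) (p x)) \<longlonglongrightarrow> 0)"
  proof (rule tendsto_L1_AE_subseq)
    show "integrable \<mu> (\<lambda>x. dist x u - G n (p x))" for n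
      by (intro integrable_continuous continuous_on_diff continuous_on_dist continuous_on_id continuous_on_const
          continuous_on_compose2[OF G(1) p(1)]) auto
    show "(\<lambda>n. LINT x|\<mu>. norm (dist x u - G n (p x))) \<longlonglongrightarrow> 0"
      by (rule tendsto_sandwich[OF _ _ tendsto_const LIMSEQ_inverse_real_of_nat])
        (use G(2) in \<open>auto intro!: always_eventually\<close>)
  qed
  then obtain r :: "nat \<Rightarrow> nat" where r: "AE x in \<mu>. (\<lambda>n. dist x u - G (r n) (p x)) \<longlonglongrightarrow> 0" by blast
  show ?thesis
  proof (intro exI[of _ "\<lambda>y. lim (\<lambda>n. G (r n) y)"] conjI)
    show "(\<lambda>y. lim (\<lambda>n. G (r n) y)) \<in> borel_measurable (restrict_space borel (p ` X))"
      using borel_measurable_continuous_on_restrict[OF G(1)] by (intro borel_measurable_lim_metric)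
    show "AE x in \<mu>. dist x u = lim (\<lambda>n. G (r n) (p x))"
      using r
    proof eventually_elim
      case (elim x)
      from tendsto_diff[OF tendsto_const[of "dist x u"] elim]
      have "(\<lambda>n. G (r n) (p x)) \<longlonglongrightarrow> dist x u" by simp
      then show ?case by (simp add: limI)
    qed
  qed
qed

end

section \<open>Factors, image measures and almost inverse maps\<close>

lemma (in minimal_system) minimal_factor:
  assumes "factor_map X T Y S p" shows "minimal_tds Y S"
  unfolding minimal_tds_def
proof (intro ballI subsetI)
  fix y y' assume "y \<in> Y" "y' \<in> Y"
  then obtain x x' where x: "x \<in> X" "x' \<in> X" "y = p x" "y' = p x'"
    using assms by (auto simp: factor_map_def)
  show "y' \<in> closure (range (\<lambda>n. (S ^^ n) y))"
    unfolding closure_approachable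
  proof (intro allI impI)
    fix e :: real assume "e > 0"
    then obtain d where d: "d > 0" "\<And>u. u \<in> X \<Longrightarrow> dist u x' < d \<Longrightarrow> dist (p u) (p x') < e"
      using assms x(2) unfolding factor_map_def continuous_on_iff by metis
    obtain n where "dist ((T ^^ n) x) x' < d" using orbit_approaches[OF x(1,2) d(1)] .
    then have "dist ((S ^^ n) y) y' < e"
      using d(2) iter_in[OF x(1)] x factor_map_iter[OF assms x(1)] by metis
    then show "\<exists>z\<in>range (\<lambda>n. (S ^^ n) y). dist z y' < e" by blast
  qed
qed

lemma equicontinuous_imp_mean_equicontinuous:
  assumes "equicontinuous_tds X T" shows "mean_equicontinuous X T"
  unfolding mean_equicontinuous_def
proof (intro allI impI)
  fix e :: real assume e: "e > 0"
  obtain d where d: "d > 0"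
    "\<And>x y n. x \<in> X \<Longrightarrow> y \<in> X \<Longrightarrow> dist x y < d \<Longrightarrow> dist ((T ^^ n) x) ((T ^^ n) y) < e"
    using assms e unfolding equicontinuous_tds_def by metis
  show "\<exists>\<delta>>0. \<forall>x\<in>X. \<forall>y\<in>X. dist x y \<le> \<delta> \<longrightarrow>
      limsup (\<lambda>n. ereal ((\<Sum>i=1..n. dist ((T ^^ i) x) ((T ^^ i) y)) / real n)) \<le> ereal e"
  proof (intro exI[of _ "d / 2"] conjI ballI impI)
    fix x y assume xy: "x \<in> X" "y \<in> X" "dist x y \<le> d / 2"
    have "(\<Sum>i=1..n. dist ((T ^^ i) x) ((T ^^ i) y)) / real n \<le> e" for n
    proof -
      have "(\<Sum>i=1..n. dist ((T ^^ i) x) ((T ^^ i) y)) \<le> real (card {1..n}) * e"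
        using d xy by (intro sum_bounded_above less_imp_le) auto
      then show ?thesis using e by (cases "n = 0") (simp_all add: field_simps)
    qed
    then show "limsup (\<lambda>n. ereal ((\<Sum>i=1..n. dist ((T ^^ i) x) ((T ^^ i) y)) / real n)) \<le> ereal e"
      by (intro Limsup_bounded always_eventually) simp
  qed (use d in simp)
qed

lemma (in topological_system) invariant_prob_factor:
  assumes \<mu>: "invariant_prob X T \<mu>" and p: "factor_map X T Y S p" and Y: "tds Y S"
  shows "invariant_prob Y S (distr \<mu> (restrict_space borel Y) p)"
proof -
  interpret \<mu>: prob_space \<mu> using \<mu> by (simp add: invariant_prob_def)
  have s\<mu>: "sets \<mu> = sets (restrict_space borel X)" and d: "distr \<mu> \<mu> T = \<mu>"
    using \<mu> by (auto simp: invariant_prob_def)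
  interpret Y: topological_system Y S using Y by unfold_locales
  define R where "R = (restrict_space borel Y :: 'b measure)"
  have pm: "p \<in> measurable \<mu> R"
    using p by (intro continuous_on_measurable_restrict[OF s\<mu>]) (auto simp: R_def factor_map_def)
  have Sm: "S \<in> measurable R R"
    using Y.continuous_T Y.T_in by (intro continuous_on_measurable_restrict) (auto simp: R_def)
  have Tm: "T \<in> measurable \<mu> \<mu>"
    using continuous_T T_in by (intro continuous_on_measurable_restrict[OF s\<mu> s\<mu>]) auto
  have "distr (distr \<mu> R p) R S = distr \<mu> R (S \<circ> p)" using Sm pm by (rule distr_distr)
  also have "\<dots> = distr \<mu> R (p \<circ> T)"
    using p space_restrict_borel_eq[OF s\<mu>] by (intro distr_cong) (auto simp: factor_map_def)
  also have "\<dots> = distr (distr \<mu> \<mu> T) R p" using pm Tm by (rule distr_distr[symmetric])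
  finally have "distr (distr \<mu> R p) R S = distr \<mu> R p" by (simp add: d)
  moreover have "distr (distr \<mu> R p) (distr \<mu> R p) S = distr (distr \<mu> R p) R S" by (intro distr_cong) auto
  ultimately show ?thesis using \<mu>.prob_space_distr[OF pm] by (simp add: invariant_prob_def R_def)
qed

text \<open>The metric space type need not be second countable, so equality is tested on the
  countably many real coordinates of an embedding of \<open>Y\<close>.\<close>

lemma measurable_set_eq_of_compact:
  fixes f g :: "'a \<Rightarrow> 'b::metric_space"
  assumes Y: "compact Y" and f: "f \<in> measurable M (restrict_space borel Y)"
    and g: "g \<in> measurable M (restrict_space borel Y)"
  shows "{x \<in> space M. f x = g x} \<in> sets M"
proof -
  obtain e :: "'b \<Rightarrow> nat \<Rightarrow> real" and r where "homeomorphism Y (e ` Y) e r"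
    using compact_embedding_nat_real[OF Y] .
  then have ec: "continuous_on Y e" and inj: "inj_on e Y"
    by (auto simp: homeomorphism_def intro: inj_on_inverseI)
  have em: "(\<lambda>y. e y n) \<in> borel_measurable (restrict_space borel Y)" for n
    by (rule borel_measurable_continuous_on_restrict[OF continuous_on_product_then_coordinatewise[OF ec]])
  have in_Y: "f x \<in> Y" "g x \<in> Y" if "x \<in> space M" for x
    using measurable_space[OF f that] measurable_space[OF g that] by (auto simp: space_restrict_space)
  have [measurable]: "(\<lambda>x. e (f x) n) \<in> borel_measurable M" "(\<lambda>x. e (g x) n) \<in> borel_measurable M" for n
    using measurable_compose[OF f em] measurable_compose[OF g em] by auto
  have "{x \<in> space M. f x = g x} = {x \<in> space M. \<forall>n. e (f x) n = e (g x) n}"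
    using in_Y inj_onD[OF inj] by (metis ext)
  also have "\<dots> \<in> sets M" by measurable
  finally show ?thesis .
qed

text \<open>Distances to the points of one dense orbit embed \<open>X\<close> in sequence space.
  Each coordinate is almost everywhere a Borel function of \<open>p x\<close>, and together they
  recover \<open>x\<close>.\<close>

lemma (in mean_equicontinuous_prob) almost_inverse_exists:
  fixes p :: "'a \<Rightarrow> 'b::metric_space"
  assumes p: "continuous_on X p" "\<And>x x'. x \<in> X \<Longrightarrow> x' \<in> X \<Longrightarrow> p x = p x' \<Longrightarrow> mean_dist T x x' = 0"
  obtains \<sigma> where "\<sigma> \<in> measurable (restrict_space borel (p ` X)) \<mu>" "AE x in \<mu>. \<sigma> (p x) = x"
proof -
  obtain x0 where x0: "x0 \<in> X" using X_nonempty by blast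
  define e where "e x n = dist x ((T ^^ n) x0)" for x n
  have ec: "continuous_on X e"
    unfolding e_def by (intro continuous_on_coordinatewise_then_product continuous_intros)
  have "inj_on e X"
  proof (rule inj_onI)
    fix x y assume xy: "x \<in> X" "y \<in> X" "e x = e y"
    have "dist x y \<le> 0"
    proof (rule field_le_epsilon)
      fix c :: real assume c: "c > 0"
      obtain n where "dist ((T ^^ n) x0) y < c / 2"
        using orbit_approaches[OF x0 xy(2), of "c / 2"] c by auto
      moreover have "dist x ((T ^^ n) x0) = dist y ((T ^^ n) x0)"
        using fun_cong[OF xy(3), of n] by (simp add: e_def)
      ultimately show "dist x y \<le> 0 + c"
        using dist_triangle[of x y "(T ^^ n) x0"] dist_commute[of y "(T ^^ n) x0"] by linarith
    qed
    then show "x = y" by simp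
  qed
  then obtain r where hom: "homeomorphism X (e ` X) e r"
    using homeomorphism_compact[OF compact_X ec refl] by blast
  then have rc: "continuous_on (e ` X) r" and re: "\<And>x. x \<in> X \<Longrightarrow> r (e x) = x"
    by (auto simp: homeomorphism_def)
  have "\<forall>n. \<exists>G. G \<in> borel_measurable (restrict_space borel (p ` X)) \<and> (AE x in \<mu>. e x n = G (p x))"
    unfolding e_def using dist_AE_eq_factor_function[OF p iter_in[OF x0]] by blast
  then obtain G where G: "\<And>n. G n \<in> borel_measurable (restrict_space borel (p ` X))"
    "\<And>n. AE x in \<mu>. e x n = G n (p x)" by metis
  define \<gamma> where "\<gamma> y n = G n y" for y n
  have \<gamma>m: "\<gamma> \<in> borel_measurable (restrict_space borel (p ` X))"
    using G(1) by (intro measurable_coordinatewise_then_product) (simp add: \<gamma>_def)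
  have cl: "closed (e ` X)" using compact_imp_closed[OF compact_continuous_image[OF ec compact_X]] .
  \<comment> \<open>The inverse of the embedding on its closed image, with default value
    \<open>x0\<close> elsewhere.\<close>
  define s where "s v = (if v \<in> e ` X then r v else x0)" for v
  have "s \<in> borel_measurable borel"
    unfolding s_def using cl borel_measurable_continuous_on_restrict[OF rc]
    by (intro measurable_If_restrict_space_iff[THEN iffD2]) auto
  then have "s \<in> measurable borel (restrict_space borel X)"
    using x0 re by (intro measurable_restrict_space2) (auto simp: s_def)
  then have sm: "s \<in> measurable borel \<mu>" using measurable_cong_sets[OF refl sets_\<mu>] by blast
  show ?thesis
  proof (rule that[of "\<lambda>y. s (\<gamma> y)"])
    show "(\<lambda>y. s (\<gamma> y)) \<in> measurable (restrict_space borel (p ` X)) \<mu>"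
      using \<gamma>m sm by (rule measurable_compose)
    have "AE x in \<mu>. \<forall>n. e x n = G n (p x)" using G(2) by (simp add: AE_all_countable)
    then show "AE x in \<mu>. s (\<gamma> (p x)) = x"
    proof (rule AE_mp, intro AE_I2 impI)
      fix x assume x: "x \<in> space \<mu>" "\<forall>n. e x n = G n (p x)"
      then have "\<gamma> (p x) = e x" by (auto simp: \<gamma>_def)
      then show "s (\<gamma> (p x)) = x" using re x(1) space_\<mu> by (simp add: s_def)
    qed
  qed
qed

text \<open>\<open>p\<close> is injective on the set \<open>A0\<close> where \<open>\<sigma>\<close>
  inverts it. Asking the whole forward orbit to stay in \<open>A0\<close> makes the set forward
  invariant and keeps full measure, because \<open>T\<close> preserves \<open>\<mu>\<close>.\<close>

lemma (in topological_system) isomorphism_of_almost_inverse: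
  assumes \<mu>: "invariant_prob X T \<mu>" and p: "factor_map X T Y S p" and Y: "tds Y S"
    and \<sigma>: "\<sigma> \<in> measurable (restrict_space borel Y) \<mu>" "AE x in \<mu>. \<sigma> (p x) = x"
  shows "measure_theoretic_isomorphism \<mu> T (distr \<mu> (restrict_space borel Y) p) S p"
proof -
  have s\<mu>: "sets \<mu> = sets (restrict_space borel X)" and d: "distr \<mu> \<mu> T = \<mu>"
    using \<mu> by (auto simp: invariant_prob_def)
  note sp = space_restrict_borel_eq[OF s\<mu>]
  define R where "R = (restrict_space borel Y :: 'b measure)"
  define \<nu> where "\<nu> = distr \<mu> R p"
  have sR: "space R = Y" by (simp add: R_def space_restrict_space)
  have pm: "p \<in> measurable \<mu> R"
    using p by (intro continuous_on_measurable_restrict[OF s\<mu>]) (auto simp: R_def factor_map_def)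
  have Tm: "T \<in> measurable \<mu> \<mu>"
    using continuous_T T_in by (intro continuous_on_measurable_restrict[OF s\<mu> s\<mu>]) auto
  have Tnm: "(T ^^ n) \<in> measurable \<mu> \<mu>" for n by (rule measurable_compose_n[OF Tm])
  have \<sigma>m: "\<sigma> \<in> measurable R \<mu>" using \<sigma>(1) by (simp add: R_def)
  have cY: "compact Y" using Y by (simp add: tds_def)
  have pT: "p (T x) = S (p x)" "p x \<in> Y" if "x \<in> X" for x using p that by (auto simp: factor_map_def)
  define A0 where "A0 = {x \<in> X. \<sigma> (p x) = x}"
  have A0: "A0 \<in> sets \<mu>"
  proof -
    have "{x \<in> space \<mu>. \<sigma> (p x) = x} \<in> sets \<mu>"
      using measurable_compose[OF pm \<sigma>m] measurable_cong_sets[OF refl s\<mu>]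
      by (intro measurable_set_eq_of_compact[OF compact_X]) (auto simp: sp intro!: measurable_ident_sets s\<mu>)
    then show ?thesis by (simp add: A0_def sp)
  qed
  define A where "A = {x \<in> X. \<forall>n. (T ^^ n) x \<in> A0}"
  have A: "A \<in> sets \<mu>"
  proof -
    have "(\<Inter>n. (T ^^ n) -` A0 \<inter> space \<mu>) \<in> sets \<mu>"
      using measurable_sets[OF Tnm A0] by (intro sets.countable_INT) auto
    moreover have "A = (\<Inter>n. (T ^^ n) -` A0 \<inter> space \<mu>)" by (auto simp: A_def sp)
    ultimately show ?thesis by simp
  qed
  have AEA: "AE x in \<mu>. x \<in> A"
  proof -
    have "AE x in \<mu>. \<sigma> (p ((T ^^ n) x)) = (T ^^ n) x" for n
    proof (induction n)
      case (Suc n)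
      have "AE x in distr \<mu> \<mu> T. \<sigma> (p ((T ^^ n) x)) = (T ^^ n) x" unfolding d by (rule Suc)
      from AE_distrD[OF Tm this] show ?case by (simp add: funpow_swap1)
    qed (use \<sigma>(2) in simp)
    then have "AE x in \<mu>. \<forall>n. \<sigma> (p ((T ^^ n) x)) = (T ^^ n) x" by (simp add: AE_all_countable)
    then show ?thesis
      by (rule AE_mp) (auto intro!: AE_I2 simp: A_def A0_def sp iter_in)
  qed
  have TA: "T x \<in> A" if "x \<in> A" for x
    using that T_in by (auto simp: A_def funpow_swap1[symmetric] dest: spec[of _ "Suc _"])
  have A_X: "x \<in> X" "\<sigma> (p x) = x" if "x \<in> A" for x
    using that by (auto simp: A_def A0_def dest: spec[of _ 0])
  \<comment> \<open>This is the image of \<open>A\<close> under \<open>p\<close>, expressed through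
    \<open>\<sigma>\<close> so that its measurability is a matter of preimages.\<close>
  define B where "B = {y \<in> Y. \<sigma> y \<in> A \<and> p (\<sigma> y) = y}"
  have pA: "p x \<in> B" if "x \<in> A" for x using A_X[OF that] that pT by (simp add: B_def)
  have B: "B \<in> sets R"
  proof -
    have "{y \<in> space R. p (\<sigma> y) = y} \<in> sets R"
      using measurable_compose[OF \<sigma>m pm]
      by (intro measurable_set_eq_of_compact[OF cY]) (auto simp: R_def)
    moreover have "\<sigma> -` A \<inter> space R \<in> sets R" using measurable_sets[OF \<sigma>m A] .
    moreover have "B = {y \<in> space R. p (\<sigma> y) = y} \<inter> (\<sigma> -` A \<inter> space R)" by (auto simp: B_def sR)
    ultimately show ?thesis by simp
  qed
  have bij: "bij_betw p A B"
    by (rule bij_betw_byWitness[where f'=\<sigma>]) (use A_X pA in \<open>auto simp: B_def\<close>)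
  have inv: "inv_into A p y = \<sigma> y" if "y \<in> B" for y
    using that bij by (intro inv_into_f_eq) (auto simp: B_def bij_betw_def)
  have SB: "S y \<in> B" if "y \<in> B" for y
  proof -
    have "\<sigma> y \<in> A" "p (\<sigma> y) = y" using that by (auto simp: B_def)
    then show ?thesis using pA[OF TA[of "\<sigma> y"]] pT(1) A_X(1) by metis
  qed
  have \<nu>B: "emeasure \<nu> (space \<nu> - B) = 0"
  proof -
    have "emeasure \<nu> (space \<nu> - B) = emeasure \<mu> (p -` (space R - B) \<inter> space \<mu>)"
      unfolding \<nu>_def using pm B by (subst emeasure_distr) auto
    also have "\<dots> = 0"
    proof -
      have "AE x in \<mu>. x \<notin> p -` (space R - B) \<inter> space \<mu>" using AEA by eventually_elim (use pA in auto)
      moreover have "p -` (space R - B) \<inter> space \<mu> \<in> sets \<mu>" using pm B by (intro measurable_sets) auto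
      ultimately show ?thesis
        using AE_iff_measurable[of "p -` (space R - B) \<inter> space \<mu>" \<mu> "\<lambda>x. x \<notin> p -` (space R - B) \<inter> space \<mu>"]
        by auto
    qed
    finally show ?thesis .
  qed
  have \<mu>A: "emeasure \<mu> (space \<mu> - A) = 0"
    using AE_iff_measurable[of "space \<mu> - A" \<mu> "\<lambda>x. x \<in> A"] A AEA by auto
  show ?thesis
    unfolding measure_theoretic_isomorphism_def R_def[symmetric] \<nu>_def[symmetric]
  proof (intro conjI bexI[of _ A] bexI[of _ B])
    show "p \<in> measurable \<mu> \<nu>" using pm by (simp add: \<nu>_def)
    show "distr \<mu> \<nu> p = \<nu>" unfolding \<nu>_def by (intro distr_cong) auto
    show "inv_into A p \<in> measurable (restrict_space \<nu> B) (restrict_space \<mu> A)"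
    proof (rule measurable_restrict_space2)
      show "inv_into A p \<in> space (restrict_space \<nu> B) \<rightarrow> A"
        using inv by (auto simp: space_restrict_space B_def)
      have "\<sigma> \<in> measurable (restrict_space \<nu> B) \<mu>"
        using \<sigma>m by (intro measurable_restrict_space1) (simp add: \<nu>_def)
      then show "inv_into A p \<in> measurable (restrict_space \<nu> B) \<mu>"
        using inv by (subst measurable_cong[where g=\<sigma>]) (auto simp: space_restrict_space)
    qed
  qed (use TA SB \<mu>A \<nu>B bij A B pT A_X in \<open>auto simp: \<nu>_def\<close>)
qed

theorem (in mean_equicontinuous_system) isomorphic_maximal_factor:
  assumes max: "maximal_equicontinuous_factor X T Y S p"
  shows "isomorphic_factor_map X T Y S p"
proof -
  have Y: "tds Y S" and eq: "equicontinuous_tds Y S" and p: "factor_map X T Y S p"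
    using max by (auto simp: maximal_equicontinuous_factor_def)
  interpret Y: mean_equicontinuous_system Y S
    using Y minimal_factor[OF p] equicontinuous_imp_mean_equicontinuous[OF eq] by unfold_locales
  obtain \<mu> where \<mu>: "invariant_prob X T \<mu>" using invariant_prob_exists by blast
  interpret mean_equicontinuous_prob X T \<mu> using \<mu> by unfold_locales
  have pX: "p ` X = Y" and pc: "continuous_on X p" using p by (auto simp: factor_map_def)
  obtain \<sigma> where \<sigma>: "\<sigma> \<in> measurable (restrict_space borel Y) \<mu>" "AE x in \<mu>. \<sigma> (p x) = x"
    using almost_inverse_exists[OF pc mean_dist_zero_on_fibres[OF max]] unfolding pX by blast
  define \<nu> where "\<nu> = distr \<mu> (restrict_space borel Y) p"
  have \<nu>: "invariant_prob Y S \<nu>" unfolding \<nu>_def by (rule invariant_prob_factor[OF \<mu> p Y])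
  have "{m. invariant_prob X T m} = {\<mu>}" using \<mu> invariant_prob_unique by blast
  moreover have "{m. invariant_prob Y S m} = {\<nu>}" using \<nu> Y.invariant_prob_unique by blast
  moreover have "measure_theoretic_isomorphism \<mu> T \<nu> S p"
    unfolding \<nu>_def by (rule isomorphism_of_almost_inverse[OF \<mu> p Y \<sigma>])
  ultimately show ?thesis unfolding isomorphic_factor_map_def by blast
qed

section \<open>Frequent stability and small fibres\<close>

context mean_equicontinuous_system
begin

text \<open>Closedness in the topology of the pseudometric \<open>mean_dist T\<close>, stated on
  \<open>X\<close> to stay off the quotient space.\<close>

definition mean_dist_closed :: "'a set \<Rightarrow> bool" where
  "mean_dist_closed C \<longleftrightarrow>
     (\<forall>w\<in>X. w \<notin> C \<longrightarrow> (\<exists>s>0. \<forall>v\<in>X. mean_dist T w v < s \<longrightarrow> v \<notin> C))"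

text \<open>The finite case of the Baire argument: a ball not contained in \<open>C N\<close> has in
  it a smaller ball that misses \<open>C N\<close>, and so is covered by the remaining sets.\<close>

lemma mean_dist_closed_finite_cover:
  fixes C :: "nat \<Rightarrow> 'a set"
  assumes C: "\<And>j. j < N \<Longrightarrow> mean_dist_closed (C j)"
    and "w \<in> X" "r > 0" "\<And>v. v \<in> X \<Longrightarrow> mean_dist T w v < r \<Longrightarrow> \<exists>j<N. v \<in> C j"
  obtains j w' r' where "j < N" "w' \<in> X" "r' > 0" "\<And>v. v \<in> X \<Longrightarrow> mean_dist T w' v < r' \<Longrightarrow> v \<in> C j"
proof -
  have "\<exists>j w' r'. j < N \<and> w' \<in> X \<and> r' > 0 \<and> (\<forall>v\<in>X. mean_dist T w' v < r' \<longrightarrow> v \<in> C j)"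
    using assms
  proof (induction N arbitrary: w r)
    case 0
    then show ?case using mean_dist_self[of T w] by (metis not_less_zero)
  next
    case (Suc N)
    show ?case
    proof (cases "\<forall>v\<in>X. mean_dist T w v < r \<longrightarrow> v \<in> C N")
      case True
      then show ?thesis using Suc.prems(2,3) by blast
    next
      case False
      then obtain v where v: "v \<in> X" "mean_dist T w v < r" "v \<notin> C N" by blast
      then obtain s where s: "s > 0" "\<And>u. u \<in> X \<Longrightarrow> mean_dist T v u < s \<Longrightarrow> u \<notin> C N"
        using Suc.prems(1)[of N] unfolding mean_dist_closed_def by blast
      define t where "t = min s (r - mean_dist T w v)"
      have "\<exists>j<N. u \<in> C j" if u: "u \<in> X" "mean_dist T v u < t" for u
      proof -
        have "mean_dist T w u < r"
          using mean_dist_triangle[OF Suc.prems(2) v(1) u(1)] u(2) by (simp add: t_def)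
        then obtain j where "j < Suc N" "u \<in> C j" using Suc.prems(4) u(1) by blast
        moreover have "u \<notin> C N" using s(2) u by (simp add: t_def)
        ultimately show ?thesis by (metis less_Suc_eq)
      qed
      moreover have "t > 0" using s(1) v(2) by (simp add: t_def)
      ultimately have "\<exists>j w' r'. j < N \<and> w' \<in> X \<and> r' > 0 \<and> (\<forall>v\<in>X. mean_dist T w' v < r' \<longrightarrow> v \<in> C j)"
        using Suc.prems(1) v(1) by (intro Suc.IH[of v t]) auto
      then show ?thesis using less_SucI by blast
    qed
  qed
  then show ?thesis using that by blast
qed

text \<open>The factor map onto the quotient by \<open>mean_dist T\<close> is semi-open: finitely many preimages of a
  small ball cover \<open>X\<close>, and \<open>T\<close> is a surjective isometry for \<open>mean_dist T\<close>.\<close>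

lemma mean_dist_ball_in_saturation:
  assumes x: "x \<in> X" and d: "d > 0"
  obtains x1 r where "x1 \<in> X" "r > 0"
    "\<And>w. w \<in> X \<Longrightarrow> mean_dist T x1 w < r \<Longrightarrow> \<exists>u\<in>X \<inter> ball x d. mean_dist T w u = 0"
proof -
  \<comment> \<open>The closed ball of half the radius is compact, so its saturation
    \<open>Q\<close> is closed for \<open>mean_dist T\<close>.\<close>
  define K where "K = X \<inter> cball x (d / 2)"
  have K: "compact K" "x \<in> K" "K \<subseteq> X \<inter> ball x d"
    using compact_X x d by (auto simp: K_def compact_Int_closed)
  define Q where "Q = {w \<in> X. \<exists>u\<in>K. mean_dist T w u = 0}"
  have Q: "mean_dist_closed Q"
    unfolding mean_dist_closed_def
  proof (intro ballI impI)
    fix w assume w: "w \<in> X" "w \<notin> Q"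
    have "continuous_on K (mean_dist T w)"
      using K(3) w(1) by (intro continuous_on_mean_dist continuous_on_id continuous_on_const) auto
    then obtain u0 where u0: "u0 \<in> K" "\<forall>u\<in>K. mean_dist T w u0 \<le> mean_dist T w u"
      using continuous_attains_inf[OF K(1)] K(2) by blast
    have pos: "mean_dist T w u0 > 0"
      using u0(1) w K(3) mean_dist_nonneg[of w u0] by (auto simp: Q_def less_le)
    show "\<exists>s>0. \<forall>v\<in>X. mean_dist T w v < s \<longrightarrow> v \<notin> Q"
    proof (intro exI[of _ "mean_dist T w u0"] conjI ballI impI pos notI)
      fix v assume v: "v \<in> X" "mean_dist T w v < mean_dist T w u0" "v \<in> Q"
      then obtain u where u: "u \<in> K" "mean_dist T v u = 0" by (auto simp: Q_def)
      then have "mean_dist T w u \<le> mean_dist T w v"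
        using mean_dist_triangle[OF w(1) v(1), of u] K(3) by auto
      then show False using u0(2) u(1) v(2) by force
    qed
  qed
  have "x \<in> ball x (d / 2) \<inter> X" using x d by simp
  then have "ball x (d / 2) \<inter> X \<noteq> {}" by blast
  then obtain N where N: "\<And>w. w \<in> X \<Longrightarrow> \<exists>j\<le>N. (T ^^ j) w \<in> ball x (d / 2)"
    using uniformly_visits_open[OF open_ball] by metis
  \<comment> \<open>Uniform visits make the first \<open>Suc N\<close> preimages of \<open>Q\<close>
    cover \<open>X\<close>, so one of them contains a ball for \<open>mean_dist T\<close>.\<close>
  define C where "C j = {w \<in> X. (T ^^ j) w \<in> Q}" for j
  have C: "mean_dist_closed (C j)" for j
    unfolding mean_dist_closed_def
  proof (intro ballI impI)
    fix w assume w: "w \<in> X" "w \<notin> C j"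
    then obtain s where s: "s > 0" "\<And>v. v \<in> X \<Longrightarrow> mean_dist T ((T ^^ j) w) v < s \<Longrightarrow> v \<notin> Q"
      using Q iter_in[OF w(1), of j] unfolding mean_dist_closed_def C_def by blast
    then show "\<exists>s>0. \<forall>v\<in>X. mean_dist T w v < s \<longrightarrow> v \<notin> C j"
      using iter_in mean_dist_iter[OF w(1)] by (intro exI[of _ s]) (auto simp: C_def)
  qed
  have "\<exists>j<Suc N. v \<in> C j" if v: "v \<in> X" for v
  proof -
    obtain j where j: "j \<le> N" "(T ^^ j) v \<in> ball x (d / 2)" using N[OF v] by blast
    then have "(T ^^ j) v \<in> K" using iter_in[OF v] by (auto simp: K_def)
    then have "v \<in> C j" using v iter_in[OF v] by (auto simp: C_def Q_def intro!: bexI[of _ "(T ^^ j) v"])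
    then show ?thesis using j(1) less_Suc_eq_le by blast
  qed
  then obtain j w r where w: "w \<in> X" "r > 0" "\<And>v. v \<in> X \<Longrightarrow> mean_dist T w v < r \<Longrightarrow> v \<in> C j"
    using mean_dist_closed_finite_cover[of "Suc N" C x 1] C x by (metis zero_less_one)
  show ?thesis
  \<comment> \<open>\<open>T ^^ j\<close> maps the ball around \<open>w\<close> onto the ball of the
    same radius around its image, which therefore lies in \<open>Q\<close>.\<close>
  proof (rule that[OF iter_in[OF w(1), of j] w(2)])
    fix v assume v: "v \<in> X" "mean_dist T ((T ^^ j) w) v < r"
    obtain v' where v': "v' \<in> X" "v = (T ^^ j) v'" using iter_surj[of j] v(1) by blast
    then have "v' \<in> C j" using v(2) w by (simp add: mean_dist_iter)
    then show "\<exists>u\<in>X \<inter> ball x d. mean_dist T v u = 0" using v' K(3) by (auto simp: C_def Q_def)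
  qed
qed

end

section \<open>From a frequently stable ball to small fibres\<close>

lemma infdist_ge_dist_minus_diameter:
  assumes "bounded S" "c \<in> S" shows "dist z c - diameter S \<le> infdist z S"
proof -
  have "dist z c - diameter S \<le> dist z s" if "s \<in> S" for s
    using diameter_bounded_bound[OF assms(1) that assms(2)] dist_triangle[of z c s] by linarith
  moreover have "S \<noteq> {}" using assms(2) by blast
  ultimately show ?thesis by (simp add: infdist_notempty cINF_greatest)
qed

lemma upper_density_less_1D:
  assumes "upper_density F < 1"
  obtains c where "c < 1" "\<forall>\<^sub>F n in sequentially. real (card (F \<inter> {..<n})) \<le> c * real n"
proof -
  obtain c :: ereal where c: "upper_density F < c" "c < 1" using dense[OF assms] by blast
  moreover have "0 \<le> upper_density F"
    unfolding upper_density_def by (intro le_Limsup always_eventually) auto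
  ultimately obtain c' where c': "c = ereal c'" by (cases c) auto
  have "\<forall>\<^sub>F n in sequentially. ereal (real (card (F \<inter> {..<n})) / real n) < c"
    using c(1) unfolding upper_density_def by (rule Limsup_lessD)
  then have "\<forall>\<^sub>F n in sequentially. real (card (F \<inter> {..<n})) \<le> c' * real n"
    using eventually_gt_at_top[of 0]
  proof eventually_elim
    case (elim n)
    then show ?case using c' by (simp add: field_simps)
  qed
  then show ?thesis using that[of c'] c(2) c' by simp
qed

text \<open>The complement of \<open>F\<close> has positive lower density, so terms of size at least
  \<open>e\<close> there would keep the averages away from 0.\<close>

lemma small_term_off_thin_set:
  fixes a :: "nat \<Rightarrow> real"
  assumes F: "upper_density F < 1" and a: "\<And>i. 0 \<le> a i"
    and lim: "(\<lambda>n. (\<Sum>i=1..n. a i) / real n) \<longlonglongrightarrow> 0" and e: "e > 0"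
  obtains i where "i \<notin> F" "a i < e"
proof (rule ccontr)
  assume "\<not> thesis"
  then have "\<not> (i \<notin> F \<and> a i < e)" for i using that by blast
  then have ge: "a i \<ge> e" if "i \<notin> F" for i using that by (meson not_le)
  obtain c where c: "c < 1" "\<forall>\<^sub>F n in sequentially. real (card (F \<inter> {..<n})) \<le> c * real n"
    using upper_density_less_1D[OF F] .
  have "(\<lambda>n. inverse (real n)) \<longlonglongrightarrow> 0" by (rule lim_inverse_n)
  then have "\<forall>\<^sub>F n in sequentially. inverse (real n) < (1 - c) / 2"
    using c(1) by (intro order_tendstoD) auto
  moreover have "\<forall>\<^sub>F n in sequentially. (\<Sum>i=1..n. a i) / real n < e * ((1 - c) / 2)"
    using c(1) e by (intro order_tendstoD[OF lim]) auto
  ultimately have "\<forall>\<^sub>F n :: nat in sequentially. False"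
    using c(2) eventually_gt_at_top[of 0]
  proof eventually_elim
    case (elim n)
    have "real n = real (card (F \<inter> {..<n})) + real (card ({..<n} - F))"
    proof -
      have "{..<n} = (F \<inter> {..<n}) \<union> ({..<n} - F)" by blast
      then have "card {..<n} = card (F \<inter> {..<n}) + card ({..<n} - F)"
        by (metis card_Un_disjoint finite_Diff finite_Int finite_lessThan Int_Diff Diff_disjoint inf_commute Diff_Int_distrib2 Int_Diff_disjoint)
      then show ?thesis by simp
    qed
    \<comment> \<open>Density counts \<open>0\<close> to \<open>n - 1\<close>, the averages run from
      \<open>1\<close> to \<open>n\<close>. The index 0 costs one element, which half of the margin
      \<open>1 - c\<close> absorbs.\<close>
    moreover have "real (card ({..<n} - F)) \<le> real (card ({1..n} - F)) + 1"
    proof -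
      have "{..<n} - F \<subseteq> insert 0 ({1..n} - F)" by auto
      then have "card ({..<n} - F) \<le> card (insert 0 ({1..n} - F))" by (intro card_mono) auto
      also have "\<dots> \<le> card ({1..n} - F) + 1" by (simp add: card_insert_if)
      finally show ?thesis by linarith
    qed
    ultimately have "(1 - c) * real n - 1 \<le> real (card ({1..n} - F))"
      using elim(3) by (simp add: algebra_simps)
    then have "e * ((1 - c) * real n - 1) \<le> e * real (card ({1..n} - F))" using e by simp
    also have "\<dots> \<le> (\<Sum>i\<in>{1..n} - F. a i)"
      using sum_bounded_below[of "{1..n} - F" e a] ge by (simp add: mult.commute)
    also have "\<dots> \<le> (\<Sum>i=1..n. a i)" using a by (intro sum_mono2) auto
    also have "\<dots> < e * ((1 - c) / 2) * real n" using elim(2,4) by (simp add: pos_divide_less_eq)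
    finally have "e * ((1 - c) * real n - 1) < e * ((1 - c) / 2 * real n)" by (simp add: mult.assoc)
    then have "(1 - c) * real n - 1 < (1 - c) / 2 * real n" using e by simp
    moreover have "1 < (1 - c) / 2 * real n" using elim(1,4) by (simp add: field_simps)
    ultimately show False by (simp add: algebra_simps)
  qed
  then show False by simp
qed

text \<open>At times off \<open>F\<close> the set \<open>V i\<close> has diameter at most
  \<open>\<epsilon>\<close>, and at suitable such times the moved \<open>mean_dist T\<close>-ball
  has small weighted distance to \<open>V i\<close>. Its radius \<open>r\<close> stays fixed, so
  only the centres have to converge.\<close>

lemma (in mean_equicontinuous_prob) small_mean_dist_ball:
  assumes x: "x \<in> X" and fs: "frequently_stable_point X T x" and \<epsilon>: "\<epsilon> > 0"
  obtains x2 r where "x2 \<in> X" "r > 0"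
    "\<And>z z'. z \<in> X \<Longrightarrow> z' \<in> X \<Longrightarrow> mean_dist T x2 z < r \<Longrightarrow> mean_dist T x2 z' < r \<Longrightarrow> dist z z' \<le> 2 * \<epsilon>"
proof -
  obtain d where d: "d > 0" "upper_density {i. diameter ((T ^^ i) ` (X \<inter> ball x d)) > \<epsilon>} < 1"
    using fs \<epsilon> unfolding frequently_stable_point_def by blast
  define V where "V i = (T ^^ i) ` (X \<inter> ball x d)" for i
  define F where "F = {i. diameter (V i) > \<epsilon>}"
  have F: "upper_density F < 1" using d(2) by (simp add: F_def V_def)
  have xV: "(T ^^ i) x \<in> V i" for i using x d(1) by (auto simp: V_def)
  have VX: "V i \<subseteq> X" for i using iter_in by (auto simp: V_def)
  obtain x1 r where x1: "x1 \<in> X" and r: "r > 0"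
    and sat: "\<And>w. w \<in> X \<Longrightarrow> mean_dist T x1 w < r \<Longrightarrow> \<exists>u\<in>X \<inter> ball x d. mean_dist T w u = 0"
    using mean_dist_ball_in_saturation[OF x d(1)] by blast
  obtain B where B: "B > 0" "\<And>x y. x \<in> X \<Longrightarrow> y \<in> X \<Longrightarrow> dist x y \<le> B"
    by (rule diameter_bound) blast
  have ck: "continuous_on X (kernel r y)" if "y \<in> X" for y
    using that by (intro continuous_on_kernel continuous_on_id continuous_on_const) auto
  define g where "g i w = infdist ((T ^^ i) w) (V i)" for i w
  have gc: "continuous_on X (g i)" for i
    unfolding g_def by (intro continuous_on_infdist continuous_iter)
  have g0: "0 \<le> g i w" for i w by (simp add: g_def infdist_nonneg)
  have gB: "g i w \<le> B" if "w \<in> X" for i w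
    using infdist_le[OF xV, of "(T ^^ i) w" i] B(2)[OF iter_in[OF that] iter_in[OF x], of i i] by (simp add: g_def)
  \<comment> \<open>A point \<open>w\<close> of the ball around \<open>x1\<close> is at mean
    distance 0 from some \<open>u\<close> in \<open>ball x d\<close>, whose iterates lie in
    \<open>V i\<close>; hence the averages of \<open>a\<close> tend to 0.\<close>
  define a where "a i = (LINT w|\<mu>. kernel r x1 w * g i w)" for i
  have cg: "continuous_on X (\<lambda>w. kernel r x1 w * g i w)" for i
    by (intro continuous_on_mult ck[OF x1] gc)
  have a0: "0 \<le> a i" for i
    unfolding a_def by (intro integral_nonneg_AE AE_I2 mult_nonneg_nonneg kernel_nonneg g0)
  define h where "h n w = (\<Sum>i=1..n. g i w) / real n" for n w
  have h0: "0 \<le> h n w" for n w by (simp add: h_def sum_nonneg g0)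
  have hB: "h n w \<le> B" if "w \<in> X" for n w
  proof -
    have "(\<Sum>i=1..n. g i w) \<le> real (card {1..n}) * B" using gB[OF that] by (intro sum_bounded_above) auto
    then show ?thesis using B(1) by (cases "n = 0") (simp_all add: h_def field_simps)
  qed
  have "(\<lambda>n. LINT w|\<mu>. kernel r x1 w * h n w) \<longlonglongrightarrow> (LINT w|\<mu>. 0)"
  proof (rule integral_dominated_convergence[where w="\<lambda>_. r * B"])
    show "(\<lambda>w. kernel r x1 w * h n w) \<in> borel_measurable \<mu>" for n
      unfolding h_def divide_inverse
      by (intro continuous_on_borel_measurable_restrict[OF sets_\<mu>] continuous_on_mult continuous_on_sum gc ck[OF x1] continuous_on_const)
    show "AE w in \<mu>. (\<lambda>n. kernel r x1 w * h n w) \<longlonglongrightarrow> 0"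
    proof (intro AE_I2)
      fix w assume "w \<in> space \<mu>"
      then have w: "w \<in> X" using space_\<mu> by simp
      show "(\<lambda>n. kernel r x1 w * h n w) \<longlonglongrightarrow> 0"
      proof (cases "mean_dist T x1 w < r")
        case True
        obtain u where u: "u \<in> X \<inter> ball x d" "mean_dist T w u = 0" using sat[OF w True] by blast
        have "(\<lambda>n. h n w) \<longlonglongrightarrow> 0"
        proof (rule LIMSEQ_I)
          fix e :: real assume e: "e > 0"
          have "\<forall>\<^sub>F n in sequentially. avg_dist T n w u < e" using u e by (intro mean_dist_lessD w) auto
          then have "\<forall>\<^sub>F n in sequentially. norm (h n w - 0) < e"
          proof eventually_elim
            case (elim n)
            have "h n w \<le> avg_dist T n w u"
              unfolding h_def avg_dist_def g_def using u(1)
              by (intro divide_right_mono sum_mono infdist_le) (auto simp: V_def)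
            then show ?case using elim h0[of n w] by simp
          qed
          then show "\<exists>no. \<forall>n\<ge>no. norm (h n w - 0) < e" by (simp add: eventually_sequentially)
        qed
        from tendsto_mult[OF tendsto_const this] show ?thesis by simp
      qed (simp add: kernel_def)
    qed
    show "AE w in \<mu>. norm (kernel r x1 w * h n w) \<le> r * B" for n
      using kernel_le[OF x1 _ r] kernel_nonneg h0 hB space_\<mu> r
      by (intro AE_I2) (auto simp: abs_mult intro!: mult_mono)
  qed auto
  moreover have "(LINT w|\<mu>. kernel r x1 w * h n w) = (\<Sum>i=1..n. a i) / real n" for n
  proof -
    have "(LINT w|\<mu>. kernel r x1 w * h n w) = (LINT w|\<mu>. (\<Sum>i=1..n. kernel r x1 w * g i w) / real n)"
      by (simp add: h_def sum_distrib_left)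
    then show ?thesis using integrable_continuous[OF cg] by (simp add: a_def)
  qed
  ultimately have avg: "(\<lambda>n. (\<Sum>i=1..n. a i) / real n) \<longlonglongrightarrow> 0" by simp
  have "\<forall>k. \<exists>i. i \<notin> F \<and> a i < inverse (real (Suc k))"
  proof
    fix k :: nat
    have "inverse (real (Suc k)) > 0" by simp
    from small_term_off_thin_set[OF F a0 avg this] show "\<exists>i. i \<notin> F \<and> a i < inverse (real (Suc k))" by blast
  qed
  then obtain i where i: "\<And>k. i k \<notin> F" "\<And>k. a (i k) < inverse (real (Suc k))" by metis
  \<comment> \<open>\<open>V i\<close> is replaced by one of its points, at the cost of
    \<open>\<epsilon>\<close>. Unlike the distance to \<open>V i\<close>, this integrand depends
    continuously on data from a compact set.\<close>
  define q where "q y c z = kernel r y z * max 0 (dist z c - \<epsilon>)" for y c z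
  have qc: "continuous_on X (q y c)" if "y \<in> X" for y c
    unfolding q_def
    by (intro continuous_on_mult ck[OF that] continuous_on_max continuous_on_diff continuous_on_dist continuous_on_id continuous_on_const)
  \<comment> \<open>Substituting \<open>z = (T ^^ i k) w\<close> preserves \<open>\<mu>\<close> and
    recentres the kernel at the iterate of \<open>x1\<close>.\<close>
  have qa: "(LINT z|\<mu>. q ((T ^^ i k) x1) ((T ^^ i k) x) z) \<le> a (i k)" for k
  proof -
    let ?n = "i k"
    let ?f = "\<lambda>z. kernel r ((T ^^ ?n) x1) z * infdist z (V ?n)"
    have fc: "continuous_on X ?f"
      by (intro continuous_on_mult ck iter_in x1 continuous_on_infdist continuous_on_id)
    have "a ?n = (LINT w|\<mu>. ?f ((T ^^ ?n) w))"
      unfolding a_def g_def using space_\<mu>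
      by (intro Bochner_Integration.integral_cong refl) (simp add: kernel_iter x1)
    also have "\<dots> = integral\<^sup>L \<mu> ?f" by (rule invariant_prob_integral_iter[OF invariant fc])
    finally have "a ?n = integral\<^sup>L \<mu> ?f" .
    moreover have "(LINT z|\<mu>. q ((T ^^ ?n) x1) ((T ^^ ?n) x) z) \<le> integral\<^sup>L \<mu> ?f"
    proof (intro integral_mono integrable_continuous fc qc iter_in x1)
      fix z
      have "dist z ((T ^^ ?n) x) - \<epsilon> \<le> infdist z (V ?n)"
        using infdist_ge_dist_minus_diameter[OF bounded_subset[OF compact_imp_bounded[OF compact_X] VX] xV, of z ?n]
          i(1)[of k] by (simp add: F_def)
      then show "q ((T ^^ ?n) x1) ((T ^^ ?n) x) z \<le> ?f z"
        unfolding q_def using infdist_nonneg[of z "V ?n"] kernel_nonneg by (intro mult_left_mono) auto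
    qed
    ultimately show ?thesis by simp
  qed
  obtain l s where l: "l \<in> X \<times> X" "strict_mono (s :: nat \<Rightarrow> nat)"
    "((\<lambda>k. ((T ^^ i k) x1, (T ^^ i k) x)) \<circ> s) \<longlonglongrightarrow> l"
    using compact_Times[OF compact_X compact_X] iter_in x1 x unfolding compact_def
    by (metis (mono_tags, lifting) mem_Sigma_iff)
  obtain x2 c where lx: "l = (x2, c)" by (cases l)
  have x2: "x2 \<in> X" and cX: "c \<in> X" using l(1) lx by auto
  define xs where "xs k = (T ^^ i (s k)) x1" for k
  define cs where "cs k = (T ^^ i (s k)) x" for k
  have xs: "xs \<longlonglongrightarrow> x2" "cs \<longlonglongrightarrow> c" "\<And>k. xs k \<in> X" "\<And>k. cs k \<in> X"
    using tendsto_fst[OF l(3)] tendsto_snd[OF l(3)] iter_in x1 x by (auto simp: lx xs_def[abs_def] cs_def[abs_def] comp_def)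
  have "(\<lambda>k. LINT z|\<mu>. q (xs k) (cs k) z) \<longlonglongrightarrow> (LINT z|\<mu>. q x2 c z)"
  proof (rule integral_dominated_convergence[where w="\<lambda>_. r * B"])
    show "AE z in \<mu>. (\<lambda>k. q (xs k) (cs k) z) \<longlonglongrightarrow> q x2 c z"
    proof (intro AE_I2)
      fix z assume "z \<in> space \<mu>"
      then have z: "z \<in> X" using space_\<mu> by simp
      have "continuous_on X (\<lambda>y. kernel r y z)"
        using z by (intro continuous_on_kernel continuous_on_id continuous_on_const) auto
      then have "(\<lambda>k. kernel r (xs k) z) \<longlonglongrightarrow> kernel r x2 z"
        using xs(3) by (intro continuous_on_tendsto_compose[OF _ xs(1) x2]) auto
      then show "(\<lambda>k. q (xs k) (cs k) z) \<longlonglongrightarrow> q x2 c z"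
        unfolding q_def by (intro tendsto_mult tendsto_max tendsto_diff tendsto_dist tendsto_const xs(2))
    qed
    show "AE z in \<mu>. norm (q (xs k) (cs k) z) \<le> r * B" for k
    proof (intro AE_I2)
      fix z assume "z \<in> space \<mu>"
      then have z: "z \<in> X" using space_\<mu> by simp
      have "max 0 (dist z (cs k) - \<epsilon>) \<le> B" using B(2)[OF z xs(4), of k] B(1) \<epsilon> by simp
      then have "q (xs k) (cs k) z \<le> r * B"
        unfolding q_def using kernel_le[OF xs(3) z r] kernel_nonneg r by (intro mult_mono) auto
      moreover have "0 \<le> q (xs k) (cs k) z" unfolding q_def by (intro mult_nonneg_nonneg kernel_nonneg) simp
      ultimately show "norm (q (xs k) (cs k) z) \<le> r * B" by simp
    qed
  qed (use borel_measurable_integrable[OF integrable_continuous[OF qc]] x2 xs(3) in auto)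
  moreover have "(\<lambda>k. inverse (real (Suc (s k)))) \<longlonglongrightarrow> 0"
    using LIMSEQ_subseq_LIMSEQ[OF LIMSEQ_inverse_real_of_nat l(2)] by (simp add: comp_def)
  moreover have "(LINT z|\<mu>. q (xs k) (cs k) z) \<le> inverse (real (Suc (s k)))" for k
    using qa[of "s k"] i(2)[of "s k"] by (simp add: xs_def cs_def)
  ultimately have q0: "(LINT z|\<mu>. q x2 c z) \<le> 0" by (meson LIMSEQ_le)
  \<comment> \<open>Full support: the limit integrand is continuous and nonnegative with integral at
    most 0, so it has no positive value.\<close>
  have close: "dist z c \<le> \<epsilon>" if z: "z \<in> X" "mean_dist T x2 z < r" for z
  proof (rule ccontr)
    assume "\<not> ?thesis"
    then have "q x2 c z > 0" using z(2) by (simp add: q_def kernel_def)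
    then have "(LINT z|\<mu>. q x2 c z) > 0"
      using z(1) by (intro invariant_prob_full_support[OF invariant qc[OF x2]]) (auto simp: q_def kernel_nonneg)
    then show False using q0 by simp
  qed
  show ?thesis
  proof (rule that[OF x2 r])
    fix z z' assume "z \<in> X" "z' \<in> X" "mean_dist T x2 z < r" "mean_dist T x2 z' < r"
    then show "dist z z' \<le> 2 * \<epsilon>" using close[of z] close[of z'] dist_triangle2[of z z' c] by simp
  qed
qed

text \<open>Small \<open>mean_dist T\<close>-balls appear around some \<open>x2\<close> whose
  position is not controlled. At most \<open>N\<close> steps bring \<open>x2\<close> near a
  prescribed point, and \<open>N\<close> is fixed before \<open>\<epsilon>\<close>, so that
  \<open>\<epsilon>\<close> can be chosen against the distortion of the first \<open>N\<close>
  iterates.\<close>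

theorem (in mean_equicontinuous_system) almost_one_to_one_maximal_factor:
  assumes max: "maximal_equicontinuous_factor X T Y S p" and fs: "frequently_stable X T"
  shows "almost_one_to_one X Y p"
proof -
  have p: "factor_map X T Y S p" and Y: "tds Y S"
    using max by (auto simp: maximal_equicontinuous_factor_def)
  have pX: "p ` X = Y" and pc: "continuous_on X p" using p by (auto simp: factor_map_def)
  have cY: "compact Y" using Y by (simp add: tds_def)
  obtain \<mu> where \<mu>: "invariant_prob X T \<mu>" using invariant_prob_exists by blast
  interpret mean_equicontinuous_prob X T \<mu> using \<mu> by unfold_locales
  define U where "U n = {y \<in> Y. \<forall>x\<in>X. \<forall>x'\<in>X. p x = y \<longrightarrow> p x' = y \<longrightarrow> dist x x' < 1 / real (Suc n)}" for n
  have "openin (top_of_set Y) (U n)" for n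
  proof -
    \<comment> \<open>Pairs in one fibre that are too far apart. This set is compact, so the points
      of \<open>Y\<close> below it form a closed set, the complement of \<open>U n\<close> in
      \<open>Y\<close>.\<close>
    define L where "L = {q \<in> X \<times> X. p (fst q) = p (snd q) \<and> 1 / real (Suc n) \<le> dist (fst q) (snd q)}"
    have c1: "continuous_on (X \<times> X) (\<lambda>q. p (fst q))" "continuous_on (X \<times> X) (\<lambda>q. p (snd q))"
      by (auto intro!: continuous_on_compose2[OF pc] continuous_intros)
    have "closed {q \<in> X \<times> X. dist (p (fst q)) (p (snd q)) \<le> 0}"
      using compact_X by (intro continuous_on_closed_Collect_le continuous_on_dist c1 continuous_on_const closed_Times compact_imp_closed)
    moreover have "closed {q \<in> X \<times> X. 1 / real (Suc n) \<le> dist (fst q) (snd q)}"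
      using compact_X by (intro continuous_on_closed_Collect_le continuous_intros closed_Times compact_imp_closed)
    moreover have "L = (X \<times> X) \<inter> ({q \<in> X \<times> X. dist (p (fst q)) (p (snd q)) \<le> 0}
        \<inter> {q \<in> X \<times> X. 1 / real (Suc n) \<le> dist (fst q) (snd q)})" by (auto simp: L_def)
    ultimately have "compact L"
      by (simp only: compact_Int_closed compact_Times compact_X closed_Int)
    moreover have "continuous_on L (\<lambda>q. p (fst q))" by (rule continuous_on_subset[OF c1(1)]) (auto simp: L_def)
    ultimately have "closed ((\<lambda>q. p (fst q)) ` L)" by (intro compact_imp_closed compact_continuous_image)
    moreover have "U n = Y \<inter> - ((\<lambda>q. p (fst q)) ` L)"
    proof (intro set_eqI iffI)
      fix y assume y: "y \<in> U n"
      then show "y \<in> Y \<inter> - ((\<lambda>q. p (fst q)) ` L)"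
        by (fastforce simp: U_def L_def not_less[symmetric])
    next
      fix y assume y: "y \<in> Y \<inter> - ((\<lambda>q. p (fst q)) ` L)"
      have "dist x x' < 1 / real (Suc n)" if "x \<in> X" "x' \<in> X" "p x = y" "p x' = y" for x x'
      proof (rule ccontr)
        assume "\<not> ?thesis"
        then have "(x, x') \<in> L" using that by (simp add: L_def)
        then show False using y that(3) by force
      qed
      then show "y \<in> U n" using y by (auto simp: U_def)
    qed
    ultimately show ?thesis by (auto intro: openin_open_Int)
  qed
  moreover have "Y \<subseteq> closure (U n)" for n
  proof
    fix y assume y: "y \<in> Y"
    show "y \<in> closure (U n)"
      unfolding closure_approachable
    proof (intro allI impI)
      fix e :: real assume e: "e > 0"
      obtain x0 where x0: "x0 \<in> X" "p x0 = y" using y pX by blast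
      obtain d where d: "d > 0" "\<And>u. u \<in> X \<Longrightarrow> dist u x0 < d \<Longrightarrow> dist (p u) (p x0) < e"
        using pc x0(1) e unfolding continuous_on_iff by metis
      have "x0 \<in> ball x0 d \<inter> X" using x0(1) d(1) by simp
      then have "ball x0 d \<inter> X \<noteq> {}" by blast
      then obtain N where N: "\<And>w. w \<in> X \<Longrightarrow> \<exists>j\<le>N. (T ^^ j) w \<in> ball x0 d"
        using uniformly_visits_open[OF open_ball] by metis
      have "\<exists>\<epsilon>>0. \<forall>j\<le>N. \<forall>z\<in>X. \<forall>z'\<in>X. dist z z' < \<epsilon> \<longrightarrow> dist ((T ^^ j) z) ((T ^^ j) z') < 1 / real (Suc n)"
      proof (induction N)
        case 0
        show ?case by (intro exI[of _ "1 / real (Suc n)"]) auto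
      next
        case (Suc N)
        then obtain \<epsilon>1 where \<epsilon>1: "\<epsilon>1 > 0" "\<forall>j\<le>N. \<forall>z\<in>X. \<forall>z'\<in>X. dist z z' < \<epsilon>1 \<longrightarrow>
            dist ((T ^^ j) z) ((T ^^ j) z') < 1 / real (Suc n)" by blast
        have "0 < 1 / real (Suc n)" by simp
        then obtain \<epsilon>2 where \<epsilon>2: "\<epsilon>2 > 0" "\<forall>z\<in>X. \<forall>z'\<in>X. dist z' z < \<epsilon>2 \<longrightarrow>
            dist ((T ^^ Suc N) z') ((T ^^ Suc N) z) < 1 / real (Suc n)"
          using compact_uniformly_continuous[OF continuous_iter compact_X, of "Suc N"]
          unfolding uniformly_continuous_on_def by blast
        show ?case
        proof (intro exI[of _ "min \<epsilon>1 \<epsilon>2"] conjI allI impI ballI)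
          fix j z z' assume j: "j \<le> Suc N" and z: "z \<in> X" "z' \<in> X" "dist z z' < min \<epsilon>1 \<epsilon>2"
          show "dist ((T ^^ j) z) ((T ^^ j) z') < 1 / real (Suc n)"
          proof (cases "j = Suc N")
            case True
            then show ?thesis using \<epsilon>2(2) z by (simp del: funpow.simps)
          next
            case False
            then show ?thesis using \<epsilon>1(2) z j by simp
          qed
        qed (use \<epsilon>1(1) \<epsilon>2(1) in auto)
      qed
      then obtain \<epsilon> where \<epsilon>: "\<epsilon> > 0" "\<And>j z z'. j \<le> N \<Longrightarrow> z \<in> X \<Longrightarrow> z' \<in> X \<Longrightarrow> dist z z' < \<epsilon> \<Longrightarrow>
          dist ((T ^^ j) z) ((T ^^ j) z') < 1 / real (Suc n)" by metis
      have fs0: "frequently_stable_point X T x0" using fs x0(1) by (simp add: frequently_stable_def)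
      have "\<epsilon> / 3 > 0" using \<epsilon>(1) by simp
      then obtain x2 r where x2: "x2 \<in> X" "r > 0"
        "\<And>z z'. z \<in> X \<Longrightarrow> z' \<in> X \<Longrightarrow> mean_dist T x2 z < r \<Longrightarrow> mean_dist T x2 z' < r \<Longrightarrow> dist z z' \<le> 2 * (\<epsilon> / 3)"
        using small_mean_dist_ball[OF x0(1) fs0] by metis
      obtain j where j: "j \<le> N" "(T ^^ j) x2 \<in> ball x0 d" using N[OF x2(1)] by blast
      define y' where "y' = p ((T ^^ j) x2)"
      have "dist y' y < e"
        using d(2)[OF iter_in[OF x2(1)], of j] j(2) x0(2) by (simp add: y'_def dist_commute)
      moreover have "y' \<in> U n"
      proof -
        \<comment> \<open>\<open>T ^^ j\<close> is onto, so each point over \<open>y'\<close> comes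
          from a point at mean distance 0 from \<open>x2\<close>.\<close>
        have fib: "\<exists>w\<in>X. z = (T ^^ j) w \<and> mean_dist T x2 w < r" if z: "z \<in> X" "p z = y'" for z
        proof -
          obtain w where w: "w \<in> X" "z = (T ^^ j) w" using iter_surj[of j] z(1) by blast
          have "mean_dist T ((T ^^ j) x2) z = 0"
            using mean_dist_zero_on_fibres[OF max iter_in[OF x2(1)] z(1), of j] z(2) by (simp add: y'_def)
          then have "mean_dist T x2 w = 0" using w x2(1) by (simp add: mean_dist_iter)
          then show ?thesis using w x2(2) by auto
        qed
        have "dist z z' < 1 / real (Suc n)" if z: "z \<in> X" "z' \<in> X" "p z = y'" "p z' = y'" for z z'
        proof -
          obtain w w' where w: "w \<in> X" "z = (T ^^ j) w" "mean_dist T x2 w < r"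
            "w' \<in> X" "z' = (T ^^ j) w'" "mean_dist T x2 w' < r" using fib z by blast
          have "dist w w' < \<epsilon>" using x2(3)[OF w(1,4,3,6)] \<epsilon>(1) by linarith
          then show ?thesis using \<epsilon>(2)[OF j(1) w(1,4)] w by simp
        qed
        then show ?thesis using iter_in[OF x2(1)] pX by (auto simp: U_def y'_def)
      qed
      ultimately show "\<exists>y'\<in>U n. dist y' y < e" by blast
    qed
  qed
  moreover have "(\<Inter>n. U n) \<subseteq> {y \<in> Y. card {x \<in> X. p x = y} = 1}"
  proof
    fix y assume y: "y \<in> (\<Inter>n. U n)"
    then have yY: "y \<in> Y" by (auto simp: U_def)
    then obtain x where x: "x \<in> X" "p x = y" using pX by blast
    have "x' = x" if x': "x' \<in> X" "p x' = y" for x'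
    proof (rule ccontr)
      assume "x' \<noteq> x"
      then obtain n where "1 / real (Suc n) < dist x' x" by (metis nat_approx_posE zero_less_dist_iff)
      moreover have "dist x' x < 1 / real (Suc n)" using y x x' unfolding U_def by blast
      ultimately show False by simp
    qed
    then have "{x \<in> X. p x = y} = {x}" using x by blast
    then show "y \<in> {y \<in> Y. card {x \<in> X. p x = y} = 1}" using yY by simp
  qed
  ultimately show ?thesis unfolding almost_one_to_one_def residual_in_def by blast
qed

section \<open>Isomorphic and almost one-to-one factor maps\<close>

text \<open>The Baire category theorem in the compact subspace \<open>Y\<close>. It supplies the one
  singleton fibre on which frequent stability is built.\<close>

lemma residual_in_compact_nonempty:
  fixes Y :: "'a::metric_space set"
  assumes Y: "compact Y" "Y \<noteq> {}" and A: "residual_in Y A"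
  shows "A \<noteq> {}"
proof -
  obtain U where U: "\<And>n::nat. openin (top_of_set Y) (U n)" "\<And>n. Y \<subseteq> closure (U n)" "(\<Inter>n. U n) \<subseteq> A"
    using A unfolding residual_in_def by blast
  have comp: "compact_space (top_of_set Y)" using Y(1) by (simp add: compact_space_subtopology)
  have "(top_of_set Y) closure_of \<Inter>(range U) = topspace (top_of_set Y)"
  proof (rule Baire_category)
    show "completely_metrizable_space (top_of_set Y)
        \<or> locally_compact_space (top_of_set Y) \<and> regular_space (top_of_set Y)"
      using compact_imp_locally_compact_space[OF comp]
        metrizable_imp_regular_space[OF metrizable_space_subtopology[OF metrizable_space_euclidean]] by blast
    fix V assume "V \<in> range U"
    then obtain n where n: "V = U n" by blast
    have "U n \<subseteq> Y" using openin_subset[OF U(1)[of n]] by simp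
    then show "openin (top_of_set Y) V \<and> top_of_set Y closure_of V = topspace (top_of_set Y)"
      using U(1,2)[of n] n by (auto simp: closure_of_subtopology Int_absorb1)
  qed simp
  then have "\<Inter>(range U) \<noteq> {}" using Y(2) by auto
  then show ?thesis using U(3) by auto
qed

text \<open>Each block of length \<open>M = N + 1\<close> contains a point outside \<open>F\<close>,
  namely \<open>f k\<close> in block \<open>k\<close>. The incomplete last block costs
  \<open>1 / n\<close>, hence the final bound \<open>1 - 1 / (2 * M)\<close>.\<close>

lemma upper_density_less_1_of_syndetic_complement:
  assumes N: "\<And>i. \<exists>j\<le>N. i + j \<notin> F"
  shows "upper_density F < 1"
proof -
  define M where "M = Suc N"
  obtain j where j: "\<And>i. j i \<le> N" "\<And>i. i + j i \<notin> F" using N by metis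
  have le: "real (card (F \<inter> {..<n})) / real n \<le> 1 - 1 / real M + 1 / real n" if n: "n > 0" for n
  proof -
    define f where "f k = k * M + j (k * M)" for k
    have "j (k * M) < M" for k using j(1)[of "k * M"] by (simp add: M_def)
    moreover have "M \<noteq> 0" by (simp add: M_def)
    ultimately have fk: "f k div M = k" for k by (simp add: f_def)
    have "f k < n" if "k < n div M" for k
    proof -
      have "f k < Suc k * M" using j(1)[of "k * M"] by (simp add: f_def M_def)
      also have "\<dots> \<le> n div M * M" using that by (intro mult_right_mono) auto
      also have "\<dots> \<le> n" by simp
      finally show ?thesis .
    qed
    then have "f ` {..<n div M} \<subseteq> {..<n} - F" using j(2) by (auto simp: f_def)
    then have "card (f ` {..<n div M}) \<le> card ({..<n} - F)" by (intro card_mono) auto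
    moreover have "inj_on f {..<n div M}" using fk by (intro inj_on_inverseI)
    ultimately have "n div M \<le> card ({..<n} - F)" by (simp add: card_image)
    moreover have "card ({..<n} - F) + card (F \<inter> {..<n}) = n"
    proof -
      have "card (({..<n} - F) \<union> (F \<inter> {..<n})) = card ({..<n} - F) + card (F \<inter> {..<n})"
        by (intro card_Un_disjoint) auto
      moreover have "({..<n} - F) \<union> (F \<inter> {..<n}) = {..<n}" by blast
      ultimately show ?thesis by simp
    qed
    ultimately have "real (card (F \<inter> {..<n})) \<le> real n - real (n div M)" by linarith
    moreover have "real n / real M - 1 \<le> real (n div M)"
    proof -
      have "n < Suc (n div M) * M" using dividend_less_div_times[of M n] \<open>M \<noteq> 0\<close> by simp
      then have "real n < (real (n div M) + 1) * real M" by (metis of_nat_Suc of_nat_less_iff of_nat_mult add.commute)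
      then show ?thesis by (simp add: M_def field_simps)
    qed
    ultimately have "real (card (F \<inter> {..<n})) \<le> (1 - 1 / real M + 1 / real n) * real n"
      using n by (simp add: algebra_simps)
    then show ?thesis using n by (simp add: pos_divide_le_eq)
  qed
  have M: "0 < 1 / (2 * real M)" by (simp add: M_def)
  have "\<forall>\<^sub>F n in sequentially. 1 / real n < 1 / (2 * real M)"
    using lim_1_over_n[where 'a=real] M by (rule order_tendstoD)
  then have "\<forall>\<^sub>F n in sequentially. ereal (real (card (F \<inter> {..<n})) / real n) \<le> ereal (1 - 1 / (2 * real M))"
    using eventually_gt_at_top[of 0]
  proof eventually_elim
    case (elim n)
    then show ?case using le[of n] by (simp add: field_simps)
  qed
  then have "upper_density F \<le> ereal (1 - 1 / (2 * real M))"
    unfolding upper_density_def by (rule Limsup_bounded)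
  also have "\<dots> < 1" using M by simp
  finally show ?thesis .
qed

text \<open>Near a singleton fibre, closeness in the factor forces closeness in \<open>X\<close>.
  Equicontinuity keeps the images of \<open>ball x d\<close> together in the factor at all times, so
  each visit of \<open>x\<close> to \<open>ball x0 d'\<close> makes the moved ball small, and these
  visits are syndetic.\<close>

lemma (in minimal_system) frequently_stable_of_singleton_fibre:
  assumes p: "factor_map X T Y S p" and eq: "equicontinuous_tds Y S"
    and y0: "{z \<in> X. p z = y0} = {x0}"
  shows "frequently_stable X T"
  unfolding frequently_stable_def frequently_stable_point_def
proof (intro ballI allI impI)
  fix x and e :: real assume x: "x \<in> X" and e: "e > 0"
  have pc: "continuous_on X p" and pY: "\<And>z. z \<in> X \<Longrightarrow> p z \<in> Y" using p by (auto simp: factor_map_def)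
  have x0: "x0 \<in> X" "p x0 = y0" using y0 by auto
  obtain c where c: "c > 0" "\<And>z. z \<in> X \<Longrightarrow> dist (p z) y0 < c \<Longrightarrow> dist z x0 < e / 2"
  proof (rule compact_zero_set_control[OF compact_X, of "\<lambda>z. dist (p z) y0" "\<lambda>z. dist z x0" "e / 2"])
    show "dist z x0 \<le> 0" if "z \<in> X" "dist (p z) y0 \<le> 0" for z using that y0 by auto
  qed (use e in \<open>auto intro!: continuous_on_dist pc continuous_on_id continuous_on_const\<close>)
  have "c / 2 > 0" using c(1) by simp
  then obtain b where b: "b > 0" "\<And>u v n. u \<in> Y \<Longrightarrow> v \<in> Y \<Longrightarrow> dist u v < b \<Longrightarrow>
      dist ((S ^^ n) u) ((S ^^ n) v) < c / 2"
    using eq unfolding equicontinuous_tds_def by metis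
  obtain d where d: "d > 0" "\<And>z. z \<in> X \<Longrightarrow> dist z x < d \<Longrightarrow> dist (p z) (p x) < b"
    using pc x b(1) unfolding continuous_on_iff by metis
  obtain d' where d': "d' > 0" "\<And>z. z \<in> X \<Longrightarrow> dist z x0 < d' \<Longrightarrow> dist (p z) (p x0) < c / 2"
    using pc x0(1) \<open>c / 2 > 0\<close> unfolding continuous_on_iff by metis
  have "x0 \<in> ball x0 d' \<inter> X" using x0(1) d'(1) by simp
  then have "ball x0 d' \<inter> X \<noteq> {}" by blast
  then obtain N where N: "\<And>w. w \<in> X \<Longrightarrow> \<exists>j\<le>N. (T ^^ j) w \<in> ball x0 d'"
    using uniformly_visits_open[OF open_ball] by metis
  have small: "diameter ((T ^^ i) ` (X \<inter> ball x d)) \<le> e" if i: "(T ^^ i) x \<in> ball x0 d'" for i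
  proof -
    have near: "dist ((T ^^ i) z) x0 < e / 2" if z: "z \<in> X" "dist x z < d" for z
    proof -
      have "dist (p z) (p x) < b" using d(2)[OF z(1)] z(2) dist_commute[of x z] by simp
      then have "dist (p ((T ^^ i) z)) (p ((T ^^ i) x)) < c / 2"
        using b(2)[OF pY[OF z(1)] pY[OF x]] by (simp add: factor_map_iter[OF p] z x)
      moreover have "dist (p ((T ^^ i) x)) y0 < c / 2"
        using d'(2)[OF iter_in[OF x], of i] i x0(2) by (simp add: dist_commute)
      ultimately have "dist (p ((T ^^ i) z)) y0 < c"
        using dist_triangle[of "p ((T ^^ i) z)" y0 "p ((T ^^ i) x)"] by linarith
      then show ?thesis using c(2) iter_in[OF z(1)] by blast
    qed
    have "dist u v \<le> e" if "u \<in> (T ^^ i) ` (X \<inter> ball x d)" "v \<in> (T ^^ i) ` (X \<inter> ball x d)" for u v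
    proof -
      have "dist u x0 < e / 2" "dist v x0 < e / 2" using near that by auto
      then show ?thesis using dist_triangle2[of u v x0] by linarith
    qed
    then show ?thesis using e unfolding diameter_def by (auto intro!: cSUP_least)
  qed
  have "upper_density {i. e < diameter ((T ^^ i) ` (X \<inter> ball x d))} < 1"
  proof (rule upper_density_less_1_of_syndetic_complement[of N])
    fix i
    obtain j where j: "j \<le> N" "(T ^^ j) ((T ^^ i) x) \<in> ball x0 d'" using N[OF iter_in[OF x]] by blast
    then have "(T ^^ (i + j)) x \<in> ball x0 d'" by (simp add: funpow_add add.commute[of i])
    from small[OF this] j(1) show "\<exists>j\<le>N. i + j \<notin> {i. e < diameter ((T ^^ i) ` (X \<inter> ball x d))}"
      by (intro exI[of _ j]) simp
  qed
  then show "\<exists>\<delta>>0. upper_density {i. e < diameter ((T ^^ i) ` (X \<inter> ball x \<delta>))} < 1" using d(1) by blast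
qed

text \<open>Otherwise the empirical measures of pairs of orbits witnessing the failure subconverge to an
  invariant measure on \<open>X \<times> X\<close> with both marginals \<open>\<mu>\<close>, carried by the pairs in a common fibre, hence
  by the diagonal, although the distance has positive integral.\<close>

theorem (in topological_system) mean_equicontinuous_of_isomorphic:
  assumes p: "factor_map X T Y S p" and eq: "equicontinuous_tds Y S"
    and iso: "isomorphic_factor_map X T Y S p"
  shows "mean_equicontinuous X T"
  unfolding mean_equicontinuous_def avg_dist_def[symmetric]
proof (intro allI impI, rule ccontr)
  fix e :: real
  assume e: "e > 0" and no: "\<not> (\<exists>\<delta>>0. \<forall>x\<in>X. \<forall>y\<in>X. dist x y \<le> \<delta> \<longrightarrow>
      limsup (\<lambda>n. ereal (avg_dist T n x y)) \<le> ereal e)"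
  have bad: "\<exists>x\<in>X. \<exists>y\<in>X. dist x y \<le> \<delta> \<and> \<not> limsup (\<lambda>n. ereal (avg_dist T n x y)) \<le> ereal e"
    if "\<delta> > 0" for \<delta>
    using no that by blast
  \<comment> \<open>A limsup above \<open>e\<close> gives times beyond any bound, so the lengths
    tend to infinity while the initial distances tend to 0.\<close>
  have "\<exists>x y n. x \<in> X \<and> y \<in> X \<and> dist x y \<le> inverse (real (Suc k)) \<and> n \<ge> Suc k \<and> avg_dist T n x y > e" for k
  proof -
    obtain x y where xy: "x \<in> X" "y \<in> X" "dist x y \<le> inverse (real (Suc k))"
      "\<not> limsup (\<lambda>n. ereal (avg_dist T n x y)) \<le> ereal e"
      using bad[of "inverse (real (Suc k))"] by auto
    have "\<not> (\<forall>\<^sub>F n in sequentially. ereal (avg_dist T n x y) \<le> ereal e)"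
      using xy(4) Limsup_bounded[of "\<lambda>n. ereal (avg_dist T n x y)" "ereal e" sequentially] by argo
    then obtain n where "n \<ge> Suc k" "avg_dist T n x y > e"
      unfolding eventually_sequentially by (auto simp: not_le)
    then show ?thesis using xy by blast
  qed
  then obtain x y N where xy: "\<And>k. x k \<in> X" "\<And>k. y k \<in> X" "\<And>k. dist (x k) (y k) \<le> inverse (real (Suc k))"
    and N: "\<And>k. N k \<ge> Suc k" "\<And>k. avg_dist T (N k) (x k) (y k) > e" by metis
  obtain r L where r: "strict_mono r" and L: "prob_space L" and sL: "sets L = sets (restrict_space borel (X \<times> X))"
    and lim: "\<And>f :: 'a \<times> 'a \<Rightarrow> real. continuous_on (X \<times> X) f \<Longrightarrow>
      (\<lambda>k. (\<Sum>i=1..N (r k). f ((T ^^ i) (x (r k)), (T ^^ i) (y (r k)))) / real (N (r k))) \<longlonglongrightarrow> integral\<^sup>L L f"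
  proof (rule empirical_measures_subsequence[OF compact_Times[OF compact_X compact_X],
        of N "\<lambda>k i. ((T ^^ i) (x k), (T ^^ i) (y k))"])
    show "0 < N k" for k using N(1)[of k] by simp
  qed (use iter_in xy in auto)
  interpret L: prob_space L by (rule L)
  note spL = space_restrict_borel_eq[OF sL]
  have Ninf: "filterlim (\<lambda>k. N (r k)) at_top sequentially"
  proof (rule filterlim_at_top_mono[OF filterlim_subseq[OF r]])
    show "\<forall>\<^sub>F k in sequentially. r k \<le> N (r k)" using N(1) Suc_leD by (intro always_eventually) blast
  qed
  define R where "R = (restrict_space borel X :: 'a measure)"
  have fm: "fst \<in> measurable L R" and sm: "snd \<in> measurable L R"
    unfolding R_def
    by (rule continuous_on_measurable_restrict[OF sL refl continuous_on_fst[OF continuous_on_id]], force)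
      (rule continuous_on_measurable_restrict[OF sL refl continuous_on_snd[OF continuous_on_id]], force)
  have marg: "invariant_prob X T (distr L R f)"
    if f: "f \<in> measurable L R" "continuous_on (X \<times> X) f" "f ` (X \<times> X) \<subseteq> X"
      and z: "\<And>k. z k \<in> X" "\<And>k i. f ((T ^^ i) (x k), (T ^^ i) (y k)) = (T ^^ i) (z k)" for f z
  proof (rule empirical_limit_invariant[where N="\<lambda>k. N (r k)" and x="\<lambda>k. z (r k)"])
    show "prob_space (distr L R f)" using f(1) by (rule L.prob_space_distr)
    fix h :: "'a \<Rightarrow> real" assume h: "continuous_on X h"
    have "integral\<^sup>L (distr L R f) h = (LINT q|L. h (f q))"
      using f(1) h by (intro integral_distr) (auto simp: R_def borel_measurable_continuous_on_restrict)
    moreover have "continuous_on (X \<times> X) (\<lambda>q. h (f q))"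
      using f(2,3) by (intro continuous_on_compose2[OF h])
    ultimately show "(\<lambda>k. (\<Sum>i=1..N (r k). h ((T ^^ i) (z (r k)))) / real (N (r k))) \<longlonglongrightarrow> integral\<^sup>L (distr L R f) h"
      using lim[of "\<lambda>q. h (f q)"] by (simp add: z(2))
  qed (use Ninf z in \<open>auto simp: R_def\<close>)
  obtain \<mu> \<nu> where \<mu>: "{m. invariant_prob X T m} = {\<mu>}" and mi: "measure_theoretic_isomorphism \<mu> T \<nu> S p"
    using iso unfolding isomorphic_factor_map_def by blast
  have s\<mu>: "sets \<mu> = sets (restrict_space borel X)" using \<mu> by (auto simp: invariant_prob_def)
  note sp\<mu> = space_restrict_borel_eq[OF s\<mu>]
  have "invariant_prob X T (distr L R fst)"
    by (rule marg[of fst x]) (use fm xy(1) in \<open>auto intro!: continuous_intros\<close>)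
  moreover have "invariant_prob X T (distr L R snd)"
    by (rule marg[of snd y]) (use sm xy(2) in \<open>auto intro!: continuous_intros\<close>)
  ultimately have d: "distr L R fst = \<mu>" "distr L R snd = \<mu>" using \<mu> by blast+
  obtain A B where A: "A \<in> sets \<mu>" "emeasure \<mu> (space \<mu> - A) = 0" and bij: "bij_betw p A B"
    using mi unfolding measure_theoretic_isomorphism_def by blast
  have AE\<mu>: "AE z in \<mu>. z \<in> A" using A by (intro AE_I[of _ _ "space \<mu> - A"]) auto
  have "AE q in L. fst q \<in> A" "AE q in L. snd q \<in> A"
    using AE_distrD[OF fm, of "\<lambda>z. z \<in> A"] AE_distrD[OF sm, of "\<lambda>z. z \<in> A"] AE\<mu> unfolding d by auto
  moreover have "AE q in L. dist (p (fst q)) (p (snd q)) = 0"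
  proof -
    have pc: "continuous_on X p" and pY: "\<And>z. z \<in> X \<Longrightarrow> p z \<in> Y" using p by (auto simp: factor_map_def)
    define f where "f q = dist (p (fst q)) (p (snd q))" for q
    have fc: "continuous_on (X \<times> X) f"
      unfolding f_def by (intro continuous_on_dist continuous_on_compose2[OF pc] continuous_intros) auto
    \<comment> \<open>Equicontinuity of the factor bounds all terms uniformly in \<open>i\<close>
      once the starting points are close.\<close>
    have "(\<lambda>k. (\<Sum>i=1..N k. f ((T ^^ i) (x k), (T ^^ i) (y k))) / real (N k)) \<longlonglongrightarrow> 0"
    proof (rule LIMSEQ_I)
      fix c :: real assume "c > 0"
      then have "c / 2 > 0" by simp
      then obtain b where b: "b > 0" "\<And>u v n. u \<in> Y \<Longrightarrow> v \<in> Y \<Longrightarrow> dist u v < b \<Longrightarrow>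
          dist ((S ^^ n) u) ((S ^^ n) v) < c / 2"
        using eq unfolding equicontinuous_tds_def by metis
      obtain a where a: "a > 0" "\<And>u v. u \<in> X \<Longrightarrow> v \<in> X \<Longrightarrow> dist v u < a \<Longrightarrow> dist (p v) (p u) < b"
        using compact_uniformly_continuous[OF pc compact_X] b(1) unfolding uniformly_continuous_on_def by metis
      have "\<forall>\<^sub>F k in sequentially. inverse (real (Suc k)) < a"
        using order_tendstoD(2)[OF LIMSEQ_inverse_real_of_nat a(1)] .
      then have "\<forall>\<^sub>F k in sequentially. norm ((\<Sum>i=1..N k. f ((T ^^ i) (x k), (T ^^ i) (y k))) / real (N k) - 0) < c"
      proof eventually_elim
        case (elim k)
        then have "dist (p (x k)) (p (y k)) < b" using a(2) xy by (meson le_less_trans)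
        then have "f ((T ^^ i) (x k), (T ^^ i) (y k)) \<le> c / 2" for i
          using b(2)[OF pY[OF xy(1)] pY[OF xy(2)], of k k i]
          by (simp add: f_def factor_map_iter[OF p] xy)
        then have "(\<Sum>i=1..N k. f ((T ^^ i) (x k), (T ^^ i) (y k))) \<le> real (card {1..N k}) * (c / 2)"
          by (intro sum_bounded_above)
        then have "(\<Sum>i=1..N k. f ((T ^^ i) (x k), (T ^^ i) (y k))) / real (N k) \<le> c / 2"
          using N(1)[of k] by (simp add: pos_divide_le_eq mult.commute)
        moreover have "0 \<le> (\<Sum>i=1..N k. f ((T ^^ i) (x k), (T ^^ i) (y k))) / real (N k)"
          by (simp add: f_def sum_nonneg)
        ultimately show ?case using \<open>c > 0\<close> unfolding diff_0_right real_norm_def by linarith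
      qed
      then show "\<exists>no. \<forall>k\<ge>no. norm ((\<Sum>i=1..N k. f ((T ^^ i) (x k), (T ^^ i) (y k))) / real (N k) - 0) < c"
        unfolding eventually_sequentially .
    qed
    from LIMSEQ_unique[OF lim[OF fc] LIMSEQ_subseq_LIMSEQ[OF this r, unfolded comp_def]]
    have "integral\<^sup>L L f = 0" .
    moreover have "integrable L f"
      using compact_X by (intro integrable_continuous_on_compact[OF _ sL _ fc] compact_Times) unfold_locales
    ultimately show ?thesis
      by (subst (asm) integral_nonneg_eq_0_iff_AE) (auto simp: f_def)
  qed
  \<comment> \<open>Almost every pair has both entries in \<open>A\<close>, where \<open>p\<close>
    is injective.\<close>
  ultimately have "AE q in L. dist (fst q) (snd q) = 0"
  proof eventually_elim
    case (elim q)
    then show ?case using bij by (auto simp: bij_betw_def inj_on_def)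
  qed
  moreover have dc: "continuous_on (X \<times> X) (\<lambda>q. dist (fst q) (snd q))" by (intro continuous_intros)
  ultimately have "(LINT q|L. dist (fst q) (snd q)) = 0"
    using continuous_on_borel_measurable_restrict[OF sL dc] by (subst integral_cong_AE[where g="\<lambda>_. 0"]) auto
  moreover have "e \<le> (LINT q|L. dist (fst q) (snd q))"
    using lim[OF dc] N(2) by (intro tendsto_lowerbound[OF lim[OF dc]]) (auto simp: avg_dist_def intro!: always_eventually less_imp_le)
  ultimately show False using e by simp
qed

theorem corollary3p7:
  fixes X :: "'a::metric_space set" and T :: "'a \<Rightarrow> 'a"
    and X_eq :: "'b::metric_space set" and T_eq :: "'b \<Rightarrow> 'b" and \<pi>_eq :: "'a \<Rightarrow> 'b"
  assumes "tds X T"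
    and "minimal_tds X T"
    and "maximal_equicontinuous_factor X T X_eq T_eq \<pi>_eq"
  shows "isomorphic_factor_map X T X_eq T_eq \<pi>_eq \<and> almost_one_to_one X X_eq \<pi>_eq \<longleftrightarrow>
         mean_equicontinuous X T \<and> frequently_stable X T"
proof -
  interpret minimal_system X T using assms by unfold_locales
  have Y: "tds X_eq T_eq" and eq: "equicontinuous_tds X_eq T_eq" and p: "factor_map X T X_eq T_eq \<pi>_eq"
    using assms(3) by (auto simp: maximal_equicontinuous_factor_def)
  show ?thesis
  proof (intro iffI conjI; elim conjE)
    assume "isomorphic_factor_map X T X_eq T_eq \<pi>_eq"
    then show "mean_equicontinuous X T" by (rule mean_equicontinuous_of_isomorphic[OF p eq])
  next
    assume "almost_one_to_one X X_eq \<pi>_eq"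
    then have res: "residual_in X_eq {y \<in> X_eq. card {x \<in> X. \<pi>_eq x = y} = 1}"
      by (simp only: almost_one_to_one_def)
    have "compact X_eq" "X_eq \<noteq> {}" using Y by (auto simp: tds_def)
    from residual_in_compact_nonempty[OF this res] obtain y0 where "card {x \<in> X. \<pi>_eq x = y0} = 1"
      by blast
    then obtain x0 where "{x \<in> X. \<pi>_eq x = y0} = {x0}" by (rule card_1_singletonE)
    then show "frequently_stable X T" by (rule frequently_stable_of_singleton_fibre[OF p eq])
  next
    assume "mean_equicontinuous X T"
    then interpret mean_equicontinuous_system X T by unfold_locales
    show "isomorphic_factor_map X T X_eq T_eq \<pi>_eq" by (rule isomorphic_maximal_factor[OF assms(3)])
  next
    assume me: "mean_equicontinuous X T" and fs: "frequently_stable X T"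
    interpret mean_equicontinuous_system X T using me by unfold_locales
    show "almost_one_to_one X X_eq \<pi>_eq" by (rule almost_one_to_one_maximal_factor[OF assms(3) fs])
  qed
qed

end
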